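(* Let $(A,d,\cdot,\{E^k_{p,q}\}_{k\ge 0;\,p,q\ge 1})$ be an extended homotopy G-algebra over $\mathbb{Z}_2$, where $(A,d,\cdot)$ is augmented with augmentation ideal $\bar A$ and all operations $E^k_{p,q}$ restrict to $\bar A$ with values in $\bar A$. Then the bar construction $BA$, with its standard differential $d_{BA}$, its deconcatenation coproduct $\nabla$, and the products $\smile_k : BA\otimes BA\to BA$ ($k\ge 0$) determined by the operations $\{E^k_{p,q}\}$, is a DG-Hopf algebra with Steenrod $\smile_i$-products.
   Context: All vector spaces are graded over the field $\mathbb{Z}_2$ (so there are no signs), differentials have degree $+1$, and $T$ denotes the permutation $T(x\otimes y)=y\otimes x$. **Homotopy G-algebra.** A DG-algebra $(A,d,\cdot)$ with multilinear operations $E_{1,k}:A\otimes A^{\otimes k}\to A$, $k\ge 1$, of degree $-k$, with the convention $E_{1,0}=\mathrm{id}$, such that for all elements of $A$ and all $k,m,n\ge 1$: (i) $dE_{1,k}(a;b_1,\dots,b_k)+E_{1,k}(da;b_1,\dots,b_k)+\sum_i E_{1,k}(a;b_1,\dots,db_i,\dots,b_k)= b_1E_{1,k-1}(a;b_2,\dots,b_k)+\sum_i E_{1,k-1}(a;b_1,\dots,b_ib_{i+1},\dots,b_k)+E_{1,k-1}(a;b_1,\dots,b_{k-1})b_k$; (ii) $a_1E_{1,k}(a_2;b_1,\dots,b_k)+E_{1,k}(a_1 a_2;b_1,\dots,b_k)+E_{1,k}(a_1;b_1,\dots,b_k)a_2=\sum_{p=1}^{k-1}E_{1,p}(a_1;b_1,\dots,b_p)\,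 E_{1,k-p}(a_2;b_{p+1},\dots,b_k)$; (iii) $E_{1,n}(E_{1,m}(a;b_1,\dots,b_m);c_1,\dots,c_n)=\sum E_{1,n-\sum l_i+m}(a;c_1,\dots,c_{k_1},E_{1,l_1}(b_1;c_{k_1+1},\dots,c_{k_1+l_1}),c_{k_1+l_1+1},\dots,c_{k_m},E_{1,l_m}(b_m;c_{k_m+1},\dots,c_{k_m+l_m}),c_{k_m+l_m+1},\dots,c_n)$, the sum over all integers $k_i,l_i\ge 0$ with $0\le k_1\le k_1+l_1\le k_2\le k_2+l_2\le\dots\le k_m+l_m\le n$. **Extended homotopy G-algebra.** A DG-algebra $(A,d,\cdot)$ with multilinear operations $E^k_{p,q}:A^{\otimes p}\otimes A^{\otimes q}\to A$ ($k\ge 0$, $p,q\ge 1$) of degree $1-k-p-q$ such that $E^0_{p,q}=0$ for $p>1$, $(A,d,\cdot,\{E^0_{1,q}\})$ is a homotopy G-algebra, and the condition ( * ) below holds. Conventions: $E^0_{1,0}=E^0_{0,1}=\mathrm{id}_A$; every other $E^k_{p,0}$ and $E^k_{0,q}$ is $0$; $E^{-1}_{p,q}=0$; and $TE^{i}_{p,q}(x_1,\dots,x_p;y_1,\dots,y_q)=E^i_{q,p}(y_1,\dots,y_q;x_1,\dots,x_p)$, with $T^i$ the $i$-th iterate. For all $k\ge 0$, $m,n\ge 1$: $$( * )\quad \begin{array}{l} dE^k_{m,n}(a_1,\dots,a_m;b_1,\dots,b_n)+\sum_iE^k_{m,n}(a_1,\dots,da_i,\dots,a_m;b_1,\dots,b_n)\\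 +\sum_iE^k_{m,n}(a_1,\dots,a_m;b_1,\dots,db_i,\dots,b_n)\\ +\sum_{i}E^k_{m-1,n}(a_1,\dots,a_ia_{i+1},\dots,a_m;b_1,\dots,b_n)+\sum_{i}E^k_{m,n-1}(a_1,\dots,a_m;b_1,\dots,b_ib_{i+1},\dots,b_n)\\ +\sum_{i=0}^k\sum_{(p,q)}E^{i}_{p,q}(a_1,\dots,a_p;b_1,\dots,b_q)\cdot T^iE^{k-i}_{m-p,n-q}(a_{p+1},\dots,a_m;b_{q+1},\dots,b_n)\\ =E^{k-1}_{m,n}(a_1,\dots,a_m;b_1,\dots,b_n)+E^{k-1}_{n,m}(b_1,\dots,b_n;a_1,\dots,a_m),\end{array}$$ where $(p,q)$ ranges over all pairs with $0\le p\le m$, $0\le q\le n$, $(p,q)\ne(0,0),(m,n)$ (so the sum includes the terms $a_1E^k_{m-1,n}$, $E^k_{m-1,n}a_m$, $b_1E^k_{m,n-1}$, $E^k_{m,n-1}b_n$). **Bar construction.** $BA=T^c(s^{-1}\bar A)$ is the tensor coalgebra on the desuspension of $\bar A$ (so $[a]$ has degree $|a|-1$), with deconcatenation coproduct $\nabla$ and differential $d_{BA}[a_1|\dots|a_n]=\sum_i[a_1|\dots|da_i|\dots|a_n]+\sum_i[a_1|\dots|a_ia_{i+1}|\dots|a_n]$. **Products determined by the operations.** Define $E^k:BA\otimes BA\to A$ (of degree $1-k$) by $E^k([a_1|\dots|a_m]\otimes[b_1|\dots|b_n])=E^k_{m,n}(a_1,\dots,a_m;b_1,\dots,b_n)$,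 using the conventions above for $m=0$ or $n=0$, and $E^k(1\otimes 1)=0$. By cofreeness there are unique maps $\smile_k:BA\otimes BA\to BA$ with $1\smile_0 1=1$, $1\smile_k1=0$ for $k>0$, satisfying the decomposition rule (c) below, whose projections to $s^{-1}\bar A\cong\bar A$ are $E^k$. Explicitly, $\smile_k=\sum_{r}\sum_{k_1+\dots+k_r=k}(s^{-1}E^{k_1}\otimes s^{-1}E^{k_2}T^{k_1}\otimes s^{-1}E^{k_3}T^{k_1+k_2}\otimes\dots\otimes s^{-1}E^{k_r}T^{k_1+\dots+k_{r-1}})\nabla^{(r)}_{BA\otimes BA}$ with $\nabla^{(r)}_{BA\otimes BA}$ the $r$-fold iterated coproduct of $BA\otimes BA$ (the $r=0$ term being the counit onto $1$ for $k=0$). **DG-Hopf algebra with Steenrod products.** An object $(H,d,\nabla,\smile_0,\smile_1,\smile_2,\dots)$ such that: (a) $(H,d,\nabla)$ is a DG-coalgebra and $(H,d,\smile_0)$ is a DG-algebra; (b) $\smile_i:H\otimes H\to H$ has degree $-i$ and $d(x\smile_iy)=dx\smile_iy+x\smile_idy+x\smile_{i-1}y+y\smile_{i-1}x$ for all $i\ge 0$, with $\smile_{-1}=0$; (c) for all $n\ge 0$, $\nabla\circ\smile_n=\sum_{k=0}^n(\smile_k\otimes\,\smile_{n-k}\circ T^k_{H\otimes H})\circ\nabla_{H\otimes H}$, where $\nabla_{H\otimes H}=(\mathrm{id}\otimes T\otimes\mathrm{id})(\nabla\otimes\nabla)$. In particular $(H,d,\nabla,\smile_0)$ is a DG-Hopf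 algebra. *)

theory Defs
  imports Complex_Main "HOL-Library.Z2" "HOL-Library.Poly_Mapping"
begin

subsection \<open>Vector spaces over the two-element field\<close>

text \<open>A vector space over the field of two elements is the same as an abelian group in which
  every element is its own negative; the scalar multiplication is then forced to be the one below.
  Spans, subspaces and linear maps are the library's, at this scalar multiplication.\<close>

class z2_vector = ab_group_add +
  assumes add_self_zero: "x + x = 0"

definition z2_scale :: "bit \<Rightarrow> 'a::z2_vector \<Rightarrow> 'a" where
  "z2_scale c x = (if c = 0 then 0 else x)"

global_interpretation z2: vector_space "z2_scale :: bit \<Rightarrow> 'a::z2_vector \<Rightarrow> 'a"
  by standard (auto simp: z2_scale_def add_self_zero)

abbreviation z2_linear :: "('a::z2_vector \<Rightarrow> 'b::z2_vector) \<Rightarrow> bool" where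
  "z2_linear \<equiv> Vector_Spaces.linear z2_scale z2_scale"

lemma z2_linear_iff: "z2_linear f \<longleftrightarrow> (\<forall>x y. f (x + y) = f x + f y)"
proof
  assume f: "\<forall>x y. f (x + y) = f x + f y"
  then have "f 0 = 0"
    by (metis add_cancel_right_right)
  with f show "z2_linear f"
    by unfold_locales (auto simp: z2_scale_def)
qed (auto simp: Vector_Spaces.linear_iff)

lemma z2_diff_eq_add: "x - y = x + (y :: 'a::z2_vector)"
  using minus_unique[OF add_self_zero[of y]] by (simp flip: add_uminus_conv_diff)

instance bit :: z2_vector
  by standard simp

instance poly_mapping :: (type, z2_vector) z2_vector
  by standard (rule poly_mapping_eqI, simp add: lookup_add add_self_zero)

definition z2_bilinear :: "('a::z2_vector \<Rightarrow> 'b::z2_vector \<Rightarrow> 'c::z2_vector) \<Rightarrow> bool" where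
  "z2_bilinear f \<longleftrightarrow> (\<forall>y. z2_linear (\<lambda>x. f x y)) \<and> (\<forall>x. z2_linear (f x))"

text \<open>Linearity in every slot of a function taking the list of its arguments, for every number
  of arguments.\<close>

definition z2_multilinear :: "('a::z2_vector list \<Rightarrow> 'b::z2_vector) \<Rightarrow> bool" where
  "z2_multilinear f \<longleftrightarrow> (\<forall>us vs. z2_linear (\<lambda>x. f (us @ x # vs)))"


subsection \<open>Tensor products\<close>

definition tensor_relators :: "(('a::z2_vector \<times> 'b::z2_vector) \<Rightarrow>\<^sub>0 bit) set" where
  "tensor_relators =
     {Poly_Mapping.single (x + x', y) 1 - Poly_Mapping.single (x, y) 1
        - Poly_Mapping.single (x', y) 1 | x x' y. True} \<union>
     {Poly_Mapping.single (x, y + y') 1 - Poly_Mapping.single (x, y) 1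
        - Poly_Mapping.single (x, y') 1 | x y y'. True}"

lemma equivp_mod_span: "equivp (\<lambda>p q. p - q \<in> z2.span R)"
proof (intro equivpI reflpI sympI transpI)
  fix p q r
  show "p - p \<in> z2.span R"
    by (simp add: z2.span_zero)
  show "q - p \<in> z2.span R" if "p - q \<in> z2.span R"
    using z2.span_neg[OF that] by simp
  show "p - r \<in> z2.span R" if "p - q \<in> z2.span R" "q - r \<in> z2.span R"
    using z2.span_add[OF that] by simp
qed

lemma z2_span_add_congruent:
  "(p + q) - (p' + q') \<in> z2.span R" if "p - p' \<in> z2.span R" "q - q' \<in> z2.span R"
  using z2.span_add[OF that] by (simp add: algebra_simps)

lemma z2_span_diff_congruent:
  "(p - q) - (p' - q') \<in> z2.span R" if "p - p' \<in> z2.span R" "q - q' \<in> z2.span R"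
  using z2.span_diff[OF that] by (simp add: algebra_simps)

lemma z2_span_uminus_congruent:
  "(- p) - (- p') \<in> z2.span R" if "p - p' \<in> z2.span R"
  using z2.span_neg[OF that] by (simp add: algebra_simps)

quotient_type (overloaded) ('a, 'b) tensor =
  "('a::z2_vector \<times> 'b::z2_vector) \<Rightarrow>\<^sub>0 bit" / "\<lambda>p q. p - q \<in> z2.span tensor_relators"
  by (rule equivp_mod_span)

instantiation tensor :: (z2_vector, z2_vector) z2_vector
begin

lift_definition zero_tensor :: "('a, 'b) tensor" is 0 .
lift_definition plus_tensor :: "('a, 'b) tensor \<Rightarrow> ('a, 'b) tensor \<Rightarrow> ('a, 'b) tensor" is "(+)"
  by (rule z2_span_add_congruent)
lift_definition minus_tensor :: "('a, 'b) tensor \<Rightarrow> ('a, 'b) tensor \<Rightarrow> ('a, 'b) tensor" is "(-)"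
  by (rule z2_span_diff_congruent)
lift_definition uminus_tensor :: "('a, 'b) tensor \<Rightarrow> ('a, 'b) tensor" is uminus
  by (rule z2_span_uminus_congruent)

instance
  by standard (transfer; simp add: algebra_simps z2.span_zero add_self_zero)+

end

lift_definition pure_tensor ::
  "'a::z2_vector \<Rightarrow> 'b::z2_vector \<Rightarrow> ('a, 'b) tensor" (infixr "\<otimes>" 75)
  is "\<lambda>x y. Poly_Mapping.single (x, y) 1" .

text \<open>The linear map induced by a bilinear map.\<close>

definition tensor_lift ::
  "('a::z2_vector \<Rightarrow> 'b::z2_vector \<Rightarrow> 'c::z2_vector) \<Rightarrow> ('a, 'b) tensor \<Rightarrow> 'c" where
  "tensor_lift f = (THE g. z2_linear g \<and> (\<forall>x y. g (x \<otimes> y) = f x y))"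

definition tensor_map ::
  "('a::z2_vector \<Rightarrow> 'c::z2_vector) \<Rightarrow> ('b::z2_vector \<Rightarrow> 'd::z2_vector) \<Rightarrow>
   ('a, 'b) tensor \<Rightarrow> ('c, 'd) tensor" where
  "tensor_map f g = tensor_lift (\<lambda>x y. f x \<otimes> g y)"

definition tensor_swap :: "('a::z2_vector, 'b::z2_vector) tensor \<Rightarrow> ('b, 'a) tensor" where
  "tensor_swap = tensor_lift (\<lambda>x y. y \<otimes> x)"

definition tensor_assoc ::
  "(('a::z2_vector, 'b::z2_vector) tensor, 'c::z2_vector) tensor \<Rightarrow> ('a, ('b, 'c) tensor) tensor"
where
  "tensor_assoc = tensor_lift (\<lambda>u z. tensor_lift (\<lambda>x y. x \<otimes> (y \<otimes> z)) u)"

text \<open>The map id \<open>\<otimes>\<close> T \<open>\<otimes>\<close> id on a fourfold tensor product.\<close>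

definition tensor_mid_swap ::
  "(('a::z2_vector, 'b::z2_vector) tensor, ('c::z2_vector, 'd::z2_vector) tensor) tensor
     \<Rightarrow> (('a, 'c) tensor, ('b, 'd) tensor) tensor" where
  "tensor_mid_swap = tensor_lift (\<lambda>u v.
     tensor_lift (\<lambda>x y. tensor_lift (\<lambda>z w. (x \<otimes> z) \<otimes> (y \<otimes> w)) v) u)"

definition tensor_comult ::
  "('h::z2_vector \<Rightarrow> ('h, 'h) tensor) \<Rightarrow>
   ('h, 'h) tensor \<Rightarrow> (('h, 'h) tensor, ('h, 'h) tensor) tensor" where
  "tensor_comult \<Delta> = tensor_mid_swap \<circ> tensor_map \<Delta> \<Delta>"


subsection \<open>The tensor coalgebra as a vector space\<close>

text \<open>The direct sum of all tensor powers of a vector space: the free vector space on finite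
  words, modulo linearity in each letter.\<close>

definition word_relators :: "('a::z2_vector list \<Rightarrow>\<^sub>0 bit) set" where
  "word_relators =
     {Poly_Mapping.single (us @ (x + y) # vs) 1 - Poly_Mapping.single (us @ x # vs) 1
        - Poly_Mapping.single (us @ y # vs) 1 | us x y vs. True}"

quotient_type (overloaded) 'a tensors =
  "'a::z2_vector list \<Rightarrow>\<^sub>0 bit" / "\<lambda>p q. p - q \<in> z2.span word_relators"
  by (rule equivp_mod_span)

instantiation tensors :: (z2_vector) z2_vector
begin

lift_definition zero_tensors :: "'a tensors" is 0 .
lift_definition plus_tensors :: "'a tensors \<Rightarrow> 'a tensors \<Rightarrow> 'a tensors" is "(+)"
  by (rule z2_span_add_congruent)
lift_definition minus_tensors :: "'a tensors \<Rightarrow> 'a tensors \<Rightarrow> 'a tensors" is "(-)"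
  by (rule z2_span_diff_congruent)
lift_definition uminus_tensors :: "'a tensors \<Rightarrow> 'a tensors" is uminus
  by (rule z2_span_uminus_congruent)

instance
  by standard (transfer; simp add: algebra_simps z2.span_zero add_self_zero)+

end

lift_definition word :: "'a::z2_vector list \<Rightarrow> 'a tensors"
  is "\<lambda>ws. Poly_Mapping.single ws 1" .

text \<open>The linear map induced by a function on words that is linear in each letter.\<close>

definition word_lift :: "('a::z2_vector list \<Rightarrow> 'b::z2_vector) \<Rightarrow> 'a tensors \<Rightarrow> 'b" where
  "word_lift f = (THE g. z2_linear g \<and> (\<forall>ws. g (word ws) = f ws))"


subsection \<open>Universal properties\<close>

text \<open>The linear extension of a function to the free vector space.\<close>

definition free_lift :: "('x \<Rightarrow> 'c::z2_vector) \<Rightarrow> ('x \<Rightarrow>\<^sub>0 bit) \<Rightarrow> 'c" where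
  "free_lift f p = (\<Sum>x\<in>Poly_Mapping.keys p. f x)"

lemma free_lift_superset:
  "free_lift f p = (\<Sum>x\<in>S. z2_scale (Poly_Mapping.lookup p x) (f x))"
  if "finite S" "Poly_Mapping.keys p \<subseteq> S"
proof -
  have "(\<Sum>x\<in>S. z2_scale (Poly_Mapping.lookup p x) (f x)) =
        (\<Sum>x\<in>Poly_Mapping.keys p. z2_scale (Poly_Mapping.lookup p x) (f x))"
    using that by (intro sum.mono_neutral_right) (auto simp: in_keys_iff)
  also have "\<dots> = free_lift f p"
    unfolding free_lift_def by (intro sum.cong) (auto simp: in_keys_iff z2_scale_def)
  finally show ?thesis ..
qed

lemma free_lift_linear: "z2_linear (free_lift f)"
  unfolding z2_linear_iff
proof (intro allI)
  fix p q :: "'a \<Rightarrow>\<^sub>0 bit"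
  let ?S = "Poly_Mapping.keys p \<union> Poly_Mapping.keys q"
  have "free_lift f (p + q) = (\<Sum>x\<in>?S. z2_scale (Poly_Mapping.lookup (p + q) x) (f x))"
    by (rule free_lift_superset) (simp_all add: Poly_Mapping.keys_add)
  also have "\<dots> = (\<Sum>x\<in>?S. z2_scale (Poly_Mapping.lookup p x) (f x)) +
                  (\<Sum>x\<in>?S. z2_scale (Poly_Mapping.lookup q x) (f x))"
    by (simp only: lookup_add z2.scale_left_distrib sum.distrib)
  also have "\<dots> = free_lift f p + free_lift f q"
    using free_lift_superset[of ?S p f] free_lift_superset[of ?S q f] by simp
  finally show "free_lift f (p + q) = free_lift f p + free_lift f q" .
qed

lemma free_lift_single [simp]: "free_lift f (Poly_Mapping.single x 1) = f x"
  by (simp add: free_lift_def)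

lemma free_lift_congruent:
  assumes "\<And>r. r \<in> R \<Longrightarrow> free_lift f r = 0" and "p - q \<in> z2.span R"
  shows "free_lift f p = free_lift f q"
proof -
  interpret F: Vector_Spaces.linear z2_scale z2_scale "free_lift f"
    by (rule free_lift_linear)
  have "free_lift f (p - q) = 0"
    by (rule F.eq_0_on_span[OF assms])
  then show ?thesis
    by (simp add: F.diff)
qed

lemma z2_linear_eqI_free:
  fixes g h :: "('x \<Rightarrow>\<^sub>0 bit) \<Rightarrow> 'c::z2_vector"
  assumes "\<And>p q. g (p + q) = g p + g q" "\<And>p q. h (p + q) = h p + h q"
    and "\<And>x. g (Poly_Mapping.single x 1) = h (Poly_Mapping.single x 1)"
  shows "g = h"
proof
  fix p
  have g0: "g 0 = 0" and h0: "h 0 = 0"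
    using assms(1)[of 0 0] assms(2)[of 0 0] by (simp_all add: add_self_zero)
  have single: "g (Poly_Mapping.single x c) = h (Poly_Mapping.single x c)" for x and c :: bit
    using assms(3) by (cases c) (auto simp: g0 h0)
  show "g p = h p"
  proof (induction p rule: update_induct)
    case const
    show ?case by (simp add: g0 h0)
  next
    case (update p x c)
    have "Poly_Mapping.update x c p = p + Poly_Mapping.single x c"
      using update.hyps(1)
      by (intro poly_mapping_eqI) (auto simp: lookup_update lookup_add lookup_single in_keys_iff)
    then show ?case
      using update.IH by (simp only: assms(1,2) single)
  qed
qed

lemma tensor_lift:
  fixes f :: "'a::z2_vector \<Rightarrow> 'b::z2_vector \<Rightarrow> 'c::z2_vector"
  assumes "z2_bilinear f"
  shows "z2_linear (tensor_lift f)" and "tensor_lift f (x \<otimes> y) = f x y"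
proof -
  have add: "f (x + x') y = f x y + f x' y" "f x (y + y') = f x y + f x y'" for x x' y y'
    using assms by (auto simp: z2_bilinear_def z2_linear_iff)
  interpret F: Vector_Spaces.linear z2_scale z2_scale "free_lift (case_prod f)"
    by (rule free_lift_linear)
  have R: "free_lift (case_prod f) r = 0" if "r \<in> tensor_relators" for r
    using that by (auto simp: tensor_relators_def F.diff add)
  define g where "g t = free_lift (case_prod f) (rep_tensor t)" for t
  have g_abs: "g (abs_tensor p) = free_lift (case_prod f) p" for p
    unfolding g_def
    by (rule free_lift_congruent[OF R Quotient3_rep_abs[OF Quotient3_tensor]])
      (simp_all add: z2.span_zero)
  have lin: "z2_linear g"
    unfolding z2_linear_iff
  proof (intro allI)
    fix s t :: "('a, 'b) tensor"
    obtain p q where "s = abs_tensor p" "t = abs_tensor q"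
      by (metis Quotient3_abs_rep[OF Quotient3_tensor])
    then show "g (s + t) = g s + g t"
      by (simp add: plus_tensor.abs_eq g_abs F.add)
  qed
  have val: "\<forall>x y. g (x \<otimes> y) = f x y"
    by (simp add: pure_tensor.abs_eq g_abs)
  have uniq: "h = g" if "z2_linear h \<and> (\<forall>x y. h (x \<otimes> y) = f x y)" for h
  proof
    fix t :: "('a, 'b) tensor"
    have "(\<lambda>p. h (abs_tensor p)) = (\<lambda>p. g (abs_tensor p))"
    proof (rule z2_linear_eqI_free)
      show "h (abs_tensor (p + q)) = h (abs_tensor p) + h (abs_tensor q)"
        and "g (abs_tensor (p + q)) = g (abs_tensor p) + g (abs_tensor q)" for p q
        using that lin by (simp_all add: z2_linear_iff flip: plus_tensor.abs_eq)
      show "h (abs_tensor (Poly_Mapping.single x 1)) = g (abs_tensor (Poly_Mapping.single x 1))" for x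
        using that val by (cases x) (simp_all flip: pure_tensor.abs_eq)
    qed
    then show "h t = g t"
      by (metis Quotient3_abs_rep[OF Quotient3_tensor])
  qed
  have eq: "tensor_lift f = g"
    unfolding tensor_lift_def by (rule the_equality) (rule conjI[OF lin val], rule uniq)
  show "z2_linear (tensor_lift f)" "tensor_lift f (x \<otimes> y) = f x y"
    unfolding eq using lin val by simp_all
qed

lemma word_lift:
  fixes f :: "'a::z2_vector list \<Rightarrow> 'b::z2_vector"
  assumes "z2_multilinear f"
  shows "z2_linear (word_lift f)" and "word_lift f (word ws) = f ws"
proof -
  have add: "f (us @ (x + y) # vs) = f (us @ x # vs) + f (us @ y # vs)" for us x y vs
    by (rule assms[unfolded z2_multilinear_def z2_linear_iff, rule_format])
  interpret F: Vector_Spaces.linear z2_scale z2_scale "free_lift f"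
    by (rule free_lift_linear)
  have R: "free_lift f r = 0" if "r \<in> word_relators" for r
  proof -
    from that obtain us x y vs where "r = Poly_Mapping.single (us @ (x + y) # vs) 1
        - Poly_Mapping.single (us @ x # vs) 1 - Poly_Mapping.single (us @ y # vs) 1"
      unfolding word_relators_def by blast
    then show ?thesis
      by (simp only: F.diff free_lift_single add) simp
  qed
  define g where "g t = free_lift f (rep_tensors t)" for t
  have g_abs: "g (abs_tensors p) = free_lift f p" for p
    unfolding g_def
    by (rule free_lift_congruent[OF R Quotient3_rep_abs[OF Quotient3_tensors]])
      (simp_all add: z2.span_zero)
  have lin: "z2_linear g"
    unfolding z2_linear_iff
  proof (intro allI)
    fix s t :: "'a tensors"
    obtain p q where "s = abs_tensors p" "t = abs_tensors q"
      by (metis Quotient3_abs_rep[OF Quotient3_tensors])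
    then show "g (s + t) = g s + g t"
      by (simp add: plus_tensors.abs_eq g_abs F.add)
  qed
  have val: "\<forall>ws. g (word ws) = f ws"
    by (simp add: word.abs_eq g_abs)
  have uniq: "h = g" if "z2_linear h \<and> (\<forall>ws. h (word ws) = f ws)" for h
  proof
    fix t :: "'a tensors"
    have "(\<lambda>p. h (abs_tensors p)) = (\<lambda>p. g (abs_tensors p))"
    proof (rule z2_linear_eqI_free)
      show "h (abs_tensors (p + q)) = h (abs_tensors p) + h (abs_tensors q)"
        and "g (abs_tensors (p + q)) = g (abs_tensors p) + g (abs_tensors q)" for p q
        using that lin by (simp_all add: z2_linear_iff flip: plus_tensors.abs_eq)
      show "h (abs_tensors (Poly_Mapping.single x 1)) = g (abs_tensors (Poly_Mapping.single x 1))" for x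
        using that val by (simp flip: word.abs_eq)
    qed
    then show "h t = g t"
      by (metis Quotient3_abs_rep[OF Quotient3_tensors])
  qed
  have eq: "word_lift f = g"
    unfolding word_lift_def by (rule the_equality) (rule conjI[OF lin val], rule uniq)
  show "z2_linear (word_lift f)" "word_lift f (word ws) = f ws"
    unfolding eq using lin val by simp_all
qed


subsection \<open>Differential graded structures\<close>

text \<open>A grading by the integers: the space is the internal direct sum of the subspaces
  \<open>gr n\<close>.\<close>

definition z2_grading :: "(int \<Rightarrow> 'a::z2_vector set) \<Rightarrow> bool" where
  "z2_grading gr \<longleftrightarrow> (\<forall>n. z2.subspace (gr n)) \<and>
     (\<forall>x. \<exists>!f. (\<forall>n. f n \<in> gr n) \<and> finite {n. f n \<noteq> 0} \<and> x = (\<Sum>n | f n \<noteq> 0. f n))"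

definition tensor_grading ::
  "(int \<Rightarrow> 'a::z2_vector set) \<Rightarrow> (int \<Rightarrow> 'b::z2_vector set) \<Rightarrow> int \<Rightarrow> ('a, 'b) tensor set" where
  "tensor_grading gr gr' n =
     z2.span {x \<otimes> y | x y i j. x \<in> gr i \<and> y \<in> gr' j \<and> i + j = n}"

locale cochain_complex =
  fixes gr :: "int \<Rightarrow> 'a::z2_vector set" and d :: "'a \<Rightarrow> 'a"
  assumes grading: "z2_grading gr"
    and d_linear: "z2_linear d"
    and d_degree: "x \<in> gr n \<Longrightarrow> d x \<in> gr (n + 1)"
    and d_d: "d (d x) = 0"

locale dg_algebra = cochain_complex gr d
  for gr :: "int \<Rightarrow> 'a::z2_vector set" and d :: "'a \<Rightarrow> 'a" +
  fixes mul :: "'a \<Rightarrow> 'a \<Rightarrow> 'a" and one :: 'a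
  assumes mul_bilinear: "z2_bilinear mul"
    and mul_degree: "x \<in> gr m \<Longrightarrow> y \<in> gr n \<Longrightarrow> mul x y \<in> gr (m + n)"
    and mul_assoc: "mul (mul x y) z = mul x (mul y z)"
    and one_degree: "one \<in> gr 0"
    and mul_one: "mul one x = x" "mul x one = x"
    and leibniz: "d (mul x y) = mul (d x) y + mul x (d y)"

locale augmented_dg_algebra = dg_algebra gr d mul one
  for gr :: "int \<Rightarrow> 'a::z2_vector set" and d mul one +
  fixes aug :: "'a \<Rightarrow> bit"
  assumes aug_linear: "z2_linear aug"
    and aug_degree: "x \<in> gr n \<Longrightarrow> n \<noteq> 0 \<Longrightarrow> aug x = 0"
    and aug_d: "aug (d x) = 0"
    and aug_mul: "aug (mul x y) = aug x * aug y"
    and aug_one: "aug one = 1"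

locale dg_coalgebra = cochain_complex gr d
  for gr :: "int \<Rightarrow> 'h::z2_vector set" and d :: "'h \<Rightarrow> 'h" +
  fixes \<Delta> :: "'h \<Rightarrow> ('h, 'h) tensor" and counit :: "'h \<Rightarrow> bit"
  assumes comult_linear: "z2_linear \<Delta>"
    and comult_degree: "x \<in> gr n \<Longrightarrow> \<Delta> x \<in> tensor_grading gr gr n"
    and counit_linear: "z2_linear counit"
    and counit_degree: "x \<in> gr n \<Longrightarrow> n \<noteq> 0 \<Longrightarrow> counit x = 0"
    and coassoc: "tensor_assoc (tensor_map \<Delta> id (\<Delta> x)) = tensor_map id \<Delta> (\<Delta> x)"
    and comult_counit:
      "tensor_lift (\<lambda>y z. z2_scale (counit y) z) (\<Delta> x) = x"
      "tensor_lift (\<lambda>y z. z2_scale (counit z) y) (\<Delta> x) = x"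
    and coleibniz: "\<Delta> (d x) = tensor_map d id (\<Delta> x) + tensor_map id d (\<Delta> x)"
    and counit_d: "counit (d x) = 0"

text \<open>Compatibility of the coproduct with the product is \<open>comult_cup\<close> at \<open>n = 0\<close>; the last
  three assumptions complete this to a (unital and counital) DG-Hopf algebra.\<close>

locale steenrod_dg_hopf_algebra = dg_coalgebra gr d \<Delta> counit
  for gr :: "int \<Rightarrow> 'h::z2_vector set" and d \<Delta> counit +
  fixes cup :: "nat \<Rightarrow> ('h, 'h) tensor \<Rightarrow> 'h" and one :: 'h
  assumes cup_0_dg_algebra: "dg_algebra gr d (\<lambda>x y. cup 0 (x \<otimes> y)) one"
    and cup_linear: "z2_linear (cup i)"
    and cup_degree: "x \<in> gr m \<Longrightarrow> y \<in> gr n \<Longrightarrow> cup i (x \<otimes> y) \<in> gr (m + n - int i)"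
    and d_cup: "d (cup i (x \<otimes> y)) = cup i (d x \<otimes> y) + cup i (x \<otimes> d y) +
      (if i = 0 then 0 else cup (i - 1) (x \<otimes> y) + cup (i - 1) (y \<otimes> x))"
    and comult_cup: "\<Delta> (cup n t) =
      (\<Sum>k\<le>n. tensor_map (cup k) (cup (n - k) \<circ> (tensor_swap ^^ k)) (tensor_comult \<Delta> t))"
    and comult_one: "\<Delta> one = one \<otimes> one"
    and counit_one: "counit one = 1"
    and counit_cup_0: "counit (cup 0 (x \<otimes> y)) = counit x * counit y"


subsection \<open>Homotopy G-algebras\<close>

text \<open>Lists are indexed from 0: this replaces the letters at positions \<open>i\<close> and \<open>i + 1\<close>
  by their product.\<close>

definition mul_at :: "('a \<Rightarrow> 'a \<Rightarrow> 'a) \<Rightarrow> nat \<Rightarrow> 'a list \<Rightarrow> 'a list" where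
  "mul_at mul i xs = take i xs @ mul (xs ! i) (xs ! (i + 1)) # drop (i + 2) xs"

definition segment :: "nat \<Rightarrow> nat \<Rightarrow> 'a list \<Rightarrow> 'a list" where
  "segment i j xs = take (j - i) (drop i xs)"

text \<open>\<open>E a bs\<close> stands for \<open>E\<^sub>1\<^sub>,\<^sub>k(a; b\<^sub>1, \<dots>, b\<^sub>k)\<close> with \<open>k = length bs\<close>. Only its values for
  \<open>k \<ge> 1\<close> are data; the convention for \<open>k = 0\<close> is supplied here.\<close>

definition hga_ext :: "('a \<Rightarrow> 'a list \<Rightarrow> 'a) \<Rightarrow> 'a \<Rightarrow> 'a list \<Rightarrow> 'a" where
  "hga_ext E a bs = (if bs = [] then a else E a bs)"

text \<open>The sequences \<open>(k\<^sub>1, \<dots>, k\<^sub>m)\<close>, \<open>(l\<^sub>1, \<dots>, l\<^sub>m)\<close> with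
  \<open>0 \<le> k\<^sub>1 \<le> k\<^sub>1 + l\<^sub>1 \<le> k\<^sub>2 \<le> \<dots> \<le> k\<^sub>m + l\<^sub>m \<le> n\<close>.\<close>

definition insertions :: "nat \<Rightarrow> nat \<Rightarrow> (nat list \<times> nat list) set" where
  "insertions m n = {(ks, ls). length ks = m \<and> length ls = m \<and>
     (\<forall>i<m. ks ! i + ls ! i \<le> (if i + 1 < m then ks ! (i + 1) else n))}"

definition insert_args ::
  "('a \<Rightarrow> 'a list \<Rightarrow> 'a) \<Rightarrow> 'a list \<Rightarrow> 'a list \<Rightarrow> nat list \<Rightarrow> nat list \<Rightarrow> 'a list" where
  "insert_args E bs cs ks ls =
     (let e = (\<lambda>i. if i = 0 then 0 else ks ! (i - 1) + ls ! (i - 1)) in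
      concat (map (\<lambda>i. segment (e i) (ks ! i) cs @
                       [hga_ext E (bs ! i) (segment (ks ! i) (ks ! i + ls ! i) cs)])
                  [0..<length bs])
      @ drop (e (length bs)) cs)"

locale homotopy_G_algebra = dg_algebra gr d mul one
  for gr :: "int \<Rightarrow> 'a::z2_vector set" and d mul one +
  fixes E :: "'a \<Rightarrow> 'a list \<Rightarrow> 'a"
  assumes E_linear_left: "bs \<noteq> [] \<Longrightarrow> z2_linear (\<lambda>a. E a bs)"
    and E_multilinear_right: "z2_multilinear (E a)"
    and E_degree: "bs \<noteq> [] \<Longrightarrow> a \<in> gr m \<Longrightarrow> list_all2 (\<lambda>b n. b \<in> gr n) bs ns \<Longrightarrow>
      E a bs \<in> gr (m + sum_list ns - int (length bs))"
    and E_differential: "bs \<noteq> [] \<Longrightarrow>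
      d (E a bs) + E (d a) bs + (\<Sum>i<length bs. E a (bs[i := d (bs ! i)])) =
      mul (hd bs) (hga_ext E a (tl bs))
      + (\<Sum>i<length bs - 1. hga_ext E a (mul_at mul i bs))
      + mul (hga_ext E a (butlast bs)) (last bs)"
    and E_product: "bs \<noteq> [] \<Longrightarrow>
      mul a\<^sub>1 (E a\<^sub>2 bs) + E (mul a\<^sub>1 a\<^sub>2) bs + mul (E a\<^sub>1 bs) a\<^sub>2 =
      (\<Sum>p\<in>{1..<length bs}. mul (E a\<^sub>1 (take p bs)) (E a\<^sub>2 (drop p bs)))"
    and E_composition: "bs \<noteq> [] \<Longrightarrow> cs \<noteq> [] \<Longrightarrow>
      E (E a bs) cs =
      (\<Sum>(ks, ls)\<in>insertions (length bs) (length cs). E a (insert_args E bs cs ks ls))"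

text \<open>\<open>E k as bs\<close> stands for \<open>E\<^sup>k\<^sub>p\<^sub>,\<^sub>q(a\<^sub>1, \<dots>, a\<^sub>p; b\<^sub>1, \<dots>, b\<^sub>q)\<close> with \<open>p = length as\<close> and
  \<open>q = length bs\<close>. Only its values for \<open>p, q \<ge> 1\<close> are data; the conventions for \<open>p = 0\<close> or
  \<open>q = 0\<close> are supplied here.\<close>

definition op_ext ::
  "(nat \<Rightarrow> 'a list \<Rightarrow> 'a list \<Rightarrow> 'a::zero) \<Rightarrow> nat \<Rightarrow> 'a list \<Rightarrow> 'a list \<Rightarrow> 'a" where
  "op_ext E k as bs =
     (if as \<noteq> [] \<and> bs \<noteq> [] then E k as bs
      else if k = 0 \<and> length (as @ bs) = 1 then hd (as @ bs) else 0)"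

definition op_swap :: "('b \<Rightarrow> 'b \<Rightarrow> 'a) \<Rightarrow> 'b \<Rightarrow> 'b \<Rightarrow> 'a" where
  "op_swap F x y = F y x"

locale extended_homotopy_G_algebra = dg_algebra gr d mul one
  for gr :: "int \<Rightarrow> 'a::z2_vector set" and d mul one +
  fixes E :: "nat \<Rightarrow> 'a list \<Rightarrow> 'a list \<Rightarrow> 'a"
  assumes op_multilinear_left: "bs \<noteq> [] \<Longrightarrow> z2_multilinear (\<lambda>as. E k as bs)"
    and op_multilinear_right: "as \<noteq> [] \<Longrightarrow> z2_multilinear (\<lambda>bs. E k as bs)"
    and op_degree: "as \<noteq> [] \<Longrightarrow> bs \<noteq> [] \<Longrightarrow>
      list_all2 (\<lambda>a m. a \<in> gr m) as ms \<Longrightarrow> list_all2 (\<lambda>b n. b \<in> gr n) bs ns \<Longrightarrow>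
      E k as bs \<in> gr (sum_list ms + sum_list ns + 1 - int k - int (length as) - int (length bs))"
    and op_0_vanish: "length as > 1 \<Longrightarrow> bs \<noteq> [] \<Longrightarrow> E 0 as bs = 0"
    and op_0_homotopy_G_algebra: "homotopy_G_algebra gr d mul one (\<lambda>a bs. E 0 [a] bs)"
    and op_differential: "as \<noteq> [] \<Longrightarrow> bs \<noteq> [] \<Longrightarrow>
      d (E k as bs)
      + (\<Sum>i<length as. E k (as[i := d (as ! i)]) bs)
      + (\<Sum>i<length bs. E k as (bs[i := d (bs ! i)]))
      + (\<Sum>i<length as - 1. op_ext E k (mul_at mul i as) bs)
      + (\<Sum>i<length bs - 1. op_ext E k as (mul_at mul i bs))
      + (\<Sum>i\<le>k. \<Sum>(p, q)\<in>{..length as} \<times> {..length bs} - {(0, 0), (length as, length bs)}.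
           mul (op_ext E i (take p as) (take q bs))
               ((op_swap ^^ i) (op_ext E (k - i)) (drop p as) (drop q bs)))
      = (if k = 0 then 0 else E (k - 1) as bs + E (k - 1) bs as)"


subsection \<open>The bar construction\<close>

text \<open>The type of letters plays the role of the augmentation ideal, and the operations below are
  the restricted ones. A letter
  of degree \<open>j\<close> contributes \<open>j - 1\<close> to the degree of a word, which accounts for the
  desuspension.\<close>

definition bar_grading ::
  "(int \<Rightarrow> 'v::z2_vector set) \<Rightarrow> int \<Rightarrow> 'v tensors set" where
  "bar_grading gr n =
     z2.span {word ws | ws js. list_all2 (\<lambda>w j. w \<in> gr j) ws js \<and> n = (\<Sum>j\<leftarrow>js. j - 1)}"

definition bar_d :: "('v::z2_vector \<Rightarrow> 'v) \<Rightarrow> ('v \<Rightarrow> 'v \<Rightarrow> 'v) \<Rightarrow> 'v tensors \<Rightarrow> 'v tensors" where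
  "bar_d d mul = word_lift (\<lambda>ws.
     (\<Sum>i<length ws. word (ws[i := d (ws ! i)])) +
     (\<Sum>i<length ws - 1. word (mul_at mul i ws)))"

definition bar_comult :: "'v::z2_vector tensors \<Rightarrow> ('v tensors, 'v tensors) tensor" where
  "bar_comult = word_lift (\<lambda>ws. \<Sum>i\<le>length ws. word (take i ws) \<otimes> word (drop i ws))"

definition bar_counit :: "'v::z2_vector tensors \<Rightarrow> bit" where
  "bar_counit = word_lift (\<lambda>ws. if ws = [] then 1 else 0)"

text \<open>The product \<open>\<smile>\<^sub>k\<close> on a pair of words: the iterated coproduct of the tensor square cuts the
  two words into \<open>r\<close> consecutive blocks each; a list entry \<open>(i, xs, ys)\<close> is a pair of blocks
  together with the upper index \<open>i\<close> of the operation applied to it, after as many transpositions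
  as the sum of the earlier upper indices.
  Pairs of empty blocks are left out since the operations vanish on them; this makes the sum
  over all \<open>r\<close> finite.\<close>

definition cup_cuts ::
  "nat \<Rightarrow> 'v list \<Rightarrow> 'v list \<Rightarrow> (nat \<times> 'v list \<times> 'v list) list set" where
  "cup_cuts k as bs = {L. (\<Sum>(i, xs, ys)\<leftarrow>L. i) = k \<and>
     concat (map (\<lambda>(i, xs, ys). xs) L) = as \<and> concat (map (\<lambda>(i, xs, ys). ys) L) = bs \<and>
     (\<forall>(i, xs, ys)\<in>set L. (xs, ys) \<noteq> ([], []))}"

fun cup_letters ::
  "(nat \<Rightarrow> 'v list \<Rightarrow> 'v list \<Rightarrow> 'v) \<Rightarrow> nat \<Rightarrow> (nat \<times> 'v list \<times> 'v list) list \<Rightarrow> 'v list" where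
  "cup_letters F s [] = []"
| "cup_letters F s ((i, xs, ys) # L) = (op_swap ^^ s) (F i) xs ys # cup_letters F (s + i) L"

definition bar_cup_words ::
  "(nat \<Rightarrow> 'v::z2_vector list \<Rightarrow> 'v list \<Rightarrow> 'v) \<Rightarrow> nat \<Rightarrow> 'v list \<Rightarrow> 'v list \<Rightarrow> 'v tensors" where
  "bar_cup_words E k as bs = (\<Sum>L\<in>cup_cuts k as bs. word (cup_letters (op_ext E) 0 L))"

definition bar_cup ::
  "(nat \<Rightarrow> 'v::z2_vector list \<Rightarrow> 'v list \<Rightarrow> 'v) \<Rightarrow>
   nat \<Rightarrow> ('v tensors, 'v tensors) tensor \<Rightarrow> 'v tensors" where
  "bar_cup E k = tensor_lift (\<lambda>x y. word_lift (\<lambda>as. word_lift (bar_cup_words E k as) y) x)"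

end

theory Submission
  imports Defs
begin

text \<open>The bar construction is cofree as a coalgebra, so maps into it that are compatible with the
coproducts agree as soon as their projections to the letters agree. The proof makes this argument
explicit by working with words and their first letters. Write \<open>u = x x'\<close> for a cut of a word \<open>u\<close>.
Splitting off the first letter of the product of two words gives the recursion

  \<open>u \<smile>\<^sub>k v = \<epsilon> + (\<Sum>i\<le>k. \<Sum>u = x x', v = y y'. E\<^sup>i(x; y) | T\<^sup>i(x' \<smile>\<^sub>k\<^sub>-\<^sub>i y'))\<close>

(\<open>cup_words_rec\<close>), where \<open>\<epsilon>\<close> is the empty word if \<open>k = 0\<close> and both words are empty, and \<open>0\<close>
otherwise. As \<open>E\<^sup>i\<close> vanishes on two empty blocks, the words \<open>x', y'\<close> are together shorter than
\<open>u, v\<close> in every nonzero summand, and identities follow by induction on the total length: the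
equation between the operations settles the first letter, the induction hypothesis the rest.

For the decomposition of the coproduct (\<open>bar_comult_cup_words\<close>) no equation is involved. For the
Steenrod formula (\<open>bar_d_cup_words\<close>), the bar differential acts on the first letter, on the remaining
word, or multiplies the first two letters. The products of the first two letters, collected over all
cuts with the same remainder, are the sum of the terms \<open>E\<^sup>i \<cdot> T\<^sup>i E\<^sup>k\<^sup>-\<^sup>i\<close> in the equation for \<open>d E\<^sup>k\<close>.
The terms \<open>E\<^sup>k\<^sup>-\<^sup>1\<close> on the right-hand side of that equation and the terms \<open>\<smile>\<^sub>k\<^sub>-\<^sub>1\<close> from the induction
hypothesis share a family of summands, which occurs twice and cancels; what is left is
\<open>u \<smile>\<^sub>k\<^sub>-\<^sub>1 v + v \<smile>\<^sub>k\<^sub>-\<^sub>1 u\<close>.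

Associativity of \<open>\<smile>\<^sub>0\<close> (\<open>cup_assoc\<close>) uses that \<open>E\<^sup>0\<close> takes one argument on the left. The equation for
\<open>E(E(a; b\<^sub>1, \<dots>, b\<^sub>m); c\<^sub>1, \<dots>, c\<^sub>n)\<close> says that this composite is \<open>E(a; _)\<close> applied to the product of the words
\<open>b\<^sub>1 \<dots> b\<^sub>m\<close> and \<open>c\<^sub>1 \<dots> c\<^sub>n\<close>, because the insertions enumerate the words of that product
(\<open>cup_words_insertions\<close>). With this, both ways of bracketing a triple product unfold to the same sum.

The remaining axioms say that the bar construction is a DG-coalgebra. Its decomposition into
homogeneous parts is certified by projections (\<open>bar_grading_grading\<close>). All of this is carried out for
a DG-algebra without unit; the augmentation ideal, with the restricted operations, is one.\<close>

section \<open>Linear maps over the two-element field\<close>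

lemma z2_linearI: "z2_linear f" if "\<And>x y. f (x + y) = f x + f y"
  using that by (simp add: z2_linear_iff)

lemma z2_linearD: "f (x + y) = f x + f y" if "z2_linear f"
  using that by (simp add: z2_linear_iff)

lemma z2_linear_zero: "f 0 = 0" if "z2_linear f"
  using z2_linearD[OF that, of 0 0] by (simp add: add_self_zero)

lemma z2_linear_sum: "f (\<Sum>a\<in>A. g a) = (\<Sum>a\<in>A. f (g a))" if "z2_linear f"
  by (induction A rule: infinite_finite_induct)
    (simp_all add: z2_linearD[OF that] z2_linear_zero[OF that])

lemma add_self_cancel: "x + (x + y) = y" for x y :: "'a::z2_vector"
  by (simp add: add_self_zero flip: add.assoc)

lemmas z2_cancel = add_self_zero add_self_cancel

lemma z2_eq_iff_add: "x = y \<longleftrightarrow> x + y = 0" for x y :: "'a::z2_vector"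
  by (metis add_self_zero add_right_imp_eq)

lemma z2_linear_comp: "z2_linear (\<lambda>x. f (g x))" if "z2_linear f" "z2_linear g"
  using that by (simp add: z2_linear_iff)

lemma z2_linear_plus: "z2_linear (\<lambda>x. f x + g x)" if "z2_linear f" "z2_linear g"
  using that by (simp add: z2_linear_iff ac_simps)

lemma z2_linear_sum_fun: "z2_linear (\<lambda>x. \<Sum>a\<in>A. f a x)" if "\<And>a. a \<in> A \<Longrightarrow> z2_linear (f a)"
  using that by (simp add: z2_linear_iff sum.distrib)

lemma z2_linear_const_zero: "z2_linear (\<lambda>x. 0)"
  by (simp add: z2_linear_iff)

lemma z2_linear_id: "z2_linear (\<lambda>x. x)" "z2_linear id"
  by (simp_all add: z2_linear_iff)

lemma z2_multilinearI:
  "z2_multilinear f" if "\<And>us x y vs. f (us @ (x + y) # vs) = f (us @ x # vs) + f (us @ y # vs)"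
  using that by (simp add: z2_multilinear_def z2_linear_iff)

lemma z2_multilinearD:
  "f (us @ (x + y) # vs) = f (us @ x # vs) + f (us @ y # vs)" if "z2_multilinear f"
  using that by (simp add: z2_multilinear_def z2_linear_iff)

lemma z2_multilinearD_hd: "f ((x + y) # vs) = f (x # vs) + f (y # vs)" if "z2_multilinear f"
  using z2_multilinearD[OF that, of "[]"] by simp

lemma z2_multilinear_hd_zero: "f (0 # vs) = 0" if "z2_multilinear f"
  using z2_multilinearD_hd[OF that, of 0 0] by (simp add: add_self_zero)

lemma z2_multilinear_Cons: "z2_multilinear (\<lambda>ws. f (a # ws))" if "z2_multilinear f"
  using z2_multilinearD[OF that, of "a # us" for us] by (intro z2_multilinearI) simp

lemma z2_multilinear_comp: "z2_multilinear (\<lambda>ws. g (f ws))"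
  if "z2_linear g" "z2_multilinear f"
  using that by (simp add: z2_multilinear_def z2_linear_iff)

lemma z2_bilinearI:
  "z2_bilinear f" if "\<And>x x' y. f (x + x') y = f x y + f x' y" "\<And>x y y'. f x (y + y') = f x y + f x y'"
  using that by (simp add: z2_bilinear_def z2_linear_iff)


section \<open>Linear maps on tensor products and on the tensor coalgebra\<close>

lemma pure_tensor_add:
  "(x + x') \<otimes> y = x \<otimes> y + x' \<otimes> y" "x \<otimes> (y + y') = x \<otimes> y + x \<otimes> y'"
proof -
  have "Poly_Mapping.single (x + x', y) 1 - Poly_Mapping.single (x, y) 1
      - Poly_Mapping.single (x', y) 1 \<in> z2.span tensor_relators"
    by (rule z2.span_base, unfold tensor_relators_def, rule UnI1) blast
  then show "(x + x') \<otimes> y = x \<otimes> y + x' \<otimes> y"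
    unfolding diff_diff_add by transfer
  have "Poly_Mapping.single (x, y + y') 1 - Poly_Mapping.single (x, y) 1
      - Poly_Mapping.single (x, y') 1 \<in> z2.span tensor_relators"
    by (rule z2.span_base, unfold tensor_relators_def, rule UnI2) blast
  then show "x \<otimes> (y + y') = x \<otimes> y + x \<otimes> y'"
    unfolding diff_diff_add by transfer
qed

lemma word_add: "word (us @ (x + y) # vs) = word (us @ x # vs) + word (us @ y # vs)"
proof -
  have "Poly_Mapping.single (us @ (x + y) # vs) 1 - Poly_Mapping.single (us @ x # vs) 1
      - Poly_Mapping.single (us @ y # vs) 1 \<in> z2.span word_relators"
    by (rule z2.span_base, unfold word_relators_def, intro CollectI exI conjI, rule refl, rule TrueI)
  then show ?thesis
    unfolding diff_diff_add by (simp only: word.abs_eq plus_tensors.abs_eq tensors.abs_eq_iff)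
qed

lemma word_multilinear: "z2_multilinear word"
  by (rule z2_multilinearI) (rule word_add)

lemma pure_tensor_linear: "z2_linear (\<lambda>x. x \<otimes> y)" "z2_linear (\<lambda>y. x \<otimes> y)"
  by (simp_all add: z2_linear_iff pure_tensor_add)

lemma pure_tensor_zero [simp]: "0 \<otimes> y = 0" "x \<otimes> 0 = 0"
  by (rule z2_linear_zero[OF pure_tensor_linear(1)], rule z2_linear_zero[OF pure_tensor_linear(2)])

lemma pure_tensor_sum:
  "(\<Sum>a\<in>A. f a) \<otimes> y = (\<Sum>a\<in>A. f a \<otimes> y)" "x \<otimes> (\<Sum>a\<in>A. g a) = (\<Sum>a\<in>A. x \<otimes> g a)"
  by (rule z2_linear_sum[OF pure_tensor_linear(1)], rule z2_linear_sum[OF pure_tensor_linear(2)])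

lemma tensor_linear_eqI:
  assumes "z2_linear g" "z2_linear h" and "\<And>x y. g (x \<otimes> y) = h (x \<otimes> y)"
  shows "g t = h t"
proof -
  have "(\<lambda>p. g (abs_tensor p)) = (\<lambda>p. h (abs_tensor p))"
  proof (rule z2_linear_eqI_free)
    show "g (abs_tensor (p + q)) = g (abs_tensor p) + g (abs_tensor q)"
      and "h (abs_tensor (p + q)) = h (abs_tensor p) + h (abs_tensor q)" for p q
      using assms(1,2) by (simp_all add: z2_linear_iff flip: plus_tensor.abs_eq)
    show "g (abs_tensor (Poly_Mapping.single x 1)) = h (abs_tensor (Poly_Mapping.single x 1))" for x
      using assms(3) by (cases x) (simp flip: pure_tensor.abs_eq)
  qed
  then show ?thesis
    by (metis Quotient3_abs_rep[OF Quotient3_tensor])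
qed

lemma tensors_linear_eqI:
  assumes "z2_linear g" "z2_linear h" and "\<And>ws. g (word ws) = h (word ws)"
  shows "g t = h t"
proof -
  have "(\<lambda>p. g (abs_tensors p)) = (\<lambda>p. h (abs_tensors p))"
  proof (rule z2_linear_eqI_free)
    show "g (abs_tensors (p + q)) = g (abs_tensors p) + g (abs_tensors q)"
      and "h (abs_tensors (p + q)) = h (abs_tensors p) + h (abs_tensors q)" for p q
      using assms(1,2) by (simp_all add: z2_linear_iff flip: plus_tensors.abs_eq)
    show "g (abs_tensors (Poly_Mapping.single x 1)) = h (abs_tensors (Poly_Mapping.single x 1))" for x
      using assms(3) by (simp flip: word.abs_eq)
  qed
  then show ?thesis
    by (metis Quotient3_abs_rep[OF Quotient3_tensors])
qed

lemma tensor_tensors_linear_eqI: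
  assumes "z2_linear g" "z2_linear h"
    and "\<And>us vs. g (word us \<otimes> word vs) = h (word us \<otimes> word vs)"
  shows "g t = h t"
proof (rule tensor_linear_eqI[OF assms(1,2)])
  fix x y
  show "g (x \<otimes> y) = h (x \<otimes> y)"
  proof (rule tensors_linear_eqI[where t = x])
    show "z2_linear (\<lambda>x. g (x \<otimes> y))" "z2_linear (\<lambda>x. h (x \<otimes> y))"
      using assms by (auto intro: z2_linear_comp pure_tensor_linear)
    show "g (word us \<otimes> y) = h (word us \<otimes> y)" for us
      by (rule tensors_linear_eqI[where t = y])
        (use assms in \<open>auto intro: z2_linear_comp[of g] z2_linear_comp[of h] pure_tensor_linear\<close>)
  qed
qed

lemma tensor_map:
  assumes "z2_linear f" "z2_linear g"
  shows tensor_map_linear: "z2_linear (tensor_map f g)"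
    and tensor_map_pure: "tensor_map f g (x \<otimes> y) = f x \<otimes> g y"
proof -
  have b: "z2_bilinear (\<lambda>x y. f x \<otimes> g y)"
    using assms by (intro z2_bilinearI) (simp_all add: z2_linear_iff pure_tensor_add)
  show "z2_linear (tensor_map f g)" "tensor_map f g (x \<otimes> y) = f x \<otimes> g y"
    unfolding tensor_map_def by (rule tensor_lift[OF b])+
qed

lemma tensor_swap_linear: "z2_linear tensor_swap"
  and tensor_swap_pure: "tensor_swap (x \<otimes> y) = y \<otimes> x"
proof -
  have b: "z2_bilinear (\<lambda>x y. y \<otimes> x)"
    by (intro z2_bilinearI) (simp_all add: pure_tensor_add)
  show "z2_linear tensor_swap" "tensor_swap (x \<otimes> y) = y \<otimes> x"
    unfolding tensor_swap_def by (rule tensor_lift[OF b])+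
qed

lemma tensor_swap_funpow_linear:
  "z2_linear ((tensor_swap :: ('a::z2_vector, 'a) tensor \<Rightarrow> ('a, 'a) tensor) ^^ k)"
proof (induction k)
  case (Suc k)
  then show ?case
    unfolding funpow.simps comp_def by (rule z2_linear_comp[OF tensor_swap_linear])
qed (simp add: z2_linear_id)

lemma tensor_swap_funpow_pure:
  "(tensor_swap ^^ k) (x \<otimes> y) = (if even k then x \<otimes> y else y \<otimes> x)"
  by (induction k) (simp_all add: tensor_swap_pure)

text \<open>Nested lifts, as in the definitions of the reassociation and of the middle interchange, are
bilinear again; this step is iterated below.\<close>

lemma z2_bilinear_lift_right:
  assumes "\<And>u. z2_bilinear (f u)" and "\<And>u u' x y. f (u + u') x y = f u x y + f u' x y"
  shows "z2_bilinear (\<lambda>u v. tensor_lift (f u) v)"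
proof (rule z2_bilinearI)
  note lin = tensor_lift(1)[OF assms(1)] and val = tensor_lift(2)[OF assms(1)]
  show "tensor_lift (f u) (v + v') = tensor_lift (f u) v + tensor_lift (f u) v'" for u v v'
    by (rule z2_linearD[OF lin])
  show "tensor_lift (f (u + u')) v = tensor_lift (f u) v + tensor_lift (f u') v" for u u' v
  proof (rule tensor_linear_eqI[where t = v])
    show "z2_linear (tensor_lift (f (u + u')))"
      "z2_linear (\<lambda>v. tensor_lift (f u) v + tensor_lift (f u') v)"
      by (intro lin z2_linear_plus)+
  qed (unfold val, rule assms(2))
qed

lemma z2_bilinear_flip: "z2_bilinear (\<lambda>x y. f y x)" if "z2_bilinear f"
  using that by (simp add: z2_bilinear_def)

lemma z2_bilinear_add: "f (x + x') y = f x y + f x' y" "f x (y + y') = f x y + f x y'"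
  if "z2_bilinear f"
  using that by (simp_all add: z2_bilinear_def z2_linear_iff)

lemma tensor_assoc_linear: "z2_linear tensor_assoc"
  and tensor_assoc_pure: "tensor_assoc ((x \<otimes> y) \<otimes> z) = x \<otimes> (y \<otimes> z)"
proof -
  have b: "z2_bilinear (\<lambda>x y. x \<otimes> (y \<otimes> z))" for z
    by (intro z2_bilinearI) (simp_all add: pure_tensor_add)
  have b': "z2_bilinear (\<lambda>u z. tensor_lift (\<lambda>x y. x \<otimes> (y \<otimes> z)) u)"
    by (rule z2_bilinear_flip, rule z2_bilinear_lift_right, rule b) (simp add: pure_tensor_add)
  show "z2_linear tensor_assoc"
    unfolding tensor_assoc_def by (rule tensor_lift(1)[OF b'])
  show "tensor_assoc ((x \<otimes> y) \<otimes> z) = x \<otimes> (y \<otimes> z)"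
    unfolding tensor_assoc_def by (simp add: tensor_lift(2)[OF b'] tensor_lift(2)[OF b])
qed

lemma tensor_mid_swap_linear: "z2_linear tensor_mid_swap"
  and tensor_mid_swap_pure: "tensor_mid_swap ((x \<otimes> y) \<otimes> (z \<otimes> w)) = (x \<otimes> z) \<otimes> (y \<otimes> w)"
proof -
  have b: "z2_bilinear (\<lambda>z w. (x \<otimes> z) \<otimes> (y \<otimes> w))" for x y
    by (intro z2_bilinearI) (simp_all add: pure_tensor_add)
  have b1: "z2_bilinear (\<lambda>x y. tensor_lift (\<lambda>z w. (x \<otimes> z) \<otimes> (y \<otimes> w)) v)" for v
    using z2_bilinear_add(1)[OF z2_bilinear_lift_right[of "\<lambda>x z w. (x \<otimes> z) \<otimes> (y \<otimes> w)" for y]]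
      z2_bilinear_add(1)[OF z2_bilinear_lift_right[of "\<lambda>y z w. (x \<otimes> z) \<otimes> (y \<otimes> w)" for x]]
    by (intro z2_bilinearI) (simp_all add: b pure_tensor_add)
  have b2: "z2_bilinear (\<lambda>u v. tensor_lift (\<lambda>x y. tensor_lift (\<lambda>z w. (x \<otimes> z) \<otimes> (y \<otimes> w)) v) u)"
    by (rule z2_bilinear_flip, rule z2_bilinear_lift_right, rule b1)
      (rule z2_linearD[OF tensor_lift(1)[OF b]])
  show "z2_linear tensor_mid_swap"
    unfolding tensor_mid_swap_def by (rule tensor_lift(1)[OF b2])
  show "tensor_mid_swap ((x \<otimes> y) \<otimes> (z \<otimes> w)) = (x \<otimes> z) \<otimes> (y \<otimes> w)"
    unfolding tensor_mid_swap_def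
    by (subst tensor_lift(2)[OF b2], subst tensor_lift(2)[OF b1], rule tensor_lift(2)[OF b])
qed

lemma word_lift_bilinear:
  assumes "\<And>vs. z2_multilinear (\<lambda>us. f us vs)" and "\<And>us. z2_multilinear (f us)"
  shows "z2_bilinear (\<lambda>x y. word_lift (\<lambda>us. word_lift (f us) y) x)"
    and "word_lift (\<lambda>us. word_lift (f us) (word vs)) (word us) = f us vs"
proof -
  note lin = word_lift(1)[OF assms(2)] and val = word_lift(2)[OF assms(2)]
  have m: "z2_multilinear (\<lambda>us. word_lift (f us) y)" for y
  proof (rule z2_multilinearI)
    fix us x x' vs
    show "word_lift (f (us @ (x + x') # vs)) y =
        word_lift (f (us @ x # vs)) y + word_lift (f (us @ x' # vs)) y"
    proof (rule tensors_linear_eqI[where t = y])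
      show "z2_linear (word_lift (f (us @ (x + x') # vs)))"
        "z2_linear (\<lambda>y. word_lift (f (us @ x # vs)) y + word_lift (f (us @ x' # vs)) y)"
        by (intro lin z2_linear_plus)+
    qed (unfold val, rule z2_multilinearD[OF assms(1)])
  qed
  show "word_lift (\<lambda>us. word_lift (f us) (word vs)) (word us) = f us vs"
    by (simp add: word_lift(2)[OF m] word_lift(2)[OF assms(1)] val)
  show "z2_bilinear (\<lambda>x y. word_lift (\<lambda>us. word_lift (f us) y) x)"
  proof (rule z2_bilinearI)
    show "word_lift (\<lambda>us. word_lift (f us) y) (x + x') =
        word_lift (\<lambda>us. word_lift (f us) y) x + word_lift (\<lambda>us. word_lift (f us) y) x'" for x x' y
      by (rule z2_linearD[OF word_lift(1)[OF m]])
    show "word_lift (\<lambda>us. word_lift (f us) (y + y')) x =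
        word_lift (\<lambda>us. word_lift (f us) y) x + word_lift (\<lambda>us. word_lift (f us) y') x" for x y y'
    proof (rule tensors_linear_eqI[where t = x])
      show "z2_linear (word_lift (\<lambda>us. word_lift (f us) (y + y')))"
        "z2_linear (\<lambda>x. word_lift (\<lambda>us. word_lift (f us) y) x + word_lift (\<lambda>us. word_lift (f us) y') x)"
        by (intro word_lift(1)[OF m] z2_linear_plus)+
    qed (unfold word_lift(2)[OF m], rule z2_linearD[OF lin])
  qed
qed

lemma z2_bilinear_tensors_eqI:
  assumes "z2_bilinear g" "z2_bilinear h" "\<And>us vs. g (word us) (word vs) = h (word us) (word vs)"
  shows "g x y = h x y"
proof (rule tensors_linear_eqI[where t = x])
  show "z2_linear (\<lambda>x. g x y)" "z2_linear (\<lambda>x. h x y)"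
    using assms(1,2) by (auto simp: z2_bilinear_def)
  show "g (word us) y = h (word us) y" for us
    by (rule tensors_linear_eqI[where t = y]) (use assms in \<open>auto simp: z2_bilinear_def\<close>)
qed


section \<open>The tensor algebra\<close>

text \<open>Concatenation of words turns the tensor coalgebra into a ring, which lets the summands of the
  recursions below be written as products \<open>letter a * t\<close>.\<close>

instantiation tensors :: (z2_vector) ring_1
begin

definition one_tensors :: "'a tensors" where
  "one_tensors = word []"

definition times_tensors :: "'a tensors \<Rightarrow> 'a tensors \<Rightarrow> 'a tensors" where
  "times_tensors x y = word_lift (\<lambda>us. word_lift (\<lambda>vs. word (us @ vs)) y) x"

lemma times_tensors_bilinear: "z2_bilinear ((*) :: 'a tensors \<Rightarrow> 'a tensors \<Rightarrow> 'a tensors)"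
  and word_append: "word (us @ vs) = word us * word (vs :: 'a list)"
proof -
  have m: "z2_multilinear (\<lambda>us. word (us @ vs))" "z2_multilinear (\<lambda>vs. word (us @ vs))"
    for us vs :: "'a list"
    using word_add[of "us @ us'" for us'] by (auto intro!: z2_multilinearI simp: word_add)
  show "z2_bilinear ((*) :: 'a tensors \<Rightarrow> 'a tensors \<Rightarrow> 'a tensors)"
    using word_lift_bilinear(1)[of "\<lambda>us vs. word (us @ vs)", OF m]
    by (simp add: times_tensors_def[abs_def])
  show "word (us @ vs) = word us * word vs"
    unfolding times_tensors_def using word_lift_bilinear(2)[of "\<lambda>us vs. word (us @ vs)", OF m] by simp
qed

instance
proof
  fix x y z :: "'a tensors"
  note add = z2_bilinear_add[OF times_tensors_bilinear]
  show "(x + y) * z = x * z + y * z" "x * (y + z) = x * y + x * z"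
    by (rule add)+
  have lin: "z2_linear (\<lambda>x. x * y)" "z2_linear (\<lambda>x. y * x)" for y :: "'a tensors"
    by (rule z2_linearI, rule add)+
  have "x * y * word ws = x * (y * word ws)" for ws
  proof (rule z2_bilinear_tensors_eqI[where x = x and y = y])
    show "z2_bilinear (\<lambda>x y. x * y * word ws)" "z2_bilinear (\<lambda>x y. x * (y * word ws))"
      by (rule z2_bilinearI; simp only: add)+
  qed (simp only: word_append[symmetric] append_assoc)
  then show "x * y * z = x * (y * z)"
    by (rule tensors_linear_eqI[OF lin(2) z2_linear_comp[OF lin(2) lin(2)]])
  show "1 * x = x"
    by (rule tensors_linear_eqI[OF lin(2) z2_linear_id(1)])
      (simp only: one_tensors_def word_append[symmetric] append_Nil)
  show "x * 1 = x"
    by (rule tensors_linear_eqI[OF lin(1) z2_linear_id(1)])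
      (simp only: one_tensors_def word_append[symmetric] append_Nil2)
  show "(0 :: 'a tensors) \<noteq> 1"
  proof
    assume "(0 :: 'a tensors) = 1"
    moreover have "z2_multilinear (\<lambda>ws :: 'a list. if ws = [] then 1 else 0 :: bit)"
      by (rule z2_multilinearI) simp
    note lin = word_lift(1)[OF this] and val = word_lift(2)[OF this]
    ultimately show False
      using z2_linear_zero[OF lin] val[of "[]"] by (simp add: one_tensors_def)
  qed
qed

end

abbreviation letter :: "'a::z2_vector \<Rightarrow> 'a tensors" where
  "letter a \<equiv> word [a]"

lemma word_Nil: "word [] = 1"
  by (simp add: one_tensors_def)

lemma word_Cons: "word (a # ws) = letter a * word ws"
  by (simp flip: word_append)

lemma letter_linear: "z2_linear letter"
  by (rule z2_linearI) (rule word_add[of "[]" _ _ "[]", simplified])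

lemmas letter_add = z2_linearD[OF letter_linear]
  and letter_zero [simp] = z2_linear_zero[OF letter_linear]
  and letter_sum = z2_linear_sum[OF letter_linear]

lemma mult_linear: "z2_linear (\<lambda>x. x * y)" "z2_linear (\<lambda>x. y * x)" for y :: "'a::z2_vector tensors"
  by (simp_all add: z2_linear_iff algebra_simps)


section \<open>Sums over the ways of cutting a word\<close>

text \<open>A function of words that is linear in each letter amounts to a linear map on the tensor
coalgebra, and summing over all cuts amounts to composing with the coproduct. The rules below are
the corresponding calculus for functions with values in an arbitrary commutative monoid.\<close>

definition cut_sum :: "('a list \<Rightarrow> 'a list \<Rightarrow> 'b::comm_monoid_add) \<Rightarrow> 'a list \<Rightarrow> 'b" where
  "cut_sum f ws = (\<Sum>i\<le>length ws. f (take i ws) (drop i ws))"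

lemma cut_sum_Nil [simp]: "cut_sum f [] = f [] []"
  by (simp add: cut_sum_def)

lemma cut_sum_Cons: "cut_sum f (a # ws) = f [] (a # ws) + cut_sum (\<lambda>x y. f (a # x) y) ws"
  by (simp add: cut_sum_def sum.atMost_Suc_shift del: sum.atMost_Suc)

lemma cut_sum_cong:
  assumes "\<And>x y. x @ y = ws \<Longrightarrow> f x y = g x y"
  shows "cut_sum f ws = cut_sum g ws"
  unfolding cut_sum_def by (intro sum.cong) (simp_all add: assms)

lemma cut_sum_add: "cut_sum (\<lambda>x y. f x y + g x y) ws = cut_sum f ws + cut_sum g ws"
  by (simp add: cut_sum_def sum.distrib)

lemma cut_sum_zero [simp]: "cut_sum (\<lambda>x y. 0) ws = 0"
  by (simp add: cut_sum_def)

lemma cut_sum_sum: "cut_sum (\<lambda>x y. \<Sum>i\<in>A. f i x y) ws = (\<Sum>i\<in>A. cut_sum (f i) ws)"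
  unfolding cut_sum_def by (rule sum.swap)

lemma cut_sum_swap:
  "cut_sum (\<lambda>x x'. cut_sum (\<lambda>y y'. f x x' y y') vs) us =
   cut_sum (\<lambda>y y'. cut_sum (\<lambda>x x'. f x x' y y') us) vs"
  unfolding cut_sum_def by (rule sum.swap)

lemma cut_sum_linear: "h (cut_sum f ws) = cut_sum (\<lambda>x y. h (f x y)) ws" if "z2_linear h"
  unfolding cut_sum_def by (rule z2_linear_sum[OF that])

text \<open>Both sides sum over all ways of cutting the word into three pieces: this is coassociativity.\<close>

lemma cut_sum_assoc:
  "cut_sum (\<lambda>x z. cut_sum (\<lambda>u v. f u v z) x) ws = cut_sum (\<lambda>u z. cut_sum (\<lambda>v z. f u v z) z) ws"
  by (induction ws arbitrary: f) (simp_all add: cut_sum_Cons cut_sum_add add.assoc)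

text \<open>A cut of \<open>us @ z # vs\<close> falls either in \<open>us\<close> or behind the letter \<open>z\<close>.\<close>

lemma cut_sum_marked:
  "cut_sum f (us @ z # vs) =
   cut_sum (\<lambda>x y. f x (y @ z # vs)) us + cut_sum (\<lambda>x y. f (us @ z # x) y) vs"
  by (induction us arbitrary: f) (simp_all add: cut_sum_Cons ac_simps)

text \<open>A letter of the word is a letter of exactly one of the two pieces, so linearity in that letter is
inherited from the argument of \<open>f\<close> that receives the piece.\<close>

lemma cut_sum_multilinear: "z2_multilinear (cut_sum f)"
  if "\<And>y. z2_multilinear (\<lambda>x. f x y)" "\<And>x. z2_multilinear (f x)"
proof (rule z2_multilinearI)
  fix us x y vs
  show "cut_sum f (us @ (x + y) # vs) = cut_sum f (us @ x # vs) + cut_sum f (us @ y # vs)"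
    using that(1)[THEN z2_multilinearD, of us x y] that(2)[THEN z2_multilinearD, of _ _ x y vs]
    by (simp add: cut_sum_marked cut_sum_add ac_simps)
qed

text \<open>A linear extension of \<open>f\<close> takes the value \<open>bar_sum d mul f ws\<close> on the bar differential of
  \<open>ws\<close>.\<close>

definition bar_sum ::
  "('a \<Rightarrow> 'a) \<Rightarrow> ('a \<Rightarrow> 'a \<Rightarrow> 'a) \<Rightarrow> ('a list \<Rightarrow> 'b::comm_monoid_add) \<Rightarrow> 'a list \<Rightarrow> 'b" where
  "bar_sum d mul f ws =
     (\<Sum>i<length ws. f (ws[i := d (ws ! i)])) + (\<Sum>i<length ws - 1. f (mul_at mul i ws))"

text \<open>The summand of the bar differential that multiplies \<open>a\<close> with the letter behind it.\<close>

definition merge_hd :: "('a \<Rightarrow> 'a \<Rightarrow> 'a) \<Rightarrow> ('a list \<Rightarrow> 'b::zero) \<Rightarrow> 'a \<Rightarrow> 'a list \<Rightarrow> 'b" where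
  "merge_hd mul f a ws = (case ws of [] \<Rightarrow> 0 | b # vs \<Rightarrow> f (mul a b # vs))"

lemma merge_hd_simps [simp]:
  "merge_hd mul f a [] = 0" "merge_hd mul f a (b # ws) = f (mul a b # ws)"
  by (simp_all add: merge_hd_def)

lemma bar_sum_Nil [simp]: "bar_sum d mul f [] = 0"
  by (simp add: bar_sum_def)

lemma bar_sum_Cons:
  "bar_sum d mul f (a # ws) =
   f (d a # ws) + bar_sum d mul (\<lambda>x. f (a # x)) ws + merge_hd mul f a ws"
proof (cases ws)
  case (Cons b vs)
  have "(\<Sum>i<length vs. f (mul_at mul (Suc i) (a # b # vs))) =
      (\<Sum>i<length vs. f (a # mul_at mul i (b # vs)))"
    by (simp add: mul_at_def)
  then show ?thesis
    by (simp add: bar_sum_def Cons sum.lessThan_Suc_shift mul_at_def ac_simps del: sum.lessThan_Suc)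
qed (simp add: bar_sum_def)

lemma bar_sum_cong:
  "bar_sum d mul f ws = bar_sum d mul g ws"
  if "\<And>x. x \<noteq> [] \<Longrightarrow> length x \<le> length ws \<Longrightarrow> f x = g x"
proof -
  have "ws[i := a] \<noteq> []" if "i < length ws" for i a
    using that by auto
  then show ?thesis
    unfolding bar_sum_def by (intro arg_cong2[where f = plus] sum.cong refl that)
      (auto simp: mul_at_def)
qed

lemma bar_sum_add: "bar_sum d mul (\<lambda>x. f x + g x) ws = bar_sum d mul f ws + bar_sum d mul g ws"
  by (simp add: bar_sum_def sum.distrib ac_simps)

lemma bar_sum_zero [simp]: "bar_sum d mul (\<lambda>x. 0) ws = 0"
  by (simp add: bar_sum_def)

lemma bar_sum_sum: "bar_sum d mul (\<lambda>x. \<Sum>i\<in>A. f i x) ws = (\<Sum>i\<in>A. bar_sum d mul (f i) ws)"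
  by (simp add: bar_sum_def sum.swap[of _ A] sum.distrib)

lemma bar_sum_linear: "h (bar_sum d mul f ws) = bar_sum d mul (\<lambda>x. h (f x)) ws" if "z2_linear h"
  by (simp add: bar_sum_def z2_linearD[OF that] z2_linear_sum[OF that])

lemma bar_sum_cut_sum_swap:
  "bar_sum d mul (\<lambda>u. cut_sum (\<lambda>x y. f u x y) vs) us =
   cut_sum (\<lambda>x y. bar_sum d mul (\<lambda>u. f u x y) us) vs"
  by (simp add: cut_sum_def bar_sum_sum)

text \<open>The bar differential is a coderivation: a product created at a cut can only arise from
  merging letters on the same side of the cut.\<close>

lemma bar_sum_cut_sum:
  "bar_sum d mul (cut_sum f) ws =
   cut_sum (\<lambda>x y. bar_sum d mul (\<lambda>x. f x y) x + bar_sum d mul (f x) y) ws"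
proof (induction ws arbitrary: f)
  case (Cons a ws)
  have merge: "merge_hd mul (cut_sum f) a ws =
      merge_hd mul (f []) a ws + cut_sum (\<lambda>x y. merge_hd mul (\<lambda>x. f x y) a x) ws"
    by (cases ws) (simp_all add: cut_sum_Cons)
  show ?case
    by (simp add: bar_sum_Cons cut_sum_Cons bar_sum_add cut_sum_add merge Cons.IH ac_simps)
qed simp

text \<open>Two changes at different places of the word are made in either order and cancel; those at the same
place cancel by the Leibniz rule, associativity and \<open>d (d x) = 0\<close>.\<close>

lemma bar_sum_bar_sum:
  fixes d :: "'a::z2_vector \<Rightarrow> 'a"
  assumes "z2_linear d" "\<And>x. d (d x) = 0"
    and "\<And>x y. d (mul x y) = mul (d x) y + mul x (d y)"
    and "\<And>x y z. mul (mul x y) z = mul x (mul y z)"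
    and "z2_multilinear f"
  shows "bar_sum d mul (bar_sum d mul f) ws = 0"
  using assms(5)
proof (induction ws arbitrary: f)
  case (Cons a ws)
  note f = z2_multilinear_hd_zero[OF Cons.prems] z2_multilinearD_hd[OF Cons.prems]
  have IH: "bar_sum d mul (bar_sum d mul (\<lambda>x. f (a # x))) ws = 0"
    using Cons by (simp add: z2_multilinear_Cons)
  show ?case
  proof (cases ws)
    case Nil
    then show ?thesis
      by (simp add: bar_sum_Cons assms(2) f)
  next
    case ws: (Cons b vs)
    show ?thesis
      using IH unfolding ws
      by (cases vs) (simp_all add: bar_sum_Cons bar_sum_add assms f ac_simps z2_cancel)
  qed
qed simp

lemma merge_hd_multilinear:
  assumes "z2_bilinear mul" "z2_multilinear f"
  shows "z2_multilinear (merge_hd mul f a)"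
proof (rule z2_multilinearI)
  fix us x y vs
  show "merge_hd mul f a (us @ (x + y) # vs) =
      merge_hd mul f a (us @ x # vs) + merge_hd mul f a (us @ y # vs)"
  proof (cases us)
    case Nil
    then show ?thesis
      by (simp add: z2_bilinear_add[OF assms(1)] z2_multilinearD_hd[OF assms(2)])
  next
    case (Cons b us')
    then show ?thesis
      using z2_multilinearD[OF assms(2), of "mul a b # us'"] by simp
  qed
qed

lemma bar_sum_multilinear:
  assumes "z2_linear d" "z2_bilinear mul" and "z2_multilinear f"
  shows "z2_multilinear (bar_sum d mul f)"
proof (rule z2_multilinearI)
  note d = z2_linearD[OF assms(1)] and mul = z2_bilinear_add[OF assms(2)]
  fix us x y vs
  show "bar_sum d mul f (us @ (x + y) # vs) =
      bar_sum d mul f (us @ x # vs) + bar_sum d mul f (us @ y # vs)"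
    using assms(3)
  proof (induction us arbitrary: f)
    case Nil
    note f = z2_multilinearD_hd[OF Nil]
    show ?case
      by (cases vs) (simp_all add: bar_sum_Cons bar_sum_add d mul f ac_simps)
  next
    case (Cons a us)
    note f = z2_multilinearD[OF Cons.prems, of "u # us" for u, simplified]
    show ?case
      by (simp add: bar_sum_Cons f z2_multilinearD[OF merge_hd_multilinear[OF assms(2) Cons.prems]]
        Cons.IH[OF z2_multilinear_Cons[OF Cons.prems]] ac_simps)
  qed
qed

lemma cut_sum_counit_left: "cut_sum (\<lambda>x y. if x = [] then g y else 0) ws = g ws"
  by (cases ws) (simp_all add: cut_sum_Cons)

lemma cut_sum_counit_right: "cut_sum (\<lambda>x y. if y = [] then g x else 0) ws = g ws"
  by (induction ws arbitrary: g) (simp_all add: cut_sum_Cons)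


section \<open>Gradings\<close>

lemma z2_subspaceI: "z2.subspace S" if "0 \<in> S" "\<And>x y. x \<in> S \<Longrightarrow> y \<in> S \<Longrightarrow> x + y \<in> S"
  using that by (simp add: z2.subspace_def z2_scale_def)

lemma z2_subspace_vimage: "z2.subspace {x. h x \<in> S}" if "z2_linear h" "z2.subspace S"
  using that
  by (intro z2_subspaceI)
    (simp_all add: z2_linearD z2_linear_zero z2.subspace_0 z2.subspace_add)

text \<open>A family of projections certifies that a spanning family of subspaces is independent.\<close>

lemma z2_gradingI:
  assumes sub: "\<And>n. z2.subspace (gr n)"
    and span: "\<And>x. x \<in> z2.span (\<Union>n. gr n)"
    and lin: "\<And>n. z2_linear (P n)"
    and proj: "\<And>m n x. x \<in> gr m \<Longrightarrow> P n x = (if n = m then x else 0)"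
  shows "z2_grading gr"
  unfolding z2_grading_def
proof (intro conjI allI sub)
  fix x
  have "\<exists>S. finite S \<and> (\<forall>n. P n x \<in> gr n) \<and> (\<forall>n. n \<notin> S \<longrightarrow> P n x = 0) \<and> x = (\<Sum>n\<in>S. P n x)"
    using span[of x]
  proof (induction x rule: z2.span_induct_alt)
    case base
    show ?case
      by (rule exI[of _ "{}"]) (simp add: z2_linear_zero[OF lin] z2.subspace_0[OF sub])
  next
    case (step c x y)
    then obtain m S where m: "x \<in> gr m" and S: "finite S" "\<And>n. P n y \<in> gr n"
        "\<And>n. n \<notin> S \<Longrightarrow> P n y = 0" "y = (\<Sum>n\<in>S. P n y)"
      by auto
    have cx: "z2_scale c x \<in> gr m"
      by (rule z2.subspace_scale[OF sub m])
    note P = z2_linearD[OF lin] proj[OF cx]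
    have S': "y = (\<Sum>n\<in>insert m S. P n y)"
      using S by (simp add: insert_absorb sum.insert_if)
    have "(\<Sum>n\<in>insert m S. P n (z2_scale c x)) = z2_scale c x"
      using S(1) by (simp add: proj[OF cx])
    with S' have "z2_scale c x + y = (\<Sum>n\<in>insert m S. P n (z2_scale c x + y))"
      by (simp only: z2_linearD[OF lin] sum.distrib)
    moreover have "\<forall>n. P n (z2_scale c x + y) \<in> gr n"
      using cx S(2) by (simp add: P z2.subspace_add[OF sub])
    moreover have "\<forall>n. n \<notin> insert m S \<longrightarrow> P n (z2_scale c x + y) = 0"
      using S(3) by (simp add: P)
    ultimately show ?case
      using S(1) by (intro exI[of _ "insert m S"]) simp
  qed
  then obtain S where S: "finite S" "\<And>n. P n x \<in> gr n" "\<And>n. n \<notin> S \<Longrightarrow> P n x = 0"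
      "x = (\<Sum>n\<in>S. P n x)"
    by blast
  show "\<exists>!f. (\<forall>n. f n \<in> gr n) \<and> finite {n. f n \<noteq> 0} \<and> x = (\<Sum>n | f n \<noteq> 0. f n)"
  proof (rule ex1I[of _ "\<lambda>n. P n x"], intro conjI allI S(2))
    show fin: "finite {n. P n x \<noteq> 0}"
      using S(1,3) by (auto intro: finite_subset)
    have "(\<Sum>n\<in>S. P n x) = (\<Sum>n | P n x \<noteq> 0. P n x)"
      using S(1,3) by (intro sum.mono_neutral_right) auto
    with S(4) show "x = (\<Sum>n | P n x \<noteq> 0. P n x)"
      by simp
  next
    fix f
    assume f: "(\<forall>n. f n \<in> gr n) \<and> finite {n. f n \<noteq> 0} \<and> x = (\<Sum>n | f n \<noteq> 0. f n)"
    show "f = (\<lambda>n. P n x)"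
    proof
      fix n
      have "P n x = (\<Sum>m | f m \<noteq> 0. P n (f m))"
        using f by (metis z2_linear_sum[OF lin])
      also have "\<dots> = (\<Sum>m | f m \<noteq> 0. if n = m then f m else 0)"
        using f by (intro sum.cong refl proj) auto
      also have "\<dots> = f n"
        using f by simp
      finally show "f n = P n x" ..
    qed
  qed
qed

definition component :: "(int \<Rightarrow> 'a::z2_vector set) \<Rightarrow> 'a \<Rightarrow> int \<Rightarrow> 'a" where
  "component gr x = (THE f. (\<forall>n. f n \<in> gr n) \<and> finite {n. f n \<noteq> 0} \<and> x = (\<Sum>n | f n \<noteq> 0. f n))"

context
  fixes gr :: "int \<Rightarrow> 'a::z2_vector set"
  assumes gr: "z2_grading gr"
begin

lemma component_props:
  "component gr x n \<in> gr n" "finite {n. component gr x n \<noteq> 0}"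
  "(\<Sum>n | component gr x n \<noteq> 0. component gr x n) = x"
proof -
  have "\<exists>!f. (\<forall>n. f n \<in> gr n) \<and> finite {n. f n \<noteq> 0} \<and> x = (\<Sum>n | f n \<noteq> 0. f n)"
    using gr unfolding z2_grading_def by blast
  from theI'[OF this, folded component_def]
  show "component gr x n \<in> gr n" "finite {n. component gr x n \<noteq> 0}"
    "(\<Sum>n | component gr x n \<noteq> 0. component gr x n) = x"
    by auto
qed

lemma component_unique:
  assumes "\<And>n. f n \<in> gr n" "finite S" "\<And>n. n \<notin> S \<Longrightarrow> f n = 0" "x = (\<Sum>n\<in>S. f n)"
  shows "component gr x = f"
proof -
  have fin: "finite {n. f n \<noteq> 0}"
    using assms(2,3) by (auto intro: finite_subset)
  have "(\<Sum>n\<in>S. f n) = (\<Sum>n | f n \<noteq> 0. f n)"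
    using assms by (intro sum.mono_neutral_right) auto
  then show ?thesis
    unfolding component_def using assms fin gr[unfolded z2_grading_def]
    by (intro the1_equality) auto
qed

lemma grading_subspace: "z2.subspace (gr n)"
  using gr by (simp add: z2_grading_def)

lemma component_add: "component gr (x + y) = (\<lambda>n. component gr x n + component gr y n)"
proof (rule component_unique[where S = "{n. component gr x n \<noteq> 0} \<union> {n. component gr y n \<noteq> 0}"])
  let ?S = "{n. component gr x n \<noteq> 0} \<union> {n. component gr y n \<noteq> 0}"
  have "(\<Sum>n\<in>?S. component gr z n) = z" if "z = x \<or> z = y" for z
  proof -
    have "(\<Sum>n\<in>?S. component gr z n) = (\<Sum>n | component gr z n \<noteq> 0. component gr z n)"
      using that by (intro sum.mono_neutral_right) (auto simp: component_props)
    then show ?thesis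
      by (simp add: component_props)
  qed
  then show "x + y = (\<Sum>n\<in>?S. component gr x n + component gr y n)"
    by (simp add: sum.distrib)
qed (auto simp: component_props z2.subspace_add[OF grading_subspace])

lemma component_homogeneous: "component gr x = (\<lambda>m. if m = n then x else 0)" if "x \<in> gr n"
  by (rule component_unique[where S = "{n}"]) (auto simp: that z2.subspace_0[OF grading_subspace])

text \<open>The range of summation depends on \<open>x\<close>, but components outside of it contribute \<open>h n 0 = 0\<close>, so
a common range can be chosen for two elements and their sum.\<close>

lemma sum_components_linear:
  assumes "\<And>n. z2_linear (h n)"
  shows "z2_linear (\<lambda>x. \<Sum>n | component gr x n \<noteq> 0. h n (component gr x n))"
proof (rule z2_linearI)
  fix x y
  let ?S = "{n. component gr x n \<noteq> 0} \<union> {n. component gr y n \<noteq> 0}"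
  have *: "(\<Sum>n | component gr z n \<noteq> 0. h n (component gr z n)) = (\<Sum>n\<in>?S. h n (component gr z n))"
    if "z = x \<or> z = y \<or> z = x + y" for z
    using that by (intro sum.mono_neutral_left)
      (auto simp: component_props component_add z2_linear_zero[OF assms])
  have "(\<Sum>n\<in>?S. h n (component gr (x + y) n)) =
      (\<Sum>n\<in>?S. h n (component gr x n)) + (\<Sum>n\<in>?S. h n (component gr y n))"
    by (simp only: component_add z2_linearD[OF assms] sum.distrib)
  then show "(\<Sum>n | component gr (x + y) n \<noteq> 0. h n (component gr (x + y) n)) =
      (\<Sum>n | component gr x n \<noteq> 0. h n (component gr x n)) +
      (\<Sum>n | component gr y n \<noteq> 0. h n (component gr y n))"
    using *[of x] *[of y] *[of "x + y"] by (simp only: simp_thms)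
qed

end

text \<open>A letter of degree \<open>j\<close> counts as \<open>j - 1\<close> because of the desuspension.\<close>

fun homogeneous_word :: "(int \<Rightarrow> 'v set) \<Rightarrow> 'v list \<Rightarrow> int \<Rightarrow> bool" where
  "homogeneous_word gr [] n \<longleftrightarrow> n = 0"
| "homogeneous_word gr (a # ws) n \<longleftrightarrow> (\<exists>j. a \<in> gr j \<and> homogeneous_word gr ws (n - (j - 1)))"

lemma homogeneous_word_iff:
  "homogeneous_word gr ws n \<longleftrightarrow>
   (\<exists>js. list_all2 (\<lambda>w j. w \<in> gr j) ws js \<and> n = (\<Sum>j\<leftarrow>js. j - 1))"
proof (induction ws arbitrary: n)
  case (Cons a ws)
  show ?case
    unfolding homogeneous_word.simps Cons.IH list_all2_Cons1
    by (fastforce simp: algebra_simps)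
qed simp

lemma bar_grading_eq: "bar_grading gr n = z2.span {word ws | ws. homogeneous_word gr ws n}"
  unfolding bar_grading_def homogeneous_word_iff by (rule arg_cong[where f = z2.span]) blast

lemma homogeneous_word_append:
  "homogeneous_word gr (us @ vs) n \<longleftrightarrow>
   (\<exists>m. homogeneous_word gr us m \<and> homogeneous_word gr vs (n - m))"
proof (induction us arbitrary: n)
  case (Cons a us)
  show ?case (is "?L \<longleftrightarrow> ?R")
  proof
    assume ?L
    then obtain j m where "a \<in> gr j" "homogeneous_word gr us m"
        "homogeneous_word gr vs (n - (j - 1) - m)"
      using Cons.IH by auto
    then show ?R
      by (intro exI[of _ "m + (j - 1)"]) (auto simp: algebra_simps intro!: exI[of _ j])
  next
    assume ?R
    then obtain j m where "a \<in> gr j" "homogeneous_word gr us (m - (j - 1))"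
        "homogeneous_word gr vs (n - m)"
      by auto
    then show ?L
      unfolding append_Cons homogeneous_word.simps Cons.IH
      by (intro exI[of _ j] conjI exI[of _ "m - (j - 1)"]) (simp_all add: algebra_simps)
  qed
qed simp

lemma bar_grading_subspace: "z2.subspace (bar_grading gr n)"
  by (simp add: bar_grading_def)

lemma bar_grading_word: "word ws \<in> bar_grading gr n" if "homogeneous_word gr ws n"
  unfolding bar_grading_eq using that by (intro z2.span_base) blast

lemma bar_grading_induct:
  assumes "x \<in> bar_grading gr n" "z2_linear h" "z2.subspace S"
    and "\<And>ws. homogeneous_word gr ws n \<Longrightarrow> h (word ws) \<in> S"
  shows "h x \<in> S"
  using assms(1) unfolding bar_grading_eq
proof (induction rule: z2.span_induct)
  case base
  show ?case
    by (rule z2_subspace_vimage[OF assms(2,3)])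
next
  case (step x)
  then show ?case
    using assms(4) by auto
qed

lemma bar_grading_times: "x * y \<in> bar_grading gr (m + n)"
  if "x \<in> bar_grading gr m" "y \<in> bar_grading gr n"
proof (rule bar_grading_induct[OF that(1) mult_linear(1) bar_grading_subspace])
  fix us
  assume us: "homogeneous_word gr us m"
  show "word us * y \<in> bar_grading gr (m + n)"
  proof (rule bar_grading_induct[OF that(2) mult_linear(2) bar_grading_subspace])
    fix vs
    assume "homogeneous_word gr vs n"
    then show "word us * word vs \<in> bar_grading gr (m + n)"
      using us unfolding word_append[symmetric]
      by (intro bar_grading_word) (auto simp: homogeneous_word_append intro!: exI[of _ m])
  qed
qed

lemma bar_grading_letter: "letter a \<in> bar_grading gr (n - 1)" if "a \<in> gr n"
  using that by (intro bar_grading_word) (auto intro: exI[of _ n])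

lemma bar_grading_one: "1 \<in> bar_grading gr 0"
  using bar_grading_word[of gr "[]" 0] by (simp add: word_Nil)

text \<open>The part of degree \<open>n\<close> of a word: every letter is replaced by its homogeneous components, and
the words of total degree \<open>n\<close> are kept. Extended linearly, these maps are the projections that
\<open>z2_gradingI\<close> asks for.\<close>

fun word_component :: "(int \<Rightarrow> 'v::z2_vector set) \<Rightarrow> int \<Rightarrow> 'v list \<Rightarrow> 'v tensors" where
  "word_component gr n [] = (if n = 0 then 1 else 0)"
| "word_component gr n (a # ws) =
     (\<Sum>j | component gr a j \<noteq> 0. letter (component gr a j) * word_component gr (n - (j - 1)) ws)"

lemma word_component_multilinear:
  assumes gr: "z2_grading gr"
  shows "z2_multilinear (word_component gr n)"
proof (rule z2_multilinearI)
  fix us x y vs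
  show "word_component gr n (us @ (x + y) # vs) =
      word_component gr n (us @ x # vs) + word_component gr n (us @ y # vs)"
  proof (induction us arbitrary: n)
    case Nil
    have "z2_linear (\<lambda>a. \<Sum>j | component gr a j \<noteq> 0.
        letter (component gr a j) * word_component gr (n - (j - 1)) vs)"
      by (rule sum_components_linear[OF gr]) (rule z2_linear_comp[OF mult_linear(1) letter_linear])
    then show ?case
      unfolding append_Nil word_component.simps by (rule z2_linearD)
  next
    case (Cons a us)
    then show ?case
      by (simp add: ring_distribs sum.distrib)
  qed
qed

lemma word_component_homogeneous:
  assumes gr: "z2_grading gr" and "homogeneous_word gr ws m"
  shows "word_component gr n ws = (if n = m then word ws else 0)"
  using assms(2)
proof (induction ws arbitrary: m n)
  case (Cons a ws)
  then obtain j where j: "a \<in> gr j" "homogeneous_word gr ws (m - (j - 1))"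
    by auto
  show ?case
  proof (cases "a = 0")
    case True
    then have "component gr 0 i = 0" for i
      using component_homogeneous[OF gr j(1)] by simp
    with True show ?thesis
      by (simp add: word_Cons[of 0 ws])
  next
    case False
    then have "{i. component gr a i \<noteq> 0} = {j}"
      by (auto simp: component_homogeneous[OF gr j(1)])
    then show ?thesis
      by (simp add: component_homogeneous[OF gr j(1)] Cons.IH[OF j(2)] word_Cons[of a ws])
  qed
qed (auto simp: word_Nil)

text \<open>A word is a sum of homogeneous words, by splitting its letters one after the other.\<close>

lemma tensors_in_span_homogeneous:
  assumes gr: "z2_grading gr"
  shows "x \<in> z2.span (\<Union>n. bar_grading gr n)"
proof -
  let ?S = "z2.span (\<Union>n. bar_grading gr n)"
  have letter: "letter (component gr a j) * y \<in> ?S" if "y \<in> ?S" for a j y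
    using that
  proof (induction rule: z2.span_induct)
    case base
    show ?case
      by (rule z2_subspace_vimage[OF mult_linear(2) z2.subspace_span])
  next
    case (step y)
    then obtain n where n: "y \<in> bar_grading gr n"
      by blast
    show ?case
      using bar_grading_times[OF bar_grading_letter[OF component_props(1)[OF gr]] n]
      by (intro z2.span_base) (rule UN_I[OF UNIV_I])
  qed
  have word: "word ws \<in> ?S" for ws
  proof (induction ws)
    case Nil
    show ?case
      unfolding word_Nil by (rule z2.span_base) (use bar_grading_one in blast)
  next
    case (Cons a ws)
    have "word (a # ws) = (\<Sum>j | component gr a j \<noteq> 0. letter (component gr a j) * word ws)"
      by (simp only: component_props(3)[OF gr] flip: word_Cons[of a ws] sum_distrib_right letter_sum)
    then show ?case
      by (simp only:) (intro z2.span_sum letter Cons)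
  qed
  obtain p where x: "x = abs_tensors p"
    by (metis Quotient3_abs_rep[OF Quotient3_tensors])
  show ?thesis
    unfolding x
  proof (induction p rule: update_induct)
    case const
    show ?case
      using z2.span_zero[of "\<Union>n. bar_grading gr n"] by (simp add: zero_tensors.abs_eq)
  next
    case (update p ws c)
    have "Poly_Mapping.update ws c p = p + Poly_Mapping.single ws c"
      using update.hyps(1)
      by (intro poly_mapping_eqI) (auto simp: lookup_update lookup_add lookup_single in_keys_iff)
    moreover have "c = 1"
      using update.hyps(2) by (cases c) auto
    ultimately show ?case
      using z2.span_add[OF update.IH word[of ws]] by (simp add: plus_tensors.abs_eq word.abs_eq)
  qed
qed

lemma bar_grading_grading:
  assumes gr: "z2_grading gr"
  shows "z2_grading (bar_grading gr)"
proof (rule z2_gradingI[where P = "\<lambda>n. word_lift (word_component gr n)"])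
  note m = word_component_multilinear[OF gr]
  show lin: "z2_linear (word_lift (word_component gr n))" for n
    by (rule word_lift(1)[OF m])
  show "word_lift (word_component gr n) x = (if n = m then x else 0)"
    if "x \<in> bar_grading gr m" for m n x
  proof (rule iffD2[OF z2_eq_iff_add], rule singletonD, rule bar_grading_induct[OF that])
    show "z2_linear (\<lambda>x. word_lift (word_component gr n) x + (if n = m then x else 0))"
      using z2_linearD[OF lin] by (simp add: z2_linear_iff ac_simps)
    show "z2.subspace {0 :: 'a tensors}"
      by simp
    show "word_lift (word_component gr n) (word ws) + (if n = m then word ws else 0) \<in> {0}"
      if "homogeneous_word gr ws m" for ws
      by (simp add: word_lift(2)[OF m] word_component_homogeneous[OF gr that] add_self_zero)
  qed
qed (rule bar_grading_subspace, rule tensors_in_span_homogeneous[OF gr])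


section \<open>The bar construction as a DG-coalgebra\<close>

lemma bar_comult_linear: "z2_linear (bar_comult :: 'v::z2_vector tensors \<Rightarrow> _)"
  and bar_comult_word:
    "bar_comult (word ws) = cut_sum (\<lambda>x y. word x \<otimes> word y) (ws :: 'v::z2_vector list)"
proof -
  have m: "z2_multilinear (cut_sum (\<lambda>x y. word x \<otimes> word (y :: 'v list)))"
    by (intro cut_sum_multilinear z2_multilinear_comp[OF _ word_multilinear] pure_tensor_linear)
  have "bar_comult = word_lift (cut_sum (\<lambda>x y. word x \<otimes> word (y :: 'v list)))"
    unfolding bar_comult_def cut_sum_def ..
  with word_lift[OF m]
  show "z2_linear (bar_comult :: 'v tensors \<Rightarrow> _)"
    "bar_comult (word ws) = cut_sum (\<lambda>x y. word x \<otimes> word (y :: 'v list)) ws"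
    by simp_all
qed

lemma bar_counit_linear: "z2_linear bar_counit"
  and bar_counit_word: "bar_counit (word ws) = (if ws = [] then 1 else 0)"
proof -
  have m: "z2_multilinear (\<lambda>ws. if ws = [] then 1 else 0 :: bit)"
    by (rule z2_multilinearI) simp
  show "z2_linear bar_counit" "bar_counit (word ws) = (if ws = [] then 1 else 0)"
    unfolding bar_counit_def by (rule word_lift[OF m])+
qed

lemma z2_scale_add:
  "z2_scale (c + c') x = z2_scale c x + z2_scale c' x"
  "z2_scale c (x + x') = z2_scale c x + z2_scale c x'"
  by (rule z2.scale_left_distrib, rule z2.scale_right_distrib)

lemma counit_bilinear:
  "z2_bilinear (\<lambda>y z. z2_scale (bar_counit y) z)" "z2_bilinear (\<lambda>y z. z2_scale (bar_counit z) y)"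
  by (intro z2_bilinearI; simp only: z2_linearD[OF bar_counit_linear] z2_scale_add)+

text \<open>An augmentation ideal is closed under the differential and the product but does not contain the unit.\<close>

locale nonunital_dg_algebra = cochain_complex gr d
  for gr :: "int \<Rightarrow> 'v::z2_vector set" and d :: "'v \<Rightarrow> 'v" +
  fixes mul :: "'v \<Rightarrow> 'v \<Rightarrow> 'v"
  assumes mul_bilinear: "z2_bilinear mul"
    and mul_degree: "x \<in> gr m \<Longrightarrow> y \<in> gr n \<Longrightarrow> mul x y \<in> gr (m + n)"
    and mul_assoc: "mul (mul x y) z = mul x (mul y z)"
    and leibniz: "d (mul x y) = mul (d x) y + mul x (d y)"
begin

abbreviation "bd \<equiv> bar_d d mul"

lemma bar_d_linear: "z2_linear bd"
  and bar_d_word: "bd (word ws) = bar_sum d mul word ws"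
proof -
  note m = bar_sum_multilinear[OF d_linear mul_bilinear word_multilinear]
  show "z2_linear bd" "bd (word ws) = bar_sum d mul word ws"
    unfolding bar_d_def bar_sum_def[symmetric] by (rule word_lift[OF m])+
qed

lemma linear_bar_d_word: "h (bd (word ws)) = bar_sum d mul (\<lambda>x. h (word x)) ws"
  if "z2_linear h"
  by (simp add: bar_d_word bar_sum_linear[OF that])

lemma bar_d_bar_d: "bd (bd x) = 0"
proof (rule tensors_linear_eqI[OF z2_linear_comp[OF bar_d_linear bar_d_linear] z2_linear_const_zero])
  fix ws
  have "bd (bd (word ws)) = bar_sum d mul (bar_sum d mul word) ws"
    by (simp only: linear_bar_d_word[OF bar_d_linear]) (simp only: bar_d_word)
  also have "\<dots> = 0"
    using bar_sum_bar_sum[where d = d and mul = mul and f = word] d_linear d_d leibniz mul_assoc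
      word_multilinear by blast
  finally show "bd (bd (word ws)) = 0" .
qed

text \<open>Applying \<open>d\<close> raises the degree of a letter by one; multiplying two letters replaces two
desuspensions by one. Either way the total degree goes up by one.\<close>

lemma bar_sum_in_subspace:
  assumes "homogeneous_word gr ws n" "z2.subspace S"
    and "\<And>x. homogeneous_word gr x (n + 1) \<Longrightarrow> f x \<in> S"
  shows "bar_sum d mul f ws \<in> S"
  using assms(1,3)
proof (induction ws arbitrary: n f)
  case Nil
  show ?case
    by (simp add: z2.subspace_0[OF assms(2)])
next
  case (Cons a ws)
  obtain j where j: "a \<in> gr j" "homogeneous_word gr ws (n - (j - 1))"
    using Cons.prems(1) by auto
  have "f (d a # ws) \<in> S"
  proof (rule Cons.prems(2))
    have "n + 1 - (j + 1 - 1) = n - (j - 1)"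
      by simp
    then show "homogeneous_word gr (d a # ws) (n + 1)"
      using j d_degree[OF j(1)] unfolding homogeneous_word.simps by metis
  qed
  moreover have "bar_sum d mul (\<lambda>x. f (a # x)) ws \<in> S"
  proof (rule Cons.IH[OF j(2)], rule Cons.prems(2))
    show "homogeneous_word gr (a # x) (n + 1)" if "homogeneous_word gr x (n - (j - 1) + 1)" for x
    proof -
      have "n - (j - 1) + 1 = n + 1 - (j - 1)"
        by simp
      then show ?thesis
        using j that unfolding homogeneous_word.simps by metis
    qed
  qed
  moreover have "merge_hd mul f a ws \<in> S"
  proof (cases ws)
    case Nil
    then show ?thesis
      by (simp add: z2.subspace_0[OF assms(2)])
  next
    case ws: (Cons b vs)
    with j obtain i where i: "b \<in> gr i" "homogeneous_word gr vs (n - (j - 1) - (i - 1))"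
      by auto
    have "n - (j - 1) - (i - 1) = n + 1 - (j + i - 1)"
      by simp
    then have "homogeneous_word gr (mul a b # vs) (n + 1)"
      using i(2) mul_degree[OF j(1) i(1)] unfolding homogeneous_word.simps by metis
    then show ?thesis
      unfolding ws merge_hd_simps by (rule Cons.prems(2))
  qed
  ultimately show ?case
    by (simp add: bar_sum_Cons z2.subspace_add[OF assms(2)])
qed

lemma bar_d_degree: "bd x \<in> bar_grading gr (n + 1)" if "x \<in> bar_grading gr n"
  using that bar_d_linear bar_grading_subspace
proof (rule bar_grading_induct)
  show "bd (word ws) \<in> bar_grading gr (n + 1)" if "homogeneous_word gr ws n" for ws
    unfolding bar_d_word
    by (rule bar_sum_in_subspace[OF that bar_grading_subspace]) (rule bar_grading_word)
qed

lemma bar_cochain_complex: "cochain_complex (bar_grading gr) bd"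
  by (rule cochain_complex.intro)
    (fact bar_grading_grading[OF grading] bar_d_linear bar_d_degree bar_d_bar_d)+

lemma cut_sum_in_subspace:
  assumes "homogeneous_word gr ws n" "z2.subspace S"
    and "\<And>x y m. homogeneous_word gr x m \<Longrightarrow> homogeneous_word gr y (n - m) \<Longrightarrow> f x y \<in> S"
  shows "cut_sum f ws \<in> S"
  unfolding cut_sum_def
proof (rule z2.subspace_sum[OF assms(2)])
  fix i
  show "f (take i ws) (drop i ws) \<in> S"
    using assms(1,3) by (metis append_take_drop_id homogeneous_word_append)
qed

lemma bar_dg_coalgebra: "dg_coalgebra (bar_grading gr) bd bar_comult bar_counit"
proof -
  note map_lin = tensor_map_linear and map_pure = tensor_map_pure
  note lin = bar_comult_linear bar_d_linear bar_counit_linear z2_linear_id tensor_assoc_linear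
  show ?thesis
  proof (intro dg_coalgebra.intro dg_coalgebra_axioms.intro bar_cochain_complex)
    show "z2_linear bar_comult" "z2_linear bar_counit"
      by (rule lin)+
    show "bar_comult x \<in> tensor_grading (bar_grading gr) (bar_grading gr) n"
      if "x \<in> bar_grading gr n" for x  and n
      using that lin(1)
    proof (rule bar_grading_induct)
      show sub: "z2.subspace (tensor_grading (bar_grading gr) (bar_grading gr) n)"
        by (simp add: tensor_grading_def)
      fix ws
      assume ws: "homogeneous_word gr ws n"
      show "bar_comult (word ws) \<in> tensor_grading (bar_grading gr) (bar_grading gr) n"
        unfolding bar_comult_word
      proof (rule cut_sum_in_subspace[OF ws sub])
        fix x y m
        assume xy: "homogeneous_word gr x m" "homogeneous_word gr y (n - m)"
        show "word x \<otimes> word y \<in> tensor_grading (bar_grading gr) (bar_grading gr) n"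
          unfolding tensor_grading_def
          by (rule z2.span_base, rule CollectI, rule exI[of _ "word x"],
              rule exI[of _ "word y"], rule exI[of _ m], rule exI[of _ "n - m"])
            (simp add: bar_grading_word xy)
      qed
    qed
    show "bar_counit x = 0" if "x \<in> bar_grading gr n" "n \<noteq> 0" for x  and n
    proof -
      have "bar_counit x \<in> {0}"
        using that(1) lin(3) z2.subspace_single_0
      proof (rule bar_grading_induct)
        show "bar_counit (word ws) \<in> {0}" if "homogeneous_word gr ws n" for ws 
          using that \<open>n \<noteq> 0\<close> by (cases ws) (auto simp: bar_counit_word)
      qed
      then show ?thesis by simp
    qed
    show "tensor_assoc (tensor_map bar_comult id (bar_comult x)) =
        tensor_map id bar_comult (bar_comult x)" for x 
    proof (rule tensors_linear_eqI[where t = x])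
      note l1 = map_lin[OF bar_comult_linear z2_linear_id(2)]
        and l2 = map_lin[OF z2_linear_id(2) bar_comult_linear]
      show "z2_linear (\<lambda>x. tensor_assoc (tensor_map bar_comult id (bar_comult x)))"
        "z2_linear (\<lambda>x. tensor_map id bar_comult (bar_comult x))"
        by (rule z2_linear_comp[OF tensor_assoc_linear z2_linear_comp[OF l1 lin(1)]],
            rule z2_linear_comp[OF l2 lin(1)])
      fix ws 
      have "tensor_assoc (tensor_map bar_comult id (bar_comult (word ws))) =
          cut_sum (\<lambda>x z. cut_sum (\<lambda>u v. word u \<otimes> (word v \<otimes> word z)) x) ws"
        by (simp add: bar_comult_word cut_sum_linear[OF l1] tensor_map_pure bar_comult_linear
          z2_linear_id cut_sum_linear[OF pure_tensor_linear(1)] cut_sum_linear[OF tensor_assoc_linear]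
          tensor_assoc_pure)
      also have "\<dots> = tensor_map id bar_comult (bar_comult (word ws))"
        by (simp add: cut_sum_assoc bar_comult_word cut_sum_linear[OF l2] tensor_map_pure
          bar_comult_linear z2_linear_id cut_sum_linear[OF pure_tensor_linear(2)])
      finally show "tensor_assoc (tensor_map bar_comult id (bar_comult (word ws))) =
          tensor_map id bar_comult (bar_comult (word ws))" .
    qed
    have scale: "z2_scale (if b then 1 else 0) x = (if b then x else 0)" for b and x 
      by (simp add: z2_scale_def)
    show "tensor_lift (\<lambda>y z. z2_scale (bar_counit y) z) (bar_comult x) = x" for x 
    proof (rule tensors_linear_eqI[where t = x])
      note l = tensor_lift(1)[OF counit_bilinear(1)]
      show "z2_linear (\<lambda>x . tensor_lift (\<lambda>y z. z2_scale (bar_counit y) z) (bar_comult x))"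
        by (rule z2_linear_comp[OF l lin(1)])
      show "tensor_lift (\<lambda>y z. z2_scale (bar_counit y) z) (bar_comult (word ws)) = word ws"
        for ws 
        by (simp add: bar_comult_word cut_sum_linear[OF l] tensor_lift(2)[OF counit_bilinear(1)]
          bar_counit_word scale cut_sum_counit_left)
    qed (rule z2_linear_id)
    show "tensor_lift (\<lambda>y z. z2_scale (bar_counit z) y) (bar_comult x) = x" for x 
    proof (rule tensors_linear_eqI[where t = x])
      note l = tensor_lift(1)[OF counit_bilinear(2)]
      show "z2_linear (\<lambda>x . tensor_lift (\<lambda>y z. z2_scale (bar_counit z) y) (bar_comult x))"
        by (rule z2_linear_comp[OF l lin(1)])
      show "tensor_lift (\<lambda>y z. z2_scale (bar_counit z) y) (bar_comult (word ws)) = word ws"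
        for ws 
        by (simp add: bar_comult_word cut_sum_linear[OF l] tensor_lift(2)[OF counit_bilinear(2)]
          bar_counit_word scale cut_sum_counit_right)
    qed (rule z2_linear_id)
    show "bar_comult (bd x) =
        tensor_map bd id (bar_comult x) + tensor_map id bd (bar_comult x)" for x
    proof (rule tensors_linear_eqI[where t = x])
      note l1 = map_lin[OF bar_d_linear z2_linear_id(2)]
        and l2 = map_lin[OF z2_linear_id(2) bar_d_linear]
      show "z2_linear (\<lambda>x. bar_comult (bd x))"
        "z2_linear (\<lambda>x. tensor_map bd id (bar_comult x) + tensor_map id bd (bar_comult x))"
        by (rule z2_linear_comp[OF lin(1,2)],
            rule z2_linear_plus[OF z2_linear_comp[OF l1 lin(1)] z2_linear_comp[OF l2 lin(1)]])
      fix ws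
      have "bar_comult (bd (word ws)) =
          cut_sum (\<lambda>x y. bar_sum d mul (\<lambda>x. word x \<otimes> word y) x +
            bar_sum d mul (\<lambda>y. word x \<otimes> word y) y) ws"
        by (simp add: linear_bar_d_word[OF lin(1)] bar_comult_word bar_sum_cut_sum)
      also have "\<dots> =
          tensor_map bd id (bar_comult (word ws)) + tensor_map id bd (bar_comult (word ws))"
        by (simp add: bar_comult_word cut_sum_linear[OF l1] cut_sum_linear[OF l2] cut_sum_add
          tensor_map_pure bar_d_linear z2_linear_id bar_d_word bar_sum_linear[OF pure_tensor_linear(1)]
          bar_sum_linear[OF pure_tensor_linear(2)])
      finally show "bar_comult (bd (word ws)) =
          tensor_map bd id (bar_comult (word ws)) + tensor_map id bd (bar_comult (word ws))" .
    qed
    show "bar_counit (bd x) = 0" for x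
    proof (rule tensors_linear_eqI[where t = x])
      show "z2_linear (\<lambda>x. bar_counit (bd x))"
        by (rule z2_linear_comp[OF lin(3,2)])
      fix ws
      have "bar_counit (bd (word ws)) = bar_sum d mul (\<lambda>x. 0) ws"
        unfolding linear_bar_d_word[OF lin(3)] by (rule bar_sum_cong) (simp add: bar_counit_word)
      then show "bar_counit (bd (word ws)) = 0"
        by simp
    qed (rule z2_linear_const_zero)
  qed
qed

end


section \<open>The words of a product\<close>

text \<open>The calculus of cuts for pairs of words, which corresponds to the coproduct of the tensor square:
the arguments of \<open>f\<close> are the two first pieces, followed by the two second pieces.\<close>

definition cut_sum2 ::
  "('a list \<Rightarrow> 'b list \<Rightarrow> 'a list \<Rightarrow> 'b list \<Rightarrow> 'c::comm_monoid_add) \<Rightarrow> 'a list \<Rightarrow> 'b list \<Rightarrow> 'c" where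
  "cut_sum2 f us vs = cut_sum (\<lambda>x x'. cut_sum (\<lambda>y y'. f x y x' y') vs) us"

lemma cut_sum2_cong:
  assumes "\<And>x y x' y'. x @ x' = us \<Longrightarrow> y @ y' = vs \<Longrightarrow> f x y x' y' = g x y x' y'"
  shows "cut_sum2 f us vs = cut_sum2 g us vs"
  unfolding cut_sum2_def by (intro cut_sum_cong assms)

lemma cut_sum2_add:
  "cut_sum2 (\<lambda>x y x' y'. f x y x' y' + g x y x' y') us vs = cut_sum2 f us vs + cut_sum2 g us vs"
  by (simp add: cut_sum2_def cut_sum_add)

lemma cut_sum2_zero [simp]: "cut_sum2 (\<lambda>x y x' y'. 0) us vs = 0"
  by (simp add: cut_sum2_def)

lemma cut_sum2_sum:
  "cut_sum2 (\<lambda>x y x' y'. \<Sum>i\<in>A. f i x y x' y') us vs = (\<Sum>i\<in>A. cut_sum2 (f i) us vs)"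
  by (simp add: cut_sum2_def cut_sum_sum)

lemma cut_sum2_linear:
  "h (cut_sum2 f us vs) = cut_sum2 (\<lambda>x y x' y'. h (f x y x' y')) us vs" if "z2_linear h"
  by (simp add: cut_sum2_def cut_sum_linear[OF that])

lemma cut_sum2_flip: "cut_sum2 f us vs = cut_sum2 (\<lambda>y x y' x'. f x y x' y') vs us"
  unfolding cut_sum2_def by (rule cut_sum_swap)

lemma cut_sum2_assoc:
  "cut_sum2 (\<lambda>x y x'' y''. cut_sum2 (\<lambda>u v u' v'. f u v u' v' x'' y'') x y) us vs =
   cut_sum2 (\<lambda>u v x y. cut_sum2 (\<lambda>u' v' x'' y''. f u v u' v' x'' y'') x y) us vs"
proof -
  have "cut_sum2 (\<lambda>x y x'' y''. cut_sum2 (\<lambda>u v u' v'. f u v u' v' x'' y'') x y) us vs =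
      cut_sum (\<lambda>x x''. cut_sum (\<lambda>u u'. cut_sum (\<lambda>y y''. cut_sum (\<lambda>v v'.
        f u v u' v' x'' y'') y) vs) x) us"
    unfolding cut_sum2_def by (intro cut_sum_cong cut_sum_swap)
  also have "\<dots> = cut_sum (\<lambda>u x. cut_sum (\<lambda>u' x''. cut_sum (\<lambda>v y. cut_sum (\<lambda>v' y''.
        f u v u' v' x'' y'') y) vs) x) us"
    by (simp only: cut_sum_assoc)
  also have "\<dots> = cut_sum2 (\<lambda>u v x y. cut_sum2 (\<lambda>u' v' x'' y''. f u v u' v' x'' y'') x y) us vs"
    unfolding cut_sum2_def by (intro cut_sum_cong cut_sum_swap)
  finally show ?thesis .
qed

lemma op_swap_funpow: "(op_swap ^^ s) f x y = (if even s then f x y else f y x)"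
  by (induction s arbitrary: x y) (simp_all add: op_swap_def)

lemma cup_cuts_Nil: "[] \<in> cup_cuts k us vs \<longleftrightarrow> k = 0 \<and> us = [] \<and> vs = []"
  by (auto simp: cup_cuts_def)

lemma cup_cuts_Cons:
  "(i, xs, ys) # L \<in> cup_cuts k us vs \<longleftrightarrow>
   i \<le> k \<and> (xs, ys) \<noteq> ([], []) \<and>
   (\<exists>us' vs'. us = xs @ us' \<and> vs = ys @ vs' \<and> L \<in> cup_cuts (k - i) us' vs')"
  by (auto simp: cup_cuts_def)

text \<open>Either there are no blocks, or the list is determined by the index of its first operation, the
lengths \<open>p\<close>, \<open>q\<close> of its first two blocks, and its tail.\<close>

lemma cup_cuts_rec:
  "cup_cuts k us vs = (if k = 0 \<and> us = [] \<and> vs = [] then {[]} else {}) \<union>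
   (\<Union>(i, p, q)\<in>{..k} \<times> {..length us} \<times> {..length vs}. if p = 0 \<and> q = 0 then {}
      else (#) (i, take p us, take q vs) ` cup_cuts (k - i) (drop p us) (drop q vs))"
  (is "_ = ?A \<union> ?B")
proof (rule set_eqI)
  fix L
  show "L \<in> cup_cuts k us vs \<longleftrightarrow> L \<in> ?A \<union> ?B"
  proof (cases L)
    case Nil
    then show ?thesis
      by (auto simp: cup_cuts_Nil split: if_splits)
  next
    case (Cons c L')
    obtain i xs ys where c: "c = (i, xs, ys)"
      by (cases c)
    show ?thesis
    proof
      assume "L \<in> cup_cuts k us vs"
      then obtain us' vs' where *: "i \<le> k" "(xs, ys) \<noteq> ([], [])" "us = xs @ us'" "vs = ys @ vs'"
          "L' \<in> cup_cuts (k - i) us' vs'"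
        by (auto simp: Cons c cup_cuts_Cons)
      then have "(i, length xs, length ys) \<in> {..k} \<times> {..length us} \<times> {..length vs}"
        by simp
      moreover have "L \<in> (#) (i, take (length xs) us, take (length ys) vs) `
          cup_cuts (k - i) (drop (length xs) us) (drop (length ys) vs)"
        using * by (simp add: Cons c)
      moreover have "\<not> (length xs = 0 \<and> length ys = 0)"
        using * by simp
      ultimately have "L \<in> ?B"
        by (intro UN_I[of "(i, length xs, length ys)"]) simp_all
      then show "L \<in> ?A \<union> ?B" ..
    next
      assume "L \<in> ?A \<union> ?B"
      then have "L \<in> ?B"
        by (auto simp: Cons split: if_splits)
      then obtain j p q where *: "j \<le> k" "p \<le> length us" "q \<le> length vs" "\<not> (p = 0 \<and> q = 0)"
          "L \<in> (#) (j, take p us, take q vs) ` cup_cuts (k - j) (drop p us) (drop q vs)"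
        by (auto split: if_splits)
      then obtain x where x: "L = (j, take p us, take q vs) # x"
          "x \<in> cup_cuts (k - j) (drop p us) (drop q vs)"
        by blast
      then have "\<exists>us' vs'. us = take p us @ us' \<and> vs = take q vs @ vs' \<and>
          x \<in> cup_cuts (k - j) us' vs'"
        by (intro exI[of _ "drop p us"] exI[of _ "drop q vs"]) simp
      with * show "L \<in> cup_cuts k us vs"
        by (auto simp add: x(1) cup_cuts_Cons)
    qed
  qed
qed

lemma finite_cup_cuts: "finite (cup_cuts k us vs)"
proof (induction "length us + length vs" arbitrary: k us vs rule: less_induct)
  case less
  have "finite (if p = 0 \<and> q = 0 then {}
      else (#) (i, take p us, take q vs) ` cup_cuts (k - i) (drop p us) (drop q vs))"
    if "p \<le> length us" "q \<le> length vs" for i p q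
    using that by (auto intro!: finite_imageI less)
  then show ?case
    by (subst cup_cuts_rec) auto
qed

text \<open>The products make sense, and are compatible with the coproduct, for any family of multilinear
operations. In the locale below, \<open>Fs s\<close> is the family of operations after \<open>s\<close> transpositions of
the two words, and \<open>cup_words s k\<close> is the product formed from it. Keeping \<open>s\<close> as a parameter is
what makes the products satisfy a recursion: the tail of a product is a product with \<open>s\<close> increased
by the index of the first operation.\<close>

locale word_operations =
  fixes F :: "nat \<Rightarrow> 'v::z2_vector list \<Rightarrow> 'v list \<Rightarrow> 'v"
  assumes F_Nil: "F k [] [] = 0"
    and F_multilinear_left: "z2_multilinear (\<lambda>xs. F k xs ys)"
    and F_multilinear_right: "z2_multilinear (\<lambda>ys. F k xs ys)"
begin

definition Fs :: "nat \<Rightarrow> nat \<Rightarrow> 'v list \<Rightarrow> 'v list \<Rightarrow> 'v" where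
  "Fs s i = (op_swap ^^ s) (F i)"

definition cup_words :: "nat \<Rightarrow> nat \<Rightarrow> 'v list \<Rightarrow> 'v list \<Rightarrow> 'v tensors" where
  "cup_words s k us vs = (\<Sum>L\<in>cup_cuts k us vs. word (cup_letters F s L))"

lemma Fs_apply: "Fs s i xs ys = (if even s then F i xs ys else F i ys xs)"
  by (simp add: Fs_def op_swap_funpow)

lemma Fs_Suc: "Fs (Suc s) i xs ys = Fs s i ys xs"
  by (simp add: Fs_apply)

lemma Fs_Nil [simp]: "Fs s i [] [] = 0"
  by (simp add: Fs_apply F_Nil)

lemma Fs_multilinear_left: "z2_multilinear (\<lambda>xs. Fs s k xs ys)"
  using F_multilinear_left F_multilinear_right by (cases "even s") (simp_all add: Fs_apply)

definition cup_unit :: "nat \<Rightarrow> 'v list \<Rightarrow> 'v list \<Rightarrow> 'v tensors" where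
  "cup_unit k us vs = (if k = 0 \<and> us = [] \<and> vs = [] then 1 else 0)"

text \<open>The decomposition of a product according to its first letter, from which all properties of the
products are derived.\<close>

lemma cup_words_rec:
  "cup_words s k us vs = cup_unit k us vs +
   (\<Sum>i\<le>k. cut_sum2 (\<lambda>x y x' y'. letter (Fs s i x y) * cup_words (s + i) (k - i) x' y') us vs)"
proof -
  let ?I = "{..k} \<times> {..length us} \<times> {..length vs}"
  let ?A = "if k = 0 \<and> us = [] \<and> vs = [] then {[]} else {}"
  let ?B = "\<lambda>(i, p, q). if p = 0 \<and> q = 0 then {}
    else (#) (i, take p us, take q vs) ` cup_cuts (k - i) (drop p us) (drop q vs)"
  let ?w = "\<lambda>L. word (cup_letters F s L)"
  have fin: "finite (?B a)" for a
    by (auto simp: finite_cup_cuts split: prod.split)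
  have "cup_words s k us vs = sum ?w (?A \<union> \<Union> (?B ` ?I))"
    unfolding cup_words_def by (subst cup_cuts_rec) simp
  also have "\<dots> = sum ?w ?A + sum ?w (\<Union> (?B ` ?I))"
    by (rule sum.union_disjoint) (auto simp: fin split: if_splits)
  also have "sum ?w ?A = cup_unit k us vs"
    by (simp add: cup_unit_def word_Nil)
  also have "sum ?w (\<Union> (?B ` ?I)) = (\<Sum>a\<in>?I. sum ?w (?B a))"
  proof (rule sum.UNION_disjoint)
    have "a = b" if a: "a \<in> ?I" "L \<in> ?B a" and b: "b \<in> ?I" "L \<in> ?B b"
      for a b :: "nat \<times> nat \<times> nat" and L
    proof -
      obtain i p q i' p' q' where ab: "a = (i, p, q)" "b = (i', p', q')"
        by (cases a, cases b)
      from a b have "i = i'" "take p us = take p' us" "take q vs = take q' vs"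
        by (auto simp: ab split: if_splits)
      moreover from this have "p = p'" "q = q'"
        using a(1) b(1) by (auto simp: ab dest!: arg_cong[where f = length])
      ultimately show ?thesis
        by (simp add: ab)
    qed
    then show "\<forall>a\<in>?I. \<forall>b\<in>?I. a \<noteq> b \<longrightarrow> ?B a \<inter> ?B b = {}"
      by blast
  qed (simp_all add: fin)
  also have "\<dots> = (\<Sum>(i, p, q)\<in>?I. letter (Fs s i (take p us) (take q vs)) *
      cup_words (s + i) (k - i) (drop p us) (drop q vs))"
  proof (intro sum.cong refl)
    fix a :: "nat \<times> nat \<times> nat"
    obtain i p q where a: "a = (i, p, q)"
      by (cases a)
    show "sum ?w (?B a) = (case a of (i, p, q) \<Rightarrow>
        letter (Fs s i (take p us) (take q vs)) * cup_words (s + i) (k - i) (drop p us) (drop q vs))"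
    proof (cases "p = 0 \<and> q = 0")
      case False
      let ?C = "cup_cuts (k - i) (drop p us) (drop q vs)"
      have "?B a = (#) (i, take p us, take q vs) ` ?C"
        unfolding a prod.case if_not_P[OF False] ..
      then have "sum ?w (?B a) = (\<Sum>L\<in>?C. ?w ((i, take p us, take q vs) # L))"
        by (simp only:) (simp add: sum.reindex)
      also have "\<dots> = (\<Sum>L\<in>?C. letter (Fs s i (take p us) (take q vs)) * word (cup_letters F (s + i) L))"
        by (intro sum.cong refl) (simp only: cup_letters.simps word_Cons[of _ "cup_letters _ _ _"] Fs_def)
      finally show ?thesis
        by (simp add: a cup_words_def sum_distrib_left)
    qed (simp add: a)
  qed
  also have "\<dots> = (\<Sum>i\<le>k. cut_sum2 (\<lambda>x y x' y'.
      letter (Fs s i x y) * cup_words (s + i) (k - i) x' y') us vs)"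
    by (simp add: cut_sum2_def cut_sum_def sum.cartesian_product)
  finally show ?thesis .
qed

text \<open>Two empty first blocks contribute nothing, since the operations vanish on them. Hence an
  equation for shorter pairs of words may be applied to the second factor of each summand of the
  recursion.\<close>

lemma cup_summand_cong:
  assumes "x @ x' = us" "y @ y' = vs"
    and "length x' + length y' < length us + length vs \<Longrightarrow> t = t'"
  shows "letter (Fs s i x y) * t = letter (Fs s i x y) * t'"
proof (cases "x = [] \<and> y = []")
  case False
  then have "length x + length y > 0"
    by simp
  then show ?thesis
    using assms(1,2) by (subst assms(3)) auto
qed simp

lemma cup_words_Suc: "cup_words (Suc s) k us vs = cup_words s k vs us"
proof (induction "length us + length vs" arbitrary: s k us vs rule: less_induct)
  case less
  have "cut_sum2 (\<lambda>x y x' y'. letter (Fs (Suc s) i x y) * cup_words (Suc s + i) (k - i) x' y') us vs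
      = cut_sum2 (\<lambda>x y x' y'. letter (Fs s i y x) * cup_words (s + i) (k - i) y' x') us vs" for i
    unfolding Fs_Suc
  proof (rule cut_sum2_cong)
    fix x y x' y'
    assume "x @ x' = us" "y @ y' = vs"
    then show "letter (Fs s i y x) * cup_words (Suc s + i) (k - i) x' y' =
        letter (Fs s i y x) * cup_words (s + i) (k - i) y' x'"
      using less[of x' y'] by (intro cup_summand_cong[of y y' vs x x' us]) auto
  qed
  then have "cut_sum2 (\<lambda>x y x' y'. letter (Fs (Suc s) i x y) * cup_words (Suc s + i) (k - i) x' y') us vs
      = cut_sum2 (\<lambda>x y x' y'. letter (Fs s i x y) * cup_words (s + i) (k - i) x' y') vs us" for i
    by (subst (2) cut_sum2_flip)
  then show ?case
    by (subst (1 2) cup_words_rec) (simp add: cup_unit_def conj_commute)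
qed

lemma cup_words_funpow: "cup_words s k us vs = (if even s then cup_words 0 k us vs else cup_words 0 k vs us)"
  by (induction s arbitrary: us vs) (simp_all add: cup_words_Suc)

text \<open>In the recursion the marked letter lies either in the first block, where the operation is linear
in it, or in the remaining word, where the induction hypothesis applies.\<close>

lemma cup_words_multilinear_left: "z2_multilinear (\<lambda>us. cup_words s k us vs)"
proof (rule z2_multilinearI)
  fix us x y ws
  show "cup_words s k (us @ (x + y) # ws) vs =
      cup_words s k (us @ x # ws) vs + cup_words s k (us @ y # ws) vs"
  proof (induction "length us + length ws + length vs" arbitrary: s k us ws vs rule: less_induct)
    case less
    have "letter (Fs s i u v) * cup_words (s + i) (k - i) (u' @ (x + y) # ws) v' =
        letter (Fs s i u v) * cup_words (s + i) (k - i) (u' @ x # ws) v' +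
        letter (Fs s i u v) * cup_words (s + i) (k - i) (u' @ y # ws) v'"
      if "u @ u' = us" "v @ v' = vs" for i u v u' v'
      unfolding distrib_left[symmetric] using that
      by (intro cup_summand_cong[OF that] less) auto
    then have 1: "cut_sum2 (\<lambda>u v u' v'.
          letter (Fs s i u v) * cup_words (s + i) (k - i) (u' @ (x + y) # ws) v') us vs =
        cut_sum2 (\<lambda>u v u' v'. letter (Fs s i u v) * cup_words (s + i) (k - i) (u' @ x # ws) v') us vs +
        cut_sum2 (\<lambda>u v u' v'. letter (Fs s i u v) * cup_words (s + i) (k - i) (u' @ y # ws) v') us vs"
      for i
      unfolding cut_sum2_add[symmetric] by (intro cut_sum2_cong)
    show ?case
      using 1 unfolding cup_words_rec[of s k "_ @ _"]
      by (simp add: cup_unit_def cut_sum2_def cut_sum_marked z2_multilinearD[OF Fs_multilinear_left]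
        letter_add distrib_right cut_sum_add sum.distrib ac_simps)
  qed
qed

lemma cup_words_multilinear_right: "z2_multilinear (cup_words s k us)"
  using cup_words_multilinear_left[of "Suc s" k us] by (simp add: cup_words_Suc)

definition cup :: "nat \<Rightarrow> ('v tensors, 'v tensors) tensor \<Rightarrow> 'v tensors" where
  "cup k = tensor_lift (\<lambda>x y. word_lift (\<lambda>us. word_lift (cup_words 0 k us) y) x)"

lemma cup_linear: "z2_linear (cup k)"
  and cup_word: "cup k (word us \<otimes> word vs) = cup_words 0 k us vs"
proof -
  note b = word_lift_bilinear[OF cup_words_multilinear_left cup_words_multilinear_right]
  show "z2_linear (cup k)" "cup k (word us \<otimes> word vs) = cup_words 0 k us vs"
    by (simp_all add: cup_def tensor_lift[OF b(1)] b(2))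
qed

lemma cup_swap_word:
  "cup k ((tensor_swap ^^ s) (word us \<otimes> word vs)) = cup_words s k us vs"
  by (simp add: tensor_swap_funpow_pure cup_word cup_words_funpow[of s])

lemma cup_bilinear: "z2_bilinear (\<lambda>x y. cup k (x \<otimes> y))"
  by (intro z2_bilinearI) (simp_all add: pure_tensor_add z2_linearD[OF cup_linear])

lemma cup_words_Nil: "cup_words s k [] [] = (if k = 0 then 1 else 0)"
  by (subst cup_words_rec) (simp add: cup_unit_def cut_sum2_def)

end


section \<open>Compatibility with the coproduct and the differential\<close>

lemma cut_sum2_unit:
  "cut_sum2 (\<lambda>x y x' y'. if x = [] \<and> y = [] then f x' y' else 0) us vs = f us (vs :: 'b list)"
  for us :: "'a list"
proof -
  have "cut_sum (\<lambda>y y'. if x = [] \<and> y = [] then f x' y' else 0) vs = (if x = [] then f x' vs else 0)"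
    for x x' :: "'a list"
    by (cases "x = []") (simp_all add: cut_sum_counit_left)
  then show ?thesis
    by (simp add: cut_sum2_def cut_sum_counit_left)
qed

lemma sum_triangle:
  "(\<Sum>i\<le>n. \<Sum>j\<le>n - i. g i j) = (\<Sum>k\<le>n. \<Sum>i\<le>k. g i (k - i))"
  for g :: "nat \<Rightarrow> nat \<Rightarrow> 'b::comm_monoid_add"
proof -
  have "(\<Sum>i\<le>n. \<Sum>j\<le>n - i. g i j) = (\<Sum>(i, j)\<in>{(i, j). i + j \<le> n}. g i j)"
    unfolding sum.Sigma[OF finite_atMost ballI[OF finite_atMost]]
    by (rule sum.cong) auto
  then show ?thesis
    by (simp add: sum.triangle_reindex_eq)
qed

lemma bar_sum_cut_sum2:
  "bar_sum d mul (\<lambda>u. cut_sum2 f u vs) us =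
   cut_sum2 (\<lambda>x y x' y'.
     bar_sum d mul (\<lambda>x. f x y x' y') x + bar_sum d mul (\<lambda>x'. f x y x' y') x') us vs"
  unfolding cut_sum2_def bar_sum_cut_sum bar_sum_cut_sum_swap cut_sum_add ..

lemma tensor_comult_linear: "z2_linear (tensor_comult bar_comult)"
  unfolding tensor_comult_def comp_def
  by (intro z2_linear_comp[OF tensor_mid_swap_linear] tensor_map_linear bar_comult_linear)

lemma tensor_comult_word:
  "tensor_comult bar_comult (word us \<otimes> word vs) =
   cut_sum2 (\<lambda>x y x' y'. (word x \<otimes> word y) \<otimes> (word x' \<otimes> word y')) us vs"
  by (simp add: tensor_comult_def tensor_map_pure bar_comult_linear bar_comult_word cut_sum2_def
    cut_sum_linear[OF pure_tensor_linear(1)] cut_sum_linear[OF pure_tensor_linear(2)]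
    cut_sum_linear[OF tensor_mid_swap_linear] tensor_mid_swap_pure) (rule cut_sum_swap)

lemma bar_comult_one: "bar_comult 1 = 1 \<otimes> 1"
  using bar_comult_word[of "[]"] by (simp add: word_Nil)

text \<open>The cut in front of the first letter, and the cuts behind it.\<close>

lemma bar_comult_letter_times:
  "bar_comult (letter a * t) = 1 \<otimes> (letter a * t) + tensor_map (\<lambda>t. letter a * t) id (bar_comult t)"
proof (rule tensors_linear_eqI[where t = t])
  note l = tensor_map_linear[OF mult_linear(2) z2_linear_id(2), of "letter a"]
  show "z2_linear (\<lambda>t. bar_comult (letter a * t))"
    by (rule z2_linear_comp[OF bar_comult_linear mult_linear(2)])
  show "z2_linear (\<lambda>t. 1 \<otimes> (letter a * t) + tensor_map (\<lambda>t. letter a * t) id (bar_comult t))"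
    by (rule z2_linear_plus[OF z2_linear_comp[OF pure_tensor_linear(2) mult_linear(2)]
      z2_linear_comp[OF l bar_comult_linear]])
  fix ws
  show "bar_comult (letter a * word ws) =
      1 \<otimes> (letter a * word ws) + tensor_map (\<lambda>t. letter a * t) id (bar_comult (word ws))"
    by (simp only: bar_comult_word cut_sum_Cons word_Nil cut_sum_linear[OF l]
      tensor_map_pure[OF mult_linear(2) z2_linear_id(2)] id_apply flip: word_Cons[of a])
qed

context word_operations
begin

text \<open>The principle of \<open>cup_summand_cong\<close> for an arbitrary dependence on the first letter.\<close>

lemma cup_summand_cong2:
  assumes "\<And>t. h 0 t = 0" "x @ x' = us" "y @ y' = vs"
    and "length x' + length y' < length us + length vs \<Longrightarrow> t = t'"
  shows "h (Fs s i x y) t = h (Fs s i x y) t'"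
proof (cases "x = [] \<and> y = []")
  case False
  then have "length x + length y > 0"
    by simp
  then show ?thesis
    using assms(2,3) by (subst assms(4)) auto
qed (simp add: assms(1))

lemma cup_unit_sum:
  "(\<Sum>k\<le>n. cut_sum2 (\<lambda>x y x' y'. cup_unit k x y \<otimes> t k x' y') us vs) = 1 \<otimes> t 0 us vs"
proof -
  have "cut_sum2 (\<lambda>x y x' y'. cup_unit k x y \<otimes> t k x' y') us vs =
      (if k = 0 then 1 \<otimes> t 0 us vs else 0)" for k
    using cut_sum2_unit[of "\<lambda>x y. 1 \<otimes> t 0 x y" us vs]
    by (auto simp: cup_unit_def if_distrib[of "\<lambda>z. z \<otimes> _"] cong: if_cong)
  then show ?thesis
    by simp
qed

text \<open>A cut of a word of the product falls in front of its first letter or behind it. In the second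
case the letters in front of the cut, starting with the first one, form a word of a product of the
first pieces, and those behind it a word of a product of the second pieces; the number of
transpositions applied to the latter is the upper index of the former.\<close>

lemma bar_comult_cup_words:
  "bar_comult (cup_words s n us vs) =
   (\<Sum>k\<le>n. cut_sum2 (\<lambda>x y x' y'. cup_words s k x y \<otimes> cup_words (s + k) (n - k) x' y') us vs)"
proof (induction "length us + length vs" arbitrary: s n us vs rule: less_induct)
  case less
  let ?L = "\<lambda>a. tensor_map (\<lambda>t. letter a * t) id"
  let ?C = cup_words
  have L: "z2_linear (?L a)" for a :: 'v
    by (rule tensor_map_linear[OF mult_linear(2) z2_linear_id(2)])
  have L_pure: "?L a (t \<otimes> t') = (letter a * t) \<otimes> t'" for a :: 'v and t t' :: "'v tensors"
    by (simp add: tensor_map_pure[OF mult_linear(2) z2_linear_id(2)])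
  have L0: "?L 0 t = 0" for t :: "('v tensors, 'v tensors) tensor"
    by (rule tensor_linear_eqI[OF L z2_linear_const_zero]) (subst L_pure, simp)
  have unit: "bar_comult (cup_unit n us vs) = 1 \<otimes> cup_unit n us vs"
    by (simp add: cup_unit_def bar_comult_one z2_linear_zero[OF bar_comult_linear])
  have first: "cut_sum2 (\<lambda>x y x' y'. ?L (Fs s i x y) (bar_comult (?C (s + i) (n - i) x' y'))) us vs =
      (\<Sum>j\<le>n - i. cut_sum2 (\<lambda>x y x' y'.
        cut_sum2 (\<lambda>u v u' v'. letter (Fs s i u v) * ?C (s + i) j u' v') x y \<otimes>
          ?C (s + i + j) (n - i - j) x' y') us vs)" (is "?l = ?r") for i
  proof -
    have "?l = cut_sum2 (\<lambda>x y x' y'. ?L (Fs s i x y) (\<Sum>j\<le>n - i. cut_sum2 (\<lambda>u v u' v'.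
        ?C (s + i) j u v \<otimes> ?C (s + i + j) (n - i - j) u' v') x' y')) us vs"
    proof (rule cut_sum2_cong)
      fix x y x' y'
      assume "x @ x' = us" "y @ y' = vs"
      then show "?L (Fs s i x y) (bar_comult (?C (s + i) (n - i) x' y')) =
          ?L (Fs s i x y) (\<Sum>j\<le>n - i. cut_sum2 (\<lambda>u v u' v'.
            ?C (s + i) j u v \<otimes> ?C (s + i + j) (n - i - j) u' v') x' y')"
        using less by (intro cup_summand_cong2[where h = ?L, OF L0]) auto
    qed
    also have "\<dots> = (\<Sum>j\<le>n - i. cut_sum2 (\<lambda>x y x' y'. cut_sum2 (\<lambda>u v u' v'.
        (letter (Fs s i x y) * ?C (s + i) j u v) \<otimes> ?C (s + i + j) (n - i - j) u' v') x' y') us vs)"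
      by (simp only: z2_linear_sum[OF L] cut_sum2_linear[OF L] L_pure cut_sum2_sum)
    also have "\<dots> = ?r"
      by (simp only: cut_sum2_assoc[symmetric] cut_sum2_linear[OF pure_tensor_linear(1)])
    finally show ?thesis .
  qed
  have "bar_comult (?C s n us vs) = 1 \<otimes> ?C s n us vs +
      (\<Sum>i\<le>n. cut_sum2 (\<lambda>x y x' y'. ?L (Fs s i x y) (bar_comult (?C (s + i) (n - i) x' y'))) us vs)"
    by (subst (1 2) cup_words_rec)
      (simp only: z2_linearD[OF bar_comult_linear] z2_linear_sum[OF bar_comult_linear] unit
        cut_sum2_linear[OF bar_comult_linear] bar_comult_letter_times cut_sum2_add sum.distrib
        pure_tensor_add pure_tensor_sum cut_sum2_linear[OF pure_tensor_linear(2)] add.assoc)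
  also have "\<dots> = 1 \<otimes> ?C s n us vs + (\<Sum>k\<le>n. \<Sum>i\<le>k. cut_sum2 (\<lambda>x y x' y'.
        cut_sum2 (\<lambda>u v u' v'. letter (Fs s i u v) * ?C (s + i) (k - i) u' v') x y \<otimes>
          ?C (s + i + (k - i)) (n - i - (k - i)) x' y') us vs)"
    by (simp only: first sum_triangle)
  also have "\<dots> = 1 \<otimes> ?C s n us vs + (\<Sum>k\<le>n. cut_sum2 (\<lambda>x y x' y'.
        (\<Sum>i\<le>k. cut_sum2 (\<lambda>u v u' v'. letter (Fs s i u v) * ?C (s + i) (k - i) u' v') x y) \<otimes>
          ?C (s + k) (n - k) x' y') us vs)"
    by (simp add: pure_tensor_sum cut_sum2_sum add.assoc)
  also have "1 \<otimes> ?C s n us vs =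
      (\<Sum>k\<le>n. cut_sum2 (\<lambda>x y x' y'. cup_unit k x y \<otimes> ?C (s + k) (n - k) x' y') us vs)"
    by (simp add: cup_unit_sum)
  finally show ?case
    by (simp only: cup_words_rec[of s _ _ _] pure_tensor_add cut_sum2_add sum.distrib)
qed

lemma bar_comult_cup:
  "bar_comult (cup n t) =
   (\<Sum>k\<le>n. tensor_map (cup k) (cup (n - k) \<circ> (tensor_swap ^^ k)) (tensor_comult bar_comult t))"
proof (rule tensor_tensors_linear_eqI[where t = t])
  have l: "z2_linear (cup (n - k) \<circ> (tensor_swap ^^ k))" for k
    unfolding comp_def by (rule z2_linear_comp[OF cup_linear tensor_swap_funpow_linear])
  note lm = tensor_map_linear[OF cup_linear l]
  show "z2_linear (\<lambda>t. bar_comult (cup n t))"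
    by (rule z2_linear_comp[OF bar_comult_linear cup_linear])
  show "z2_linear (\<lambda>t. \<Sum>k\<le>n. tensor_map (cup k) (cup (n - k) \<circ> (tensor_swap ^^ k))
      (tensor_comult bar_comult t))"
    by (intro z2_linear_sum_fun z2_linear_comp[OF lm tensor_comult_linear])
  fix us vs
  show "bar_comult (cup n (word us \<otimes> word vs)) =
      (\<Sum>k\<le>n. tensor_map (cup k) (cup (n - k) \<circ> (tensor_swap ^^ k))
        (tensor_comult bar_comult (word us \<otimes> word vs)))"
    by (simp add: tensor_comult_word cut_sum2_linear[OF lm] tensor_map_pure[OF cup_linear l]
      cup_swap_word cup_word bar_comult_cup_words)
qed

lemma bar_counit_cup: "bar_counit (cup k (x \<otimes> y)) = (if k = 0 then bar_counit x * bar_counit y else 0)"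
proof -
  have letter: "bar_counit (letter a * t) = 0" for a and t :: "'v tensors"
    by (rule tensors_linear_eqI[where t = t, OF z2_linear_comp[OF bar_counit_linear mult_linear(2)]
        z2_linear_const_zero])
      (simp only: bar_counit_word flip: word_Cons[of a], simp)
  have "bar_counit (cup_words s k us vs) = bar_counit (cup_unit k us vs)" for s us vs
    by (subst cup_words_rec) (simp add: z2_linearD[OF bar_counit_linear] letter
      z2_linear_sum[OF bar_counit_linear] cut_sum2_linear[OF bar_counit_linear])
  then have *: "bar_counit (cup k (word us \<otimes> word vs)) =
      (if k = 0 then bar_counit (word us) * bar_counit (word vs) else 0)" for us vs
    using bar_counit_word[of "[] :: 'v list"]
    by (simp add: cup_word cup_unit_def z2_linear_zero[OF bar_counit_linear] word_Nil bar_counit_word)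
  show ?thesis
  proof (rule z2_bilinear_tensors_eqI[where x = x and y = y])
    show "z2_bilinear (\<lambda>x y. bar_counit (cup k (x \<otimes> y)))"
      by (rule z2_bilinearI)
        (simp_all only: pure_tensor_add z2_linearD[OF cup_linear] z2_linearD[OF bar_counit_linear])
    show "z2_bilinear (\<lambda>x y :: 'v tensors. if k = 0 then bar_counit x * bar_counit y else 0)"
    proof (cases "k = 0")
      case True
      then show ?thesis
        by (simp only: if_True refl)
          (rule z2_bilinearI; simp only: z2_linearD[OF bar_counit_linear] distrib_left distrib_right)
    next
      case False
      then show ?thesis
        by (simp add: z2_bilinear_def z2_linear_const_zero)
    qed
  qed (rule *)
qed

end

text \<open>The assumption \<open>F_differential\<close> is the structure equation, in a form that also covers
empty arguments. The sum over cuts includes the two extreme ones, where one of the factors has only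
empty arguments and vanishes.\<close>

locale bar_operations = nonunital_dg_algebra gr d mul + word_operations F
  for gr :: "int \<Rightarrow> 'v::z2_vector set" and d mul and F :: "nat \<Rightarrow> 'v list \<Rightarrow> 'v list \<Rightarrow> 'v" +
  assumes F_degree: "homogeneous_word gr xs m \<Longrightarrow> homogeneous_word gr ys n \<Longrightarrow>
      F k xs ys \<in> gr (m + n + 1 - int k)"
    and F_differential: "d (F k us vs) + bar_sum d mul (\<lambda>x. F k x vs) us + bar_sum d mul (F k us) vs
      + (\<Sum>i\<le>k. cut_sum2 (\<lambda>x y x' y'. mul (F i x y) (Fs i (k - i) x' y')) us vs)
      = (if k = 0 then 0 else F (k - 1) us vs + F (k - 1) vs us)"
begin

lemma cup_words_degree:
  assumes "homogeneous_word gr us m" "homogeneous_word gr vs n"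
  shows "cup_words s k us vs \<in> bar_grading gr (m + n - int k)"
  using assms
proof (induction "length us + length vs" arbitrary: s k us vs m n rule: less_induct)
  case less
  let ?S = "bar_grading gr (m + n - int k)"
  have Fs_degree: "Fs s i xs ys \<in> gr (a + b + 1 - int i)"
    if "homogeneous_word gr xs a" "homogeneous_word gr ys b" for i xs ys a b
    using F_degree[OF that, of i] F_degree[OF that(2,1), of i] by (simp add: Fs_apply add.commute)
  have "letter (Fs s i x y) * cup_words (s + i) (k - i) x' y' \<in> ?S"
    if ik: "i \<le> k" and split: "x @ x' = us" "y @ y' = vs" for i x x' y y'
  proof (cases "x = [] \<and> y = []")
    case True
    then show ?thesis
      by (simp add: z2.subspace_0[OF bar_grading_subspace])
  next
    case False
    obtain a b where a: "homogeneous_word gr x a" "homogeneous_word gr x' (m - a)"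
      and b: "homogeneous_word gr y b" "homogeneous_word gr y' (n - b)"
      using less.prems split by (metis homogeneous_word_append)
    have "length x' + length y' < length us + length vs"
      using False split by auto
    from less.hyps[OF this a(2) b(2), of "s + i" "k - i"]
    have "letter (Fs s i x y) * cup_words (s + i) (k - i) x' y' \<in>
        bar_grading gr (a + b + 1 - int i - 1 + (m - a + (n - b) - int (k - i)))"
      by (intro bar_grading_times bar_grading_letter Fs_degree a b)
    also have "a + b + 1 - int i - 1 + (m - a + (n - b) - int (k - i)) = m + n - int k"
      using ik by simp
    finally show ?thesis .
  qed
  then have "(\<Sum>i\<le>k. cut_sum2 (\<lambda>x y x' y'.
      letter (Fs s i x y) * cup_words (s + i) (k - i) x' y') us vs) \<in> ?S"
    unfolding cut_sum2_def cut_sum_def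
    by (intro z2.subspace_sum[OF bar_grading_subspace]) simp
  moreover have "cup_unit k us vs \<in> ?S"
    using less.prems bar_grading_one by (auto simp: cup_unit_def z2.subspace_0[OF bar_grading_subspace])
  ultimately show ?case
    by (subst cup_words_rec) (rule z2.subspace_add[OF bar_grading_subspace])
qed

lemma cup_degree: "cup k (x \<otimes> y) \<in> bar_grading gr (m + n - int k)"
  if "x \<in> bar_grading gr m" "y \<in> bar_grading gr n"
proof (rule bar_grading_induct[OF that(1) z2_linear_comp[OF cup_linear pure_tensor_linear(1)]
    bar_grading_subspace])
  fix us
  assume "homogeneous_word gr us m"
  then show "cup k (word us \<otimes> y) \<in> bar_grading gr (m + n - int k)"
    by (intro bar_grading_induct[OF that(2) z2_linear_comp[OF cup_linear pure_tensor_linear(2)]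
      bar_grading_subspace]) (simp add: cup_word cup_words_degree)
qed

text \<open>The part of the bar differential of \<open>letter a * t\<close> that multiplies \<open>a\<close> into \<open>t\<close>; the other parts
are the derivation terms in \<open>bar_d_letter_times\<close>.\<close>

definition merge :: "'v \<Rightarrow> 'v tensors \<Rightarrow> 'v tensors" where
  "merge a = word_lift (merge_hd mul word a)"

lemma merge_linear: "z2_linear (merge a)"
  and merge_word: "merge a (word ws) = merge_hd mul word a ws"
  unfolding merge_def by (rule word_lift[OF merge_hd_multilinear[OF mul_bilinear word_multilinear]])+

lemma merge_one: "merge a 1 = 0"
  using merge_word[of a "[]"] by (simp add: word_Nil)

lemma merge_letter_times: "merge a (letter b * t) = letter (mul a b) * t"
  by (rule tensors_linear_eqI[where t = t, OF z2_linear_comp[OF merge_linear mult_linear(2)]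
      mult_linear(2)])
    (simp only: merge_word merge_hd_simps flip: word_Cons[of b] word_Cons[of "mul a b"])

lemma bar_d_one: "bd 1 = 0"
  using bar_d_word[of "[]"] by (simp add: word_Nil)

lemma bar_d_letter_times: "bd (letter a * t) = letter (d a) * t + letter a * bd t + merge a t"
proof (rule tensors_linear_eqI[where t = t])
  show "z2_linear (\<lambda>t. bd (letter a * t))"
    "z2_linear (\<lambda>t. letter (d a) * t + letter a * bd t + merge a t)"
    by (rule z2_linear_comp[OF bar_d_linear mult_linear(2)])
      (intro z2_linear_plus mult_linear merge_linear z2_linear_comp[OF mult_linear(2) bar_d_linear])
  fix ws
  have "bd (word (a # ws)) = bar_sum d mul word (a # ws)"
    by (rule bar_d_word)
  also have "\<dots> = letter (d a) * word ws + letter a * bd (word ws) + merge a (word ws)"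
    by (simp only: bar_sum_Cons bar_d_word merge_word bar_sum_linear[OF mult_linear(2)]
      flip: word_Cons[of a] word_Cons[of "d a"])
  finally show "bd (letter a * word ws) =
      letter (d a) * word ws + letter a * bd (word ws) + merge a (word ws)"
    by (simp only: word_Cons[of a ws])
qed

text \<open>Interchanging the roles of the two words turns the equation for \<open>F\<close> into the one for the
transposed operations.\<close>

lemma Fs_differential:
  "d (Fs s k us vs) + bar_sum d mul (\<lambda>x. Fs s k x vs) us + bar_sum d mul (Fs s k us) vs
   + (\<Sum>i\<le>k. cut_sum2 (\<lambda>x y x' y'. mul (Fs s i x y) (Fs (s + i) (k - i) x' y')) us vs)
   = (if k = 0 then 0 else Fs s (k - 1) us vs + Fs (Suc s) (k - 1) us vs)"
proof (cases "even s")
  case True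
  then show ?thesis
    using F_differential[of k us vs] by (simp add: Fs_apply[abs_def])
next
  case False
  have "cut_sum2 (\<lambda>x y x' y'. mul (Fs s i x y) (Fs (s + i) (k - i) x' y')) us vs =
      cut_sum2 (\<lambda>x y x' y'. mul (F i x y) (Fs i (k - i) x' y')) vs us" for i
    using False by (subst cut_sum2_flip, cases "even i") (simp_all add: Fs_apply)
  then show ?thesis
    using False F_differential[of k vs us] by (simp add: Fs_apply[abs_def] ac_simps)
qed

lemma bar_sum_cup_words:
  "bar_sum d mul (\<lambda>u. cup_words s k u vs) us =
   (\<Sum>i\<le>k. cut_sum2 (\<lambda>x y x' y'.
      letter (bar_sum d mul (\<lambda>x. Fs s i x y) x) * cup_words (s + i) (k - i) x' y' +
      letter (Fs s i x y) * bar_sum d mul (\<lambda>x'. cup_words (s + i) (k - i) x' y') x') us vs)"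
proof -
  have "bar_sum d mul (\<lambda>u. cup_unit k u vs) us = bar_sum d mul (\<lambda>u. 0) us"
    by (rule bar_sum_cong) (simp add: cup_unit_def)
  then show ?thesis
    by (subst cup_words_rec)
      (simp add: bar_sum_add bar_sum_sum bar_sum_cut_sum2 bar_sum_linear[OF mult_linear(1)]
        bar_sum_linear[OF mult_linear(2)] bar_sum_linear[OF letter_linear])
qed

lemma bar_sum_cup_words_right:
  "bar_sum d mul (cup_words s k us) vs =
   (\<Sum>i\<le>k. cut_sum2 (\<lambda>x y x' y'.
      letter (bar_sum d mul (Fs s i x) y) * cup_words (s + i) (k - i) x' y' +
      letter (Fs s i x y) * bar_sum d mul (cup_words (s + i) (k - i) x') y') us vs)"
  using bar_sum_cup_words[of "Suc s" k us vs]
  by (subst cut_sum2_flip) (simp add: cup_words_Suc Fs_Suc)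

lemma merge_cup_words:
  "merge a (cup_words s k us vs) =
   (\<Sum>i\<le>k. cut_sum2 (\<lambda>x y x' y'.
      letter (mul a (Fs s i x y)) * cup_words (s + i) (k - i) x' y') us vs)"
  by (subst cup_words_rec)
    (simp add: z2_linearD[OF merge_linear] z2_linear_sum[OF merge_linear] z2_linear_zero[OF merge_linear]
      cut_sum2_linear[OF merge_linear] merge_letter_times cup_unit_def merge_one)

text \<open>In the proof, \<open>N\<close> and \<open>NC\<close> abbreviate the contributions of upper index one lower, for the operations
and for the products, and \<open>M\<close> is the quadratic part of the structure equation.\<close>

lemma bar_d_cup_words:
  "bd (cup_words s k us vs) =
   bar_sum d mul (\<lambda>u. cup_words s k u vs) us + bar_sum d mul (cup_words s k us) vs
   + (if k = 0 then 0 else cup_words s (k - 1) us vs + cup_words (Suc s) (k - 1) us vs)"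
proof (induction "length us + length vs" arbitrary: s k us vs rule: less_induct)
  case less
  let ?C = cup_words
  define N where "N s k x y = (if k = 0 then 0 else Fs s (k - 1) x y + Fs (Suc s) (k - 1) x y)" for s k x y
  define NC where "NC s k x y = (if k = 0 then 0 else ?C s (k - 1) x y + ?C (Suc s) (k - 1) x y)" for s k x y
  define M where "M l x y = (\<Sum>i\<le>l. cut_sum2 (\<lambda>u v u' v'. mul (Fs s i u v) (Fs (s + i) (l - i) u' v')) x y)"
    for l x y
  have IH: "letter (Fs s i x y) * bd (?C (s + i) (k - i) x' y') = letter (Fs s i x y) *
      (bar_sum d mul (\<lambda>x'. ?C (s + i) (k - i) x' y') x' + bar_sum d mul (?C (s + i) (k - i) x') y'
        + NC (s + i) (k - i) x' y')"
    if "x @ x' = us" "y @ y' = vs" for i x y x' y'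
    using less unfolding NC_def by (intro cup_summand_cong[OF that]) simp
  \<comment> \<open>The product of the first two letters only depends on the union of the first two pairs of blocks and on the sum of their indices: regrouping by these collects the quadratic part.\<close>
  have merge: "(\<Sum>i\<le>k. cut_sum2 (\<lambda>x y x' y'. merge (Fs s i x y) (?C (s + i) (k - i) x' y')) us vs)
      = (\<Sum>l\<le>k. cut_sum2 (\<lambda>x y x' y'. letter (M l x y) * ?C (s + l) (k - l) x' y') us vs)"
    (is "?l = ?r")
  proof -
    have "?l = (\<Sum>i\<le>k. \<Sum>j\<le>k - i. cut_sum2 (\<lambda>x y x' y'. cut_sum2 (\<lambda>u v u' v'.
        letter (mul (Fs s i u v) (Fs (s + i) j u' v'))) x y * ?C (s + i + j) (k - i - j) x' y') us vs)"
      by (simp only: merge_cup_words cut_sum2_sum cut_sum2_linear[OF mult_linear(1)] cut_sum2_assoc)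
    also have "\<dots> = (\<Sum>l\<le>k. \<Sum>i\<le>l. cut_sum2 (\<lambda>x y x' y'. cut_sum2 (\<lambda>u v u' v'.
        letter (mul (Fs s i u v) (Fs (s + i) (l - i) u' v'))) x y *
          ?C (s + i + (l - i)) (k - i - (l - i)) x' y') us vs)"
      by (rule sum_triangle)
    also have "\<dots> = ?r"
      by (simp add: M_def letter_sum sum_distrib_right cut_sum2_sum cut_sum2_linear[OF letter_linear])
    finally show ?thesis .
  qed
  have diff: "letter (d (Fs s i x y)) * t + letter (M i x y) * t =
      letter (bar_sum d mul (\<lambda>x. Fs s i x y) x) * t + letter (bar_sum d mul (Fs s i x) y) * t
      + letter (N s i x y) * t" for i x y t
  proof -
    have "d (Fs s i x y) + M i x y = bar_sum d mul (\<lambda>x. Fs s i x y) x + bar_sum d mul (Fs s i x) y + N s i x y"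
      using Fs_differential[of s i x y] unfolding M_def N_def
      by (simp add: z2_eq_iff_add[of "_ + _ :: 'v" "_ + _ :: 'v"] z2_eq_iff_add[of "_ + _ :: 'v" "if _ then _ else _"] ac_simps del: add_left_cancel)
    then show ?thesis
      by (simp flip: distrib_right letter_add)
  qed
  \<comment> \<open>The summands with \<open>letter (Fs s i x y)\<close> and \<open>?C (Suc s + i)\<close> come up once in each sum and cancel.\<close>
  have rest: "(\<Sum>i\<le>k. cut_sum2 (\<lambda>x y x' y'. letter (N s i x y) * ?C (s + i) (k - i) x' y') us vs)
      + (\<Sum>i\<le>k. cut_sum2 (\<lambda>x y x' y'. letter (Fs s i x y) * NC (s + i) (k - i) x' y') us vs)
      = NC s k us vs"
  proof (cases k)
    case 0
    then show ?thesis
      by (simp add: N_def NC_def)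
  next
    case (Suc k')
    have "(\<Sum>i\<le>k. cut_sum2 (\<lambda>x y x' y'. letter (N s i x y) * ?C (s + i) (k - i) x' y') us vs)
        = (\<Sum>i\<le>k'. cut_sum2 (\<lambda>x y x' y'. letter (Fs s i x y) * ?C (Suc s + i) (k' - i) x' y') us vs)
        + (\<Sum>i\<le>k'. cut_sum2 (\<lambda>x y x' y'. letter (Fs (Suc s) i x y) * ?C (Suc s + i) (k' - i) x' y') us vs)"
      by (simp add: Suc sum.atMost_Suc_shift N_def letter_add distrib_right cut_sum2_add sum.distrib
        del: sum.atMost_Suc)
    moreover have "(\<Sum>i\<le>k. cut_sum2 (\<lambda>x y x' y'. letter (Fs s i x y) * NC (s + i) (k - i) x' y') us vs)
        = (\<Sum>i\<le>k'. cut_sum2 (\<lambda>x y x' y'. letter (Fs s i x y) * ?C (s + i) (k' - i) x' y') us vs)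
        + (\<Sum>i\<le>k'. cut_sum2 (\<lambda>x y x' y'. letter (Fs s i x y) * ?C (Suc s + i) (k' - i) x' y') us vs)"
    proof -
      have "NC (s + i) (k - i) x' y' = ?C (s + i) (k' - i) x' y' + ?C (Suc s + i) (k' - i) x' y'"
        if "i \<le> k'" for i x' y'
        using that by (simp add: NC_def Suc Suc_diff_le)
      moreover have "NC (s + k) (k - k) x' y' = 0" for x' y'
        by (simp add: NC_def)
      ultimately show ?thesis
        by (simp add: Suc distrib_left cut_sum2_add sum.distrib)
    qed
    ultimately show ?thesis
      using cup_words_rec[of s k' us vs] cup_words_rec[of "Suc s" k' us vs]
      by (simp add: NC_def Suc ac_simps z2_cancel)
  qed
  have "bd (?C s k us vs) = (\<Sum>i\<le>k. cut_sum2 (\<lambda>x y x' y'.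
      letter (d (Fs s i x y)) * ?C (s + i) (k - i) x' y'
      + letter (Fs s i x y) * bd (?C (s + i) (k - i) x' y')
      + merge (Fs s i x y) (?C (s + i) (k - i) x' y')) us vs)"
    by (subst cup_words_rec)
      (simp add: z2_linearD[OF bar_d_linear] z2_linear_sum[OF bar_d_linear] z2_linear_zero[OF bar_d_linear]
        cut_sum2_linear[OF bar_d_linear] bar_d_letter_times cup_unit_def bar_d_one)
  also have "\<dots> = (\<Sum>i\<le>k. cut_sum2 (\<lambda>x y x' y'. letter (d (Fs s i x y)) * ?C (s + i) (k - i) x' y'
        + letter (M i x y) * ?C (s + i) (k - i) x' y') us vs)
      + (\<Sum>i\<le>k. cut_sum2 (\<lambda>x y x' y'. letter (Fs s i x y) * bd (?C (s + i) (k - i) x' y')) us vs)"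
    by (simp only: cut_sum2_add sum.distrib merge) (simp only: ac_simps)
  also have "\<dots> = (\<Sum>i\<le>k. cut_sum2 (\<lambda>x y x' y'.
        letter (bar_sum d mul (\<lambda>x. Fs s i x y) x) * ?C (s + i) (k - i) x' y'
        + letter (bar_sum d mul (Fs s i x) y) * ?C (s + i) (k - i) x' y'
        + letter (N s i x y) * ?C (s + i) (k - i) x' y') us vs)
      + (\<Sum>i\<le>k. cut_sum2 (\<lambda>x y x' y'. letter (Fs s i x y) *
        (bar_sum d mul (\<lambda>x'. ?C (s + i) (k - i) x' y') x' + bar_sum d mul (?C (s + i) (k - i) x') y'
          + NC (s + i) (k - i) x' y')) us vs)"
    by (simp only: diff IH cong: cut_sum2_cong)
  also have "\<dots> = bar_sum d mul (\<lambda>u. ?C s k u vs) us + bar_sum d mul (?C s k us) vs + NC s k us vs"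
    unfolding rest[symmetric] bar_sum_cup_words[where s = s and k = k and us = us and vs = vs]
      bar_sum_cup_words_right[where s = s and k = k and us = us and vs = vs]
    by (simp only: distrib_left cut_sum2_add sum.distrib) (simp only: ac_simps)
  finally show ?case
    by (simp add: NC_def)
qed

lemma bar_d_cup:
  "bd (cup k (x \<otimes> y)) = cup k (bd x \<otimes> y) + cup k (x \<otimes> bd y) +
   (if k = 0 then 0 else cup (k - 1) (x \<otimes> y) + cup (k - 1) (y \<otimes> x))"
proof (rule z2_bilinear_tensors_eqI[where x = x and y = y])
  note lin = pure_tensor_add z2_linearD[OF cup_linear] z2_linearD[OF bar_d_linear]
  show "z2_bilinear (\<lambda>x y. bd (cup k (x \<otimes> y)))"
    by (rule z2_bilinearI) (simp_all add: lin)
  show "z2_bilinear (\<lambda>x y. cup k (bd x \<otimes> y) + cup k (x \<otimes> bd y) +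
      (if k = 0 then 0 else cup (k - 1) (x \<otimes> y) + cup (k - 1) (y \<otimes> x)))"
    by (rule z2_bilinearI) (simp_all add: lin ac_simps)
  fix us vs
  show "bd (cup k (word us \<otimes> word vs)) = cup k (bd (word us) \<otimes> word vs) + cup k (word us \<otimes> bd (word vs)) +
      (if k = 0 then 0 else cup (k - 1) (word us \<otimes> word vs) + cup (k - 1) (word vs \<otimes> word us))"
    by (simp add: linear_bar_d_word[OF z2_linear_comp[OF cup_linear pure_tensor_linear(1)]]
      linear_bar_d_word[OF z2_linear_comp[OF cup_linear pure_tensor_linear(2)]]
      cup_word bar_d_cup_words cup_words_Suc)
qed

end


section \<open>Associativity\<close>

text \<open>The inequalities between the entries of an insertion, as a condition on the lists that can be
peeled off from the front; \<open>e\<close> is the end of the preceding segment.\<close>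

fun insertion_chain :: "nat \<Rightarrow> nat \<Rightarrow> nat list \<Rightarrow> nat list \<Rightarrow> bool" where
  "insertion_chain e n (k # ks) (l # ls) \<longleftrightarrow> e \<le> k \<and> insertion_chain (k + l) n ks ls"
| "insertion_chain e n _ _ \<longleftrightarrow> e \<le> n"

lemma insertion_chain_iff:
  assumes "length ks = length ls"
  shows "insertion_chain e n ks ls \<longleftrightarrow> e \<le> (if ks = [] then n else hd ks) \<and>
    (\<forall>i<length ks. ks ! i + ls ! i \<le> (if i + 1 < length ks then ks ! (i + 1) else n))"
  using assms
proof (induction ks ls arbitrary: e rule: list_induct2)
  case (Cons k ks l ls)
  show ?case
    using Cons.IH by (cases ks) (simp_all add: All_less_Suc2 conj_commute)
qed simp

lemma insertions_eq:
  "insertions m n = {(ks, ls). length ks = m \<and> length ls = m \<and> insertion_chain 0 n ks ls}"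
proof -
  have "(length ks = m \<and> length ls = m \<and>
      (\<forall>i<m. ks ! i + ls ! i \<le> (if i + 1 < m then ks ! (i + 1) else n))) \<longleftrightarrow>
      length ks = m \<and> length ls = m \<and> insertion_chain 0 n ks ls" for ks ls
    using insertion_chain_iff[of ks ls 0 n] by (cases "length ks = m \<and> length ls = m") auto
  then show ?thesis
    by (simp only: insertions_def)
qed

lemma insertion_chain_le: "e \<le> n" if "insertion_chain e n ks ls"
  using that by (induction e n ks ls rule: insertion_chain.induct) auto

lemma insertion_chain_ge: "\<forall>k\<in>set ks. e \<le> k"
  if "insertion_chain e n ks ls" "length ks = length ls"
  using that(2,1)
proof (induction ks ls arbitrary: e rule: list_induct2)
  case (Cons k ks l ls)
  then have "e \<le> k" "\<forall>x\<in>set ks. k + l \<le> x"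
    by simp_all
  then show ?case
    by force
qed simp

lemma insertion_chain_shift:
  "insertion_chain (e + c) n (map ((+) c) ks) ls \<longleftrightarrow> insertion_chain e (n - c) ks ls"
  if "c \<le> n" "length ks = length ls"
  using that(2,1)
proof (induction ks ls arbitrary: e rule: list_induct2)
  case (Cons k ks l ls)
  have eq: "c + k + l = k + l + c"
    by simp
  show ?case
    unfolding list.map insertion_chain.simps eq Cons.IH[OF Cons.prems] by simp
qed auto

lemma finite_insertions: "finite (insertions m n)"
proof (rule finite_subset)
  let ?S = "{xs. set xs \<subseteq> {..n} \<and> length xs = m}"
  show "insertions m n \<subseteq> ?S \<times> ?S"
  proof -
    have *: "set ks \<subseteq> {..n} \<and> set ls \<subseteq> {..n}" if "length ks = length ls" "insertion_chain e n ks ls"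
      for e ks ls
      using that
    proof (induction ks ls arbitrary: e rule: list_induct2)
      case (Cons k ks l ls)
      then have chain: "insertion_chain (k + l) n ks ls"
        by simp
      show ?case
        using Cons.IH[OF chain] insertion_chain_le[OF chain] by simp
    qed simp
    show ?thesis
    proof (rule subrelI)
      fix ks ls
      assume "(ks, ls) \<in> insertions m n"
      then show "(ks, ls) \<in> ?S \<times> ?S"
        using *[of ks ls 0] by (simp add: insertions_eq)
    qed
  qed
  show "finite (?S \<times> ?S)"
    by (intro finite_cartesian_product finite_lists_length_eq) simp_all
qed

text \<open>The first of the inserted operations is preceded by \<open>k\<close> arguments and takes the next \<open>l\<close>; what
  remains is an insertion into the arguments behind these, with positions shifted by \<open>k + l\<close>.\<close>

lemma sum_insertions_Suc:
  "(\<Sum>(ks, ls)\<in>insertions (Suc m) n. g ks ls) =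
   (\<Sum>k\<le>n. \<Sum>l\<le>n - k. \<Sum>(ks, ls)\<in>insertions m (n - k - l). g (k # map ((+) (k + l)) ks) (l # ls))"
  (is "_ = ?r")
proof -
  let ?S = "SIGMA k:{..n}. SIGMA l:{..n - k}. insertions m (n - k - l)"
  have "?r = (\<Sum>(k, l, ks, ls)\<in>?S. g (k # map ((+) (k + l)) ks) (l # ls))"
    by (simp add: sum.Sigma finite_insertions)
  also have "\<dots> = (\<Sum>(ks, ls)\<in>insertions (Suc m) n. g ks ls)"
  proof (rule sum.reindex_bij_witness[where
        i = "\<lambda>(ks, ls). (hd ks, hd ls, map (\<lambda>x. x - (hd ks + hd ls)) (tl ks), tl ls)" and
        j = "\<lambda>(k, l, ks, ls). (k # map ((+) (k + l)) ks, l # ls)"])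
    fix a
    assume "a \<in> ?S"
    then show "(case case a of (k, l, ks, ls) \<Rightarrow> (k # map ((+) (k + l)) ks, l # ls) of (ks, ls) \<Rightarrow>
        (hd ks, hd ls, map (\<lambda>x. x - (hd ks + hd ls)) (tl ks), tl ls)) = a"
      by (auto simp: comp_def)
    show "(case a of (k, l, ks, ls) \<Rightarrow> (k # map ((+) (k + l)) ks, l # ls)) \<in> insertions (Suc m) n"
      using \<open>a \<in> ?S\<close> insertion_chain_shift[of "fst a + fst (snd a)" n _ _ 0]
      by (auto simp: insertions_eq)
    show "(case case a of (k, l, ks, ls) \<Rightarrow> (k # map ((+) (k + l)) ks, l # ls) of (ks, ls) \<Rightarrow> g ks ls) =
        (case a of (k, l, ks, ls) \<Rightarrow> g (k # map ((+) (k + l)) ks) (l # ls))"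
      by (simp add: split_beta)
  next
    fix b
    assume "b \<in> insertions (Suc m) n"
    then obtain k ks l ls where b: "b = (k # ks, l # ls)" "length ks = m" "length ls = m"
        and chain: "insertion_chain (k + l) n ks ls"
      by (auto simp: insertions_eq length_Suc_conv)
    have ge: "\<forall>x\<in>set ks. k + l \<le> x" and le: "k + l \<le> n"
      using insertion_chain_ge[OF chain] insertion_chain_le[OF chain] b by auto
    have ks: "map ((+) (k + l)) (map (\<lambda>x. x - (k + l)) ks) = ks"
      using ge by (auto simp: comp_def intro!: map_idI)
    show "(case case b of (ks, ls) \<Rightarrow> (hd ks, hd ls, map (\<lambda>x. x - (hd ks + hd ls)) (tl ks), tl ls) of
        (k, l, ks, ls) \<Rightarrow> (k # map ((+) (k + l)) ks, l # ls)) = b"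
      using ks by (simp add: b)
    have "insertion_chain 0 (n - (k + l)) (map (\<lambda>x. x - (k + l)) ks) ls"
      using insertion_chain_shift[of "k + l" n "map (\<lambda>x. x - (k + l)) ks" ls 0] le chain b ks by simp
    then show "(case b of (ks, ls) \<Rightarrow>
        (hd ks, hd ls, map (\<lambda>x. x - (hd ks + hd ls)) (tl ks), tl ls)) \<in> ?S"
      using le by (auto simp: b insertions_eq)
  qed
  finally show ?thesis ..
qed

lemma insert_args_Cons:
  "insert_args E (b # bs) cs (k # map ((+) (k + l)) ks) (l # ls) =
   take k cs @ hga_ext E b (take l (drop k cs)) # insert_args E bs (drop (k + l) cs) ks ls"
  if "length ks = length bs" "length ls = length bs"
proof -
  define e where "e = (\<lambda>i. if i = 0 then 0 else ks ! (i - 1) + ls ! (i - 1))"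
  define e' where "e' = (\<lambda>i. if i = 0 then 0 else
    (k # map ((+) (k + l)) ks) ! (i - 1) + (l # ls) ! (i - 1))"
  have e': "e' (Suc i) = k + l + e i" if "i \<le> length bs" for i
    using that \<open>length ks = length bs\<close> by (cases i) (simp_all add: e'_def e_def)
  have seg: "segment (k + (l + i)) (k + (l + j)) cs = segment i j (drop (k + l) cs)" for i j
    by (simp add: segment_def ac_simps)
  define X where "X = concat (map (\<lambda>i. segment (e i) (ks ! i) (drop (k + l) cs) @
    [hga_ext E (bs ! i) (segment (ks ! i) (ks ! i + ls ! i) (drop (k + l) cs))]) [0..<length bs])"
  have X: "concat (map (\<lambda>i. segment (e' (Suc i)) ((k # map ((+) (k + l)) ks) ! Suc i) cs @
      [hga_ext E ((b # bs) ! Suc i) (segment ((k # map ((+) (k + l)) ks) ! Suc i)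
        ((k # map ((+) (k + l)) ks) ! Suc i + (l # ls) ! Suc i) cs)]) [0..<length bs]) = X"
    unfolding X_def using that(1) by (intro arg_cong[where f = concat] map_cong refl)
      (simp add: e' seg add.assoc)
  have "insert_args E bs (drop (k + l) cs) ks ls = X @ drop (e (length bs)) (drop (k + l) cs)"
    unfolding insert_args_def Let_def e_def X_def ..
  moreover have "insert_args E (b # bs) cs (k # map ((+) (k + l)) ks) (l # ls) =
      (segment (e' 0) k cs @ [hga_ext E b (segment k (k + l) cs)]) @ X @ drop (e' (Suc (length bs))) cs"
    unfolding X[symmetric] unfolding insert_args_def Let_def e'_def
    by (simp only: list.size One_nat_def add_Suc_right add_0_right map_upt_Suc concat.simps
      nth_Cons_0 append_assoc)
  ultimately show ?thesis
    unfolding e'[OF order_refl] by (simp add: e'_def segment_def ac_simps)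
qed

lemma insert_args_Nil: "insert_args E [] cs [] [] = cs"
  by (simp add: insert_args_def)

text \<open>The part of the structure that concerns the operations of upper index \<open>0\<close>, again extended to empty
arguments: \<open>F 0 [a]\<close> stands for \<open>E\<^sub>1\<^sub>,\<^sub>q(a; _)\<close>.\<close>

locale brace_operations = word_operations F
  for F :: "nat \<Rightarrow> 'v::z2_vector list \<Rightarrow> 'v list \<Rightarrow> 'v" +
  assumes F_0_Nil: "F 0 [] ys = (if length ys = 1 then hd ys else 0)" "F 0 [a] [] = a"
    and F_0_vanish: "length xs > 1 \<Longrightarrow> F 0 xs ys = 0"
    and F_0_composition: "bs \<noteq> [] \<Longrightarrow> cs \<noteq> [] \<Longrightarrow>
      F 0 [F 0 [a] bs] cs = (\<Sum>(ks, ls)\<in>insertions (length bs) (length cs).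
        F 0 [a] (insert_args (\<lambda>a. F 0 [a]) bs cs ks ls))"
begin

abbreviation "C \<equiv> cup_words 0 0"

lemma C_rec: "C us vs = cup_unit 0 us vs +
    cut_sum2 (\<lambda>x y x' y'. letter (F 0 x y) * C x' y') us vs"
  by (subst cup_words_rec) (simp add: Fs_apply)

text \<open>With an empty left block, the operation of index \<open>0\<close> is nonzero only on a single letter, which
it returns.\<close>

lemma cut_sum_first_letter:
  "cut_sum (\<lambda>y y'. letter (F 0 [] y) * h y') vs = (case vs of [] \<Rightarrow> 0 | c # ws \<Rightarrow> letter c * h ws)"
proof (cases vs)
  case (Cons c ws)
  have "letter (F 0 [] (c # y)) * h y' = (if y = [] then letter c * h y' else 0)" for y y'
    by (simp add: F_0_Nil)
  then show ?thesis
    by (simp add: Cons cut_sum_Cons F_Nil cut_sum_counit_left)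
qed (simp add: F_Nil)

lemma C_Nil_left: "C [] vs = word vs"
proof (induction vs)
  case (Cons c vs)
  then show ?case
    by (subst C_rec) (simp add: cup_unit_def cut_sum2_def cut_sum_first_letter word_Cons[of c vs])
qed (simp add: cup_words_Nil word_Nil)

text \<open>The words of a product whose first letter is an operation on \<open>a\<close>.\<close>

definition brace_step :: "'v \<Rightarrow> 'v list \<Rightarrow> 'v list \<Rightarrow> 'v tensors" where
  "brace_step a us vs = cut_sum (\<lambda>y y'. letter (F 0 [a] y) * C us y') vs"

text \<open>Letters of the second word are copied until the operation on \<open>a\<close> comes.\<close>

lemma C_Cons: "C (a # us) vs = cut_sum (\<lambda>p z. word p * brace_step a us z) vs"
proof (induction vs)
  case Nil
  have "C (a # us) [] = cut_sum (\<lambda>x x'. letter (F 0 (a # x) []) * C x' []) us"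
    by (subst C_rec) (simp add: cup_unit_def cut_sum2_def cut_sum_Cons F_Nil)
  also have "\<dots> = cut_sum (\<lambda>x x'. if x = [] then letter a * C x' [] else 0) us"
    by (rule cut_sum_cong) (auto simp: F_0_Nil F_0_vanish)
  finally show ?case
    by (simp add: cut_sum_counit_left brace_step_def word_Nil F_0_Nil)
next
  case (Cons c vs)
  have "C (a # us) (c # vs) = letter c * C (a # us) vs +
      cut_sum (\<lambda>x x'. cut_sum (\<lambda>y y'. letter (F 0 (a # x) y) * C x' y') (c # vs)) us"
    by (subst C_rec) (simp add: cup_unit_def cut_sum2_def cut_sum_Cons[of _ a] cut_sum_first_letter)
  also have "cut_sum (\<lambda>x x'. cut_sum (\<lambda>y y'. letter (F 0 (a # x) y) * C x' y') (c # vs)) us =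
      cut_sum (\<lambda>x x'. if x = [] then brace_step a x' (c # vs) else 0) us"
    by (rule cut_sum_cong) (auto simp: F_0_vanish brace_step_def)
  finally have "C (a # us) (c # vs) = letter c * C (a # us) vs + brace_step a us (c # vs)"
    by (simp add: cut_sum_counit_left)
  also have "letter c * C (a # us) vs = cut_sum (\<lambda>p z. word (c # p) * brace_step a us z) vs"
    by (simp only: Cons cut_sum_linear[OF mult_linear(2)] mult.assoc[symmetric] flip: word_Cons[of c])
  finally show ?case
    by (simp add: cut_sum_Cons word_Nil add.commute)
qed

lemma C_Nil_right: "C us [] = word us"
proof (induction us)
  case (Cons b us)
  then show ?case
    by (simp add: C_Cons brace_step_def F_0_Nil word_Nil word_Cons[of b us])
qed (simp add: cup_words_Nil word_Nil)

text \<open>An insertion of the \<open>bs\<close> into the \<open>cs\<close> is a choice, for each \<open>b\<close>, of the segment of \<open>cs\<close> on which its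
operation acts, the rest of \<open>cs\<close> being copied; these are the words of the product.\<close>

lemma cup_words_insertions:
  "C bs cs = (\<Sum>(ks, ls)\<in>insertions (length bs) (length cs).
     word (insert_args (\<lambda>a. F 0 [a]) bs cs ks ls))"
proof (induction bs arbitrary: cs)
  case Nil
  have "insertions 0 (length cs) = {([], [])}"
    by (auto simp: insertions_eq)
  then show ?case
    by (simp add: C_Nil_left insert_args_Nil)
next
  case (Cons b bs)
  let ?E = "\<lambda>a. F 0 [a]"
  have ext: "hga_ext ?E b y = F 0 [b] y" for y
    by (simp add: hga_ext_def F_0_Nil)
  have args: "word (insert_args ?E (b # bs) cs (k # map ((+) (k + l)) ks) (l # ls)) =
      word (take k cs) * (letter (F 0 [b] (take l (drop k cs))) *
        word (insert_args ?E bs (drop l (drop k cs)) ks ls))"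
    if "(ks, ls) \<in> insertions (length bs) n" for k l ks ls n
  proof -
    have len: "length ks = length bs" "length ls = length bs"
      using that by (auto simp: insertions_eq)
    show ?thesis
      unfolding insert_args_Cons[OF len] ext
      by (simp only: word_append word_Cons[of _ "insert_args _ _ _ _ _"] drop_drop add.commute[of l k])
  qed
  have "(\<Sum>(ks, ls)\<in>insertions (length (b # bs)) (length cs). word (insert_args ?E (b # bs) cs ks ls)) =
      (\<Sum>k\<le>length cs. \<Sum>l\<le>length cs - k. \<Sum>(ks, ls)\<in>insertions (length bs) (length cs - k - l).
        word (take k cs) * (letter (F 0 [b] (take l (drop k cs))) *
          word (insert_args ?E bs (drop l (drop k cs)) ks ls)))"
    unfolding list.size One_nat_def add_Suc_right add_0_right sum_insertions_Suc
    by (intro sum.cong refl) (simp only: split_paired_all prod.case args)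
  also have "\<dots> = (\<Sum>k\<le>length cs. \<Sum>l\<le>length cs - k. word (take k cs) *
      (letter (F 0 [b] (take l (drop k cs))) * C bs (drop l (drop k cs))))"
    by (simp add: Cons sum_distrib_left split_beta add.commute)
  also have "\<dots> = C (b # bs) cs"
    by (simp add: C_Cons brace_step_def cut_sum_def sum_distrib_left)
  finally show ?case ..
qed

definition brace :: "'v \<Rightarrow> 'v tensors \<Rightarrow> 'v" where
  "brace a = word_lift (F 0 [a])"

lemma brace_linear: "z2_linear (brace a)"
  and brace_word: "brace a (word ws) = F 0 [a] ws"
  unfolding brace_def by (rule word_lift[OF F_multilinear_right])+

text \<open>The composition equation, with the convention for empty arguments built in.\<close>

lemma brace_cup_words: "brace a (C bs cs) = F 0 [F 0 [a] bs] cs"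
proof -
  consider "bs = []" | "cs = []" "bs \<noteq> []" | "bs \<noteq> []" "cs \<noteq> []"
    by blast
  then show ?thesis
  proof cases
    case 1
    then show ?thesis
      by (simp add: C_Nil_left brace_word F_0_Nil)
  next
    case 2
    then show ?thesis
      by (simp add: C_Nil_right brace_word F_0_Nil)
  next
    case 3
    then show ?thesis
      by (simp add: F_0_composition cup_words_insertions z2_linear_sum[OF brace_linear] brace_word
        split_beta)
  qed
qed

text \<open>The letters of the second word that are used up to the operation on \<open>a\<close> are distributed over the
product with \<open>us\<close> and that operation.\<close>

lemma C_append: "C (us @ a # ws) vs = cut_sum (\<lambda>p z. C us p * brace_step a ws z) vs"
proof (induction us arbitrary: vs)
  case Nil
  show ?case
    by (simp add: C_Cons C_Nil_left)
next
  case (Cons b us)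
  have "C ((b # us) @ a # ws) vs = cut_sum (\<lambda>p z. cut_sum (\<lambda>q r. cut_sum (\<lambda>q' r'.
      word p * letter (F 0 [b] q) * C us q' * brace_step a ws r') r) z) vs"
    by (simp add: C_Cons brace_step_def[of b] Cons cut_sum_linear[OF mult_linear(2)] mult.assoc)
  also have "\<dots> = cut_sum (\<lambda>p z. C (b # us) p * brace_step a ws z) vs"
    by (simp add: C_Cons brace_step_def[of b] cut_sum_linear[OF mult_linear(2)]
      cut_sum_linear[OF mult_linear(1)] mult.assoc cut_sum_assoc)
  finally show ?case .
qed

lemma cup_append:
  "cup 0 ((word us * (letter a * t)) \<otimes> word vs) =
   cut_sum (\<lambda>p z. C us p * cut_sum (\<lambda>q r. letter (F 0 [a] q) * cup 0 (t \<otimes> word r)) z) vs"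
proof (rule tensors_linear_eqI[where t = t])
  show "z2_linear (\<lambda>t. cup 0 ((word us * (letter a * t)) \<otimes> word vs))"
    by (intro z2_linearI) (simp add: distrib_left pure_tensor_add z2_linearD[OF cup_linear])
  show "z2_linear (\<lambda>t. cut_sum (\<lambda>p z. C us p *
      cut_sum (\<lambda>q r. letter (F 0 [a] q) * cup 0 (t \<otimes> word r)) z) vs)"
    by (intro z2_linearI)
      (simp add: distrib_left pure_tensor_add z2_linearD[OF cup_linear] cut_sum_add)
  fix ws
  have "word us * (letter a * word ws) = word (us @ a # ws)"
    by (simp only: word_append word_Cons[of a ws])
  then show "cup 0 ((word us * (letter a * word ws)) \<otimes> word vs) = cut_sum (\<lambda>p z. C us p *
      cut_sum (\<lambda>q r. letter (F 0 [a] q) * cup 0 (word ws \<otimes> word r)) z) vs"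
    by (simp add: cup_word C_append brace_step_def)
qed

text \<open>Induction on the first word. On the left the rule for a product with first factor \<open>a # us\<close> is
applied twice. On the right it is applied once, as a linear map of the coproduct of the second factor
(\<open>right\<close>); that coproduct is known because \<open>\<smile>\<^sub>0\<close> is a map of coalgebras, and the operations on \<open>a\<close>
combine by \<open>brace_cup_words\<close>.\<close>

lemma cup_assoc_word:
  "cup 0 (C us vs \<otimes> word ws) = cup 0 (word us \<otimes> C vs ws)"
proof (induction us arbitrary: vs ws)
  case Nil
  have "cup 0 (word [] \<otimes> y) = y" for y
    by (rule tensors_linear_eqI[where t = y,
        OF z2_linear_comp[OF cup_linear pure_tensor_linear(2)] z2_linear_id(1)])
      (simp add: cup_word C_Nil_left)
  then show ?case
    by (simp add: C_Nil_left cup_word)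
next
  case (Cons a us)
  define g' where "g' = tensor_lift (\<lambda>x z. letter (brace a x) * cup 0 (word us \<otimes> z))"
  have b': "z2_bilinear (\<lambda>x z. letter (brace a x) * cup 0 (word us \<otimes> z))"
    by (rule z2_bilinearI) (simp_all add: z2_linearD[OF brace_linear] letter_add algebra_simps
      pure_tensor_add z2_linearD[OF cup_linear])
  note g' = tensor_lift[OF b', folded g'_def]
  define g where "g z = g' (bar_comult z)" for z
  have g: "z2_linear g"
    unfolding g_def by (rule z2_linear_comp[OF g'(1) bar_comult_linear])
  have g_word: "g (word z) = brace_step a us z" for z
    by (simp add: g_def bar_comult_word cut_sum_linear[OF g'(1)] g'(2) brace_word cup_word
      brace_step_def)
  have g_C: "g (C x y) = cut_sum2 (\<lambda>u v u' v'. letter (F 0 [F 0 [a] u] v) *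
      cup 0 (word us \<otimes> C u' v')) x y" for x y
    by (simp add: g_def bar_comult_cup_words cut_sum2_linear[OF g'(1)] g'(2) brace_cup_words)
  define h where "h = tensor_lift (\<lambda>x z. x * g z)"
  have b: "z2_bilinear (\<lambda>x z. x * g z)"
    by (rule z2_bilinearI) (simp_all add: z2_linearD[OF g] algebra_simps)
  note h = tensor_lift[OF b, folded h_def]
  have right: "cup 0 (word (a # us) \<otimes> y) = h (bar_comult y)" for y
    by (rule tensors_linear_eqI[where t = y,
        OF z2_linear_comp[OF cup_linear pure_tensor_linear(2)]
          z2_linear_comp[OF h(1) bar_comult_linear]])
      (simp add: cup_word bar_comult_word cut_sum_linear[OF h(1)] h(2) g_word C_Cons)
  have "cup 0 (word (a # us) \<otimes> C vs ws) = cut_sum2 (\<lambda>x y x' y'. C x y *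
      cut_sum2 (\<lambda>u v u' v'. letter (F 0 [F 0 [a] u] v) * cup 0 (word us \<otimes> C u' v')) x' y') vs ws"
    by (simp add: right bar_comult_cup_words cut_sum2_linear[OF h(1)] h(2) g_C)
  also have "\<dots> = cut_sum (\<lambda>x x'. cut_sum (\<lambda>u u'. cut_sum (\<lambda>y y'. C x y * cut_sum (\<lambda>v v'.
      letter (F 0 [F 0 [a] u] v) * cup 0 (word us \<otimes> C u' v')) y') ws) x') vs"
    unfolding cut_sum2_def cut_sum_linear[OF mult_linear(2)]
    by (intro cut_sum_cong cut_sum_swap)
  also have "\<dots> = cup 0 (C (a # us) vs \<otimes> word ws)"
    by (simp add: C_Cons brace_step_def cut_sum_linear[OF mult_linear(2)]
      cut_sum_linear[OF z2_linear_comp[OF cup_linear pure_tensor_linear(1)]] cup_append Cons)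
  finally show ?case ..
qed

lemma cup_assoc: "cup 0 (cup 0 (x \<otimes> y) \<otimes> z) = cup 0 (x \<otimes> cup 0 (y \<otimes> z))"
proof (rule tensors_linear_eqI[where t = z])
  note lin = pure_tensor_add z2_linearD[OF cup_linear]
  show "z2_linear (\<lambda>z. cup 0 (cup 0 (x \<otimes> y) \<otimes> z))" "z2_linear (\<lambda>z. cup 0 (x \<otimes> cup 0 (y \<otimes> z)))"
    by (rule z2_linearI; simp add: lin)+
  fix ws
  show "cup 0 (cup 0 (x \<otimes> y) \<otimes> word ws) = cup 0 (x \<otimes> cup 0 (y \<otimes> word ws))"
    by (rule z2_bilinear_tensors_eqI[where x = x and y = y])
      (auto intro!: z2_bilinearI simp: lin cup_word cup_assoc_word)
qed

lemma cup_one: "cup 0 (1 \<otimes> x) = x" "cup 0 (x \<otimes> 1) = x"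
proof -
  show "cup 0 (1 \<otimes> x) = x"
    by (rule tensors_linear_eqI[where t = x,
        OF z2_linear_comp[OF cup_linear pure_tensor_linear(2)] z2_linear_id(1)])
      (simp add: cup_word C_Nil_left flip: word_Nil)
  show "cup 0 (x \<otimes> 1) = x"
    by (rule tensors_linear_eqI[where t = x,
        OF z2_linear_comp[OF cup_linear pure_tensor_linear(1)] z2_linear_id(1)])
      (simp add: cup_word C_Nil_right flip: word_Nil)
qed

end


section \<open>The Hopf algebra determined by the operations\<close>

locale steenrod_operations = bar_operations gr d mul F + brace_operations F
  for gr :: "int \<Rightarrow> 'v::z2_vector set" and d mul and F :: "nat \<Rightarrow> 'v list \<Rightarrow> 'v list \<Rightarrow> 'v"
begin

lemma cup_0_dg_algebra: "dg_algebra (bar_grading gr) bd (\<lambda>x y. cup 0 (x \<otimes> y)) (word [])"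
proof (intro dg_algebra.intro dg_algebra_axioms.intro bar_cochain_complex cup_bilinear cup_assoc)
  show "cup 0 (x \<otimes> y) \<in> bar_grading gr (m + n)"
    if "x \<in> bar_grading gr m" "y \<in> bar_grading gr n" for x y m n
    using cup_degree[OF that, of 0] by simp
  show "bd (cup 0 (x \<otimes> y)) = cup 0 (bd x \<otimes> y) + cup 0 (x \<otimes> bd y)" for x y
    by (simp add: bar_d_cup)
qed (simp_all add: word_Nil bar_grading_one cup_one)

theorem bar_steenrod_dg_hopf_algebra:
  "steenrod_dg_hopf_algebra (bar_grading gr) bd bar_comult bar_counit cup (word [])"
proof (intro steenrod_dg_hopf_algebra.intro steenrod_dg_hopf_algebra_axioms.intro
    bar_dg_coalgebra cup_0_dg_algebra cup_linear cup_degree bar_d_cup bar_comult_cup)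
  show "bar_comult (word []) = word [] \<otimes> word []"
    by (simp add: word_Nil bar_comult_one)
  show "bar_counit (word []) = 1"
    by (simp add: bar_counit_word)
  show "bar_counit (cup 0 (x \<otimes> y)) = bar_counit x * bar_counit y" for x y
    by (simp only: bar_counit_cup if_True refl)
qed

end


section \<open>The structure equations with degenerate arguments\<close>

text \<open>The convention for the operations with an empty block on one side.\<close>

definition degenerate_op :: "nat \<Rightarrow> 'a list \<Rightarrow> 'a::zero" where
  "degenerate_op k xs = (if k = 0 \<and> length xs = 1 then hd xs else 0)"

lemma op_ext_Nil: "op_ext E k xs [] = degenerate_op k xs" "op_ext E k [] = degenerate_op k"
  by (auto simp: op_ext_def degenerate_op_def fun_eq_iff)

lemma op_swap_op_ext_Nil:
  "(op_swap ^^ i) (op_ext E k) xs [] = degenerate_op k xs"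
  "(op_swap ^^ i) (op_ext E k) [] xs = degenerate_op k xs"
  by (cases "even i"; simp add: op_swap_funpow op_ext_Nil)+

lemma degenerate_op_multilinear: "z2_multilinear (degenerate_op k :: 'a::z2_vector list \<Rightarrow> 'a)"
proof (rule z2_multilinearI)
  fix us vs and x y :: 'a
  show "degenerate_op k (us @ (x + y) # vs) = degenerate_op k (us @ x # vs) + degenerate_op k (us @ y # vs)"
    by (cases us) (simp_all add: degenerate_op_def)
qed

lemma op_ext_nonempty: "op_ext E k xs ys = E k xs ys" if "xs \<noteq> []" "ys \<noteq> []"
  using that by (simp add: op_ext_def)

context nonunital_dg_algebra
begin

lemma mul_zero: "mul 0 y = 0" "mul x 0 = 0"
  using mul_bilinear by (auto simp: z2_bilinear_def dest: z2_linear_zero)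

text \<open>Only words of length one and two matter: the differential of a letter appears twice, and so does
the product of two letters.\<close>

lemma degenerate_op_differential:
  "d (degenerate_op k ws) + bar_sum d mul (degenerate_op k) ws +
   (\<Sum>i\<le>k. cut_sum (\<lambda>x x'. mul (degenerate_op i x) (degenerate_op (k - i) x')) ws) = 0"
proof (cases "k = 0")
  case False
  then have "degenerate_op k = (\<lambda>x. 0 :: 'v)"
    "mul (degenerate_op i x) (degenerate_op (k - i) x') = 0" for i x x'
    by (auto simp: degenerate_op_def mul_zero fun_eq_iff)
  then show ?thesis
    by (simp add: z2_linear_zero[OF d_linear])
next
  case True
  consider "ws = []" | a where "ws = [a]" | a b where "ws = [a, b]" | a b c vs where "ws = a # b # c # vs"
    by (metis list.exhaust)
  then show ?thesis
    using True
    by cases (simp_all add: degenerate_op_def[abs_def] bar_sum_Cons cut_sum_Cons mul_zero z2_linear_zero[OF d_linear]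
      add_self_zero)
qed

text \<open>The structure equation for nonempty arguments extends to all arguments.\<close>

lemma op_ext_differential:
  assumes E: "\<And>k as bs. as \<noteq> [] \<Longrightarrow> bs \<noteq> [] \<Longrightarrow>
      d (E k as bs)
      + (\<Sum>i<length as. E k (as[i := d (as ! i)]) bs)
      + (\<Sum>i<length bs. E k as (bs[i := d (bs ! i)]))
      + (\<Sum>i<length as - 1. op_ext E k (mul_at mul i as) bs)
      + (\<Sum>i<length bs - 1. op_ext E k as (mul_at mul i bs))
      + (\<Sum>i\<le>k. \<Sum>(p, q)\<in>{..length as} \<times> {..length bs} - {(0, 0), (length as, length bs)}.
           mul (op_ext E i (take p as) (take q bs))
               ((op_swap ^^ i) (op_ext E (k - i)) (drop p as) (drop q bs)))
      = (if k = 0 then 0 else E (k - 1) as bs + E (k - 1) bs as)"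
  shows "d (op_ext E k us vs) + bar_sum d mul (\<lambda>x. op_ext E k x vs) us + bar_sum d mul (op_ext E k us) vs
      + (\<Sum>i\<le>k. cut_sum2 (\<lambda>x y x' y'. mul (op_ext E i x y) ((op_swap ^^ i) (op_ext E (k - i)) x' y')) us vs)
      = (if k = 0 then 0 else op_ext E (k - 1) us vs + op_ext E (k - 1) vs us)"
proof -
  consider "us = []" | "vs = []" | "us \<noteq> []" "vs \<noteq> []"
    by blast
  then show ?thesis
  proof cases
    case 1
    then show ?thesis
      using degenerate_op_differential[of k vs]
      by (simp add: op_ext_Nil op_swap_op_ext_Nil cut_sum2_def add_self_zero)
  next
    case 2
    then show ?thesis
      using degenerate_op_differential[of k us]
      by (simp add: op_ext_Nil op_swap_op_ext_Nil cut_sum2_def add_self_zero)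
  next
    case 3
    have "cut_sum2 (\<lambda>x y x' y'. mul (op_ext E i x y) ((op_swap ^^ i) (op_ext E (k - i)) x' y')) us vs =
        (\<Sum>(p, q)\<in>{..length us} \<times> {..length vs} - {(0, 0), (length us, length vs)}.
           mul (op_ext E i (take p us) (take q vs))
               ((op_swap ^^ i) (op_ext E (k - i)) (drop p us) (drop q vs)))" for i
      unfolding cut_sum2_def cut_sum_def sum.cartesian_product
      by (rule sum.mono_neutral_right)
        (auto simp: op_ext_Nil degenerate_op_def op_swap_op_ext_Nil mul_zero)
    moreover have "us[i := a] \<noteq> []" "vs[i := a] \<noteq> []" for i a
      using 3 by simp_all
    ultimately show ?thesis
      using E[OF 3, of k] 3 unfolding bar_sum_def by (simp add: op_ext_nonempty ac_simps)
  qed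
qed

end


section \<open>Restriction to the augmentation ideal\<close>

lemma insert_args_nonempty: "insert_args E bs cs ks ls \<noteq> []" if "bs \<noteq> []"
  using that by (auto simp: insert_args_def Let_def intro!: bexI[of _ 0])

lemma insert_args_map:
  assumes "\<And>b xs. h (hga_ext E' b xs) = hga_ext E (h b) (map h xs)"
  shows "map h (insert_args E' bs cs ks ls) = insert_args E (map h bs) (map h cs) ks ls"
  by (simp add: insert_args_def Let_def map_concat comp_def segment_def assms take_map drop_map)
    (intro arg_cong[where f = concat] map_cong refl, simp)

lemma mul_at_map:
  "map h (mul_at mul' i xs) = mul_at mul i (map h xs)"
  if "\<And>x y. h (mul' x y) = mul (h x) (h y)" "i < length xs - 1"
  using that by (simp add: mul_at_def take_map drop_map)

locale augmentation_ideal =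
  extended_homotopy_G_algebra gr d mul one E + augmented_dg_algebra gr d mul one aug
  for gr :: "int \<Rightarrow> 'a::z2_vector set" and d mul one E aug +
  fixes Rep :: "'v::z2_vector \<Rightarrow> 'a" and Abs :: "'a \<Rightarrow> 'v"
  assumes ideal: "type_definition Rep Abs {a. aug a = 0}"
    and Rep_linear: "z2_linear Rep"
    and op_ideal: "as \<noteq> [] \<Longrightarrow> bs \<noteq> [] \<Longrightarrow> set as \<union> set bs \<subseteq> {a. aug a = 0} \<Longrightarrow> aug (E k as bs) = 0"
begin

definition "gr' n = Rep -` gr n"
definition "d' = map_fun Rep Abs d"
definition "mul' = map_fun Rep (map_fun Rep Abs) mul"
definition "E' k = map_fun (map Rep) (map_fun (map Rep) Abs) (E k)"

abbreviation "F \<equiv> op_ext E'"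

lemma aug_Rep: "aug (Rep x) = 0"
  using type_definition.Rep[OF ideal, of x] by simp

lemma Rep_Abs: "Rep (Abs a) = a" if "aug a = 0"
  using type_definition.Abs_inverse[OF ideal, of a] that by simp

lemma Rep_eqI: "x = y" if "Rep x = Rep y"
  using that type_definition.Rep_inject[OF ideal] by simp

lemmas Rep_add = z2_linearD[OF Rep_linear]
  and Rep_zero = z2_linear_zero[OF Rep_linear]
  and Rep_sum = z2_linear_sum[OF Rep_linear]

lemma Rep_d: "Rep (d' x) = d (Rep x)"
  by (simp add: d'_def Rep_Abs aug_d)

lemma Rep_mul: "Rep (mul' x y) = mul (Rep x) (Rep y)"
  by (simp add: mul'_def Rep_Abs aug_mul aug_Rep)

lemma Rep_op: "Rep (E' k as bs) = E k (map Rep as) (map Rep bs)" if "as \<noteq> []" "bs \<noteq> []"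
proof -
  have "aug (E k (map Rep as) (map Rep bs)) = 0"
    using that by (intro op_ideal) (auto simp: aug_Rep)
  then show ?thesis
    by (simp add: E'_def Rep_Abs)
qed

lemma Rep_op_ext: "Rep (F k as bs) = op_ext E k (map Rep as) (map Rep bs)"
proof -
  have "Rep (hd xs) = hd (map Rep xs)" if "length xs = 1" for xs :: "'v list"
    using that by (cases xs) simp_all
  then show ?thesis
    by (simp add: op_ext_def Rep_op Rep_zero)
qed

text \<open>The components of an element of the augmentation ideal lie in the ideal: those of nonzero degree
because the augmentation has degree zero, and then the one of degree zero by linearity.\<close>

lemma ideal_grading: "z2_grading gr'"
proof (rule z2_gradingI)
  have aug_sum: "aug (\<Sum>i\<in>A. f i) = (\<Sum>i\<in>A. aug (f i))" for A and f :: "int \<Rightarrow> 'a"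
    by (rule z2_linear_sum[OF aug_linear])
  have aug_component: "aug (component gr (Rep x) n) = 0" for x n
  proof (cases "n = 0")
    case False
    then show ?thesis
      by (rule aug_degree[OF component_props(1)[OF grading]])
  next
    case True
    let ?S = "{n. component gr (Rep x) n \<noteq> 0}"
    have "(\<Sum>n\<in>?S. aug (component gr (Rep x) n)) = (\<Sum>n\<in>?S. if n = 0 then aug (component gr (Rep x) 0) else 0)"
      by (intro sum.cong refl) (auto intro: aug_degree[OF component_props(1)[OF grading]])
    also have "\<dots> = aug (component gr (Rep x) 0)"
      using component_props(2)[OF grading, of "Rep x"] z2_linear_zero[OF aug_linear] by simp
    finally show ?thesis
      using True aug_Rep[of x] component_props(3)[OF grading, of "Rep x"] by (simp flip: aug_sum)
  qed
  define P where "P n x = Abs (component gr (Rep x) n)" for n x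
  have Rep_P: "Rep (P n x) = component gr (Rep x) n" for n x
    by (simp add: P_def Rep_Abs aug_component)
  show sub: "z2.subspace (gr' n)" for n
    unfolding gr'_def vimage_def by (rule z2_subspace_vimage[OF Rep_linear grading_subspace[OF grading]])
  show "z2_linear (P n)" for n
    by (intro z2_linearI Rep_eqI) (simp add: Rep_P Rep_add component_add[OF grading])
  show "P n x = (if n = m then x else 0)" if "x \<in> gr' m" for m n x
    using that by (intro Rep_eqI) (simp add: Rep_P gr'_def component_homogeneous[OF grading] Rep_zero)
  show "x \<in> z2.span (\<Union>n. gr' n)" for x
  proof -
    let ?S = "{n. component gr (Rep x) n \<noteq> 0}"
    have "x = (\<Sum>n\<in>?S. P n x)"
      by (rule Rep_eqI) (simp add: Rep_sum Rep_P component_props[OF grading])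
    moreover have "P n x \<in> gr' n" for n
      by (simp add: gr'_def Rep_P component_props[OF grading])
    then have "(\<Sum>n\<in>?S. P n x) \<in> z2.span (\<Union>n. gr' n)"
      by (intro z2.span_sum z2.span_base) blast
    ultimately show ?thesis
      by simp
  qed
qed

lemma ideal_dg_algebra: "nonunital_dg_algebra gr' d' mul'"
proof (intro nonunital_dg_algebra.intro nonunital_dg_algebra_axioms.intro cochain_complex.intro
    ideal_grading)
  note mul = z2_bilinear_add[OF mul_bilinear]
  show "z2_linear d'"
    by (intro z2_linearI Rep_eqI) (simp add: Rep_d Rep_add z2_linearD[OF d_linear])
  show "d' x \<in> gr' (n + 1)" if "x \<in> gr' n" for x n
    using that by (simp add: gr'_def Rep_d d_degree)
  show "d' (d' x) = 0" for x
    by (rule Rep_eqI) (simp add: Rep_d d_d Rep_zero)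
  show "z2_bilinear mul'"
    by (intro z2_bilinearI Rep_eqI) (simp_all add: Rep_mul Rep_add mul)
  show "mul' x y \<in> gr' (m + n)" if "x \<in> gr' m" "y \<in> gr' n" for x y m n
    using that by (simp add: gr'_def Rep_mul mul_degree)
  show "mul' (mul' x y) z = mul' x (mul' y z)" for x y z
    by (rule Rep_eqI) (simp add: Rep_mul mul_assoc)
  show "d' (mul' x y) = mul' (d' x) y + mul' x (d' y)" for x y
    by (rule Rep_eqI) (simp add: Rep_mul Rep_d Rep_add leibniz)
qed

lemma ideal_op_differential:
  assumes ne: "as \<noteq> []" "bs \<noteq> []"
  shows "d' (E' k as bs)
      + (\<Sum>i<length as. E' k (as[i := d' (as ! i)]) bs)
      + (\<Sum>i<length bs. E' k as (bs[i := d' (bs ! i)]))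
      + (\<Sum>i<length as - 1. F k (mul_at mul' i as) bs)
      + (\<Sum>i<length bs - 1. F k as (mul_at mul' i bs))
      + (\<Sum>i\<le>k. \<Sum>(p, q)\<in>{..length as} \<times> {..length bs} - {(0, 0), (length as, length bs)}.
           mul' (F i (take p as) (take q bs)) ((op_swap ^^ i) (F (k - i)) (drop p as) (drop q bs)))
      = (if k = 0 then 0 else E' (k - 1) as bs + E' (k - 1) bs as)"
proof (rule Rep_eqI)
  have swap: "Rep ((op_swap ^^ i) (F j) xs ys) = (op_swap ^^ i) (op_ext E j) (map Rep xs) (map Rep ys)"
    for i j xs ys
    by (simp add: op_swap_funpow Rep_op_ext)
  have mul_at: "map Rep (mul_at mul' i xs) = mul_at mul i (map Rep xs)" if "i < length xs - 1" for i xs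
    by (rule mul_at_map[where h = Rep and mul' = mul' and mul = mul, OF Rep_mul that])
  show "Rep (d' (E' k as bs)
      + (\<Sum>i<length as. E' k (as[i := d' (as ! i)]) bs)
      + (\<Sum>i<length bs. E' k as (bs[i := d' (bs ! i)]))
      + (\<Sum>i<length as - 1. F k (mul_at mul' i as) bs)
      + (\<Sum>i<length bs - 1. F k as (mul_at mul' i bs))
      + (\<Sum>i\<le>k. \<Sum>(p, q)\<in>{..length as} \<times> {..length bs} - {(0, 0), (length as, length bs)}.
           mul' (F i (take p as) (take q bs)) ((op_swap ^^ i) (F (k - i)) (drop p as) (drop q bs))))
      = Rep (if k = 0 then 0 else E' (k - 1) as bs + E' (k - 1) bs as)"
    using op_differential[of "map Rep as" "map Rep bs" k] ne
    by (simp add: Rep_add Rep_sum Rep_d Rep_op Rep_mul Rep_op_ext Rep_zero swap mul_at map_update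
        split_beta take_map drop_map)
qed

lemma ideal_op_multilinear:
  assumes "ws \<noteq> []"
  shows "z2_multilinear (\<lambda>as. E' k as ws)" "z2_multilinear (\<lambda>bs. E' k ws bs)"
proof -
  note lin = op_multilinear_left[of "map Rep ws" k] op_multilinear_right[of "map Rep ws" k]
  show "z2_multilinear (\<lambda>as. E' k as ws)"
    using assms z2_multilinearD[OF lin(1)]
    by (intro z2_multilinearI Rep_eqI) (simp add: Rep_op Rep_add)
  show "z2_multilinear (\<lambda>bs. E' k ws bs)"
    using assms z2_multilinearD[OF lin(2)]
    by (intro z2_multilinearI Rep_eqI) (simp add: Rep_op Rep_add)
qed

lemma ideal_word_operations: "word_operations F"
proof
  show "F k [] [] = 0" for k
    by (simp add: op_ext_Nil degenerate_op_def)
  show "z2_multilinear (\<lambda>xs. F k xs ys)" for k ys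
  proof (cases "ys = []")
    case True
    then show ?thesis
      by (simp add: op_ext_Nil degenerate_op_multilinear)
  next
    case False
    then show ?thesis
      using z2_multilinearD[OF ideal_op_multilinear(1)[OF False]]
      by (intro z2_multilinearI) (simp add: op_ext_nonempty)
  qed
  show "z2_multilinear (\<lambda>ys. F k xs ys)" for k xs
  proof (cases "xs = []")
    case True
    then show ?thesis
      by (simp add: op_ext_Nil degenerate_op_multilinear)
  next
    case False
    then show ?thesis
      using z2_multilinearD[OF ideal_op_multilinear(2)[OF False]]
      by (intro z2_multilinearI) (simp add: op_ext_nonempty)
  qed
qed

lemma ideal_op_degree:
  assumes xs: "homogeneous_word gr' xs m" and ys: "homogeneous_word gr' ys n"
  shows "F k xs ys \<in> gr' (m + n + 1 - int k)"
proof -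
  have sub: "0 \<in> gr' j" for j
    using z2.subspace_0[OF grading_subspace[OF grading]] by (simp add: gr'_def Rep_zero)
  have single: "degenerate_op k ws \<in> gr' (j + 1 - int k)"
    if "homogeneous_word gr' ws j" for ws j
    using that sub by (auto simp: degenerate_op_def length_Suc_conv)
  consider "xs = []" | "ys = []" | "xs \<noteq> []" "ys \<noteq> []"
    by blast
  then show ?thesis
  proof cases
    case 1
    then show ?thesis
      using single[OF ys] xs by (simp add: op_ext_Nil)
  next
    case 2
    then show ?thesis
      using single[OF xs] ys by (simp add: op_ext_Nil)
  next
    case 3
    have deg: "\<exists>js. list_all2 (\<lambda>a j. a \<in> gr j) (map Rep ws) js \<and> j = sum_list js - int (length ws)"
      if "homogeneous_word gr' ws j" for ws j
    proof -
      obtain js where js: "list_all2 (\<lambda>w j. w \<in> gr' j) ws js" "j = (\<Sum>j\<leftarrow>js. j - 1)"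
        using \<open>homogeneous_word gr' ws j\<close> unfolding homogeneous_word_iff by blast
      have "(\<Sum>j\<leftarrow>js. j - 1) = sum_list js - int (length js)"
        by (induction js) simp_all
      with js show ?thesis
        by (intro exI[of _ js]) (auto simp: gr'_def list_all2_map1 dest: list_all2_lengthD)
    qed
    obtain ms ns where
      ms: "list_all2 (\<lambda>a j. a \<in> gr j) (map Rep xs) ms" "m = sum_list ms - int (length xs)" and
      ns: "list_all2 (\<lambda>a j. a \<in> gr j) (map Rep ys) ns" "n = sum_list ns - int (length ys)"
      using deg[OF xs] deg[OF ys] by blast
    then show ?thesis
      using op_degree[OF _ _ ms(1) ns(1), of k] 3
      by (simp add: gr'_def op_ext_nonempty Rep_op) (simp add: algebra_simps)
  qed
qed

lemma ideal_brace_operations: "brace_operations F"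
proof (intro brace_operations.intro brace_operations_axioms.intro ideal_word_operations)
  show "F 0 [] ys = (if length ys = 1 then hd ys else 0)" "F 0 [a] [] = a" for ys a
    by (simp_all add: op_ext_Nil degenerate_op_def)
  show "F 0 xs ys = 0" if "length xs > 1" for xs ys
  proof (cases "ys = []")
    case False
    then show ?thesis
      using that by (intro Rep_eqI, cases xs) (simp_all add: op_ext_nonempty Rep_op Rep_zero op_0_vanish)
  qed (use that in \<open>simp add: op_ext_Nil degenerate_op_def\<close>)
  show "F 0 [F 0 [a] bs] cs = (\<Sum>(ks, ls)\<in>insertions (length bs) (length cs).
      F 0 [a] (insert_args (\<lambda>a. F 0 [a]) bs cs ks ls))" if "bs \<noteq> []" "cs \<noteq> []" for a bs cs
  proof (rule Rep_eqI)
    interpret brace: homotopy_G_algebra gr d mul one "\<lambda>a bs. E 0 [a] bs"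
      by (rule op_0_homotopy_G_algebra)
    have hga: "Rep (hga_ext (\<lambda>a. F 0 [a]) b ws) = hga_ext (\<lambda>a. E 0 [a]) (Rep b) (map Rep ws)" for b ws
      by (cases "ws = []")
        (simp_all add: hga_ext_def op_ext_Nil degenerate_op_def op_ext_nonempty Rep_op)
    have ne: "insert_args (\<lambda>a. E 0 [a]) (map Rep bs) (map Rep cs) ks ls \<noteq> []" for ks ls
      using that by (simp add: insert_args_nonempty)
    have "Rep (F 0 [F 0 [a] bs] cs) = E 0 [E 0 [Rep a] (map Rep bs)] (map Rep cs)"
      using that by (simp add: op_ext_nonempty Rep_op)
    also have "\<dots> = (\<Sum>(ks, ls)\<in>insertions (length bs) (length cs).
        E 0 [Rep a] (insert_args (\<lambda>a. E 0 [a]) (map Rep bs) (map Rep cs) ks ls))"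
      using brace.E_composition[of "map Rep bs" "map Rep cs" "Rep a"] that by simp
    also have "\<dots> = Rep (\<Sum>(ks, ls)\<in>insertions (length bs) (length cs).
        F 0 [a] (insert_args (\<lambda>a. F 0 [a]) bs cs ks ls))"
      by (simp add: Rep_sum split_beta Rep_op_ext insert_args_map[OF hga] op_ext_nonempty ne)
    finally show "Rep (F 0 [F 0 [a] bs] cs) = Rep (\<Sum>(ks, ls)\<in>insertions (length bs) (length cs).
        F 0 [a] (insert_args (\<lambda>a. F 0 [a]) bs cs ks ls))" .
  qed
qed

lemma ideal_steenrod_operations: "steenrod_operations gr' d' mul' F"
proof -
  interpret N: nonunital_dg_algebra gr' d' mul'
    by (rule ideal_dg_algebra)
  interpret W: word_operations F
    by (rule ideal_word_operations)
  have "bar_operations gr' d' mul' F"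
  proof (intro bar_operations.intro bar_operations_axioms.intro ideal_dg_algebra
      ideal_word_operations)
    show "F k xs ys \<in> gr' (m + n + 1 - int k)"
      if "homogeneous_word gr' xs m" "homogeneous_word gr' ys n" for xs ys m n k
      using that by (rule ideal_op_degree)
    show "d' (F k us vs) + bar_sum d' mul' (\<lambda>x. F k x vs) us + bar_sum d' mul' (F k us) vs
        + (\<Sum>i\<le>k. cut_sum2 (\<lambda>x y x' y'. mul' (F i x y) (W.Fs i (k - i) x' y')) us vs)
        = (if k = 0 then 0 else F (k - 1) us vs + F (k - 1) vs us)" for k us vs
      unfolding W.Fs_def by (rule N.op_ext_differential) (rule ideal_op_differential)
  qed
  then show ?thesis
    by (intro steenrod_operations.intro ideal_brace_operations)
qed

lemma bar_cup_eq: "bar_cup E' = word_operations.cup F"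
proof -
  interpret W: word_operations F
    by (rule ideal_word_operations)
  show ?thesis
    by (simp add: fun_eq_iff bar_cup_def W.cup_def W.cup_words_def[abs_def] bar_cup_words_def[abs_def])
qed

end

theorem proposition2:
  fixes gr :: "int \<Rightarrow> 'a::z2_vector set"
    and d :: "'a \<Rightarrow> 'a"
    and mul :: "'a \<Rightarrow> 'a \<Rightarrow> 'a"
    and one :: 'a
    and aug :: "'a \<Rightarrow> bit"
    and E :: "nat \<Rightarrow> 'a list \<Rightarrow> 'a list \<Rightarrow> 'a"
    and Rep :: "'v::z2_vector \<Rightarrow> 'a"
    and Abs :: "'a \<Rightarrow> 'v"
  assumes "extended_homotopy_G_algebra gr d mul one E"
    and "augmented_dg_algebra gr d mul one aug"
    and "type_definition Rep Abs {a. aug a = 0}" and "z2_linear Rep"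
    and "\<And>k as bs. as \<noteq> [] \<Longrightarrow> bs \<noteq> [] \<Longrightarrow> set as \<union> set bs \<subseteq> {a. aug a = 0} \<Longrightarrow>
           aug (E k as bs) = 0"
  shows "steenrod_dg_hopf_algebra
           (bar_grading (\<lambda>n. Rep -` gr n))
           (bar_d (map_fun Rep Abs d) (map_fun Rep (map_fun Rep Abs) mul))
           bar_comult
           bar_counit
           (bar_cup (\<lambda>k. map_fun (map Rep) (map_fun (map Rep) Abs) (E k)))
           (word [])"
proof -
  interpret I: augmentation_ideal gr d mul one E aug Rep Abs
    using assms by (intro augmentation_ideal.intro augmentation_ideal_axioms.intro)
  interpret S: steenrod_operations I.gr' I.d' I.mul' I.F
    by (rule I.ideal_steenrod_operations)
  show ?thesis
    using S.bar_steenrod_dg_hopf_algebra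
    unfolding I.bar_cup_eq[symmetric]
    unfolding I.gr'_def[abs_def] I.d'_def I.mul'_def I.E'_def[abs_def] .
qed

end
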